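(* Let $d\ge 1$ be an integer and let $(U_i)_{i\ge 1}$ be a sequence of non-empty open subsets of the torus $\mathbb{T}^d$. Let $v=(v_i)_{i\ge 1}$ be a sequence of independent random vectors, each uniformly distributed on $\mathbb{T}^d$. Put $V_i(v_i)=U_i+v_i$ and \[ E(v)=\limsup_{i\to\infty}V_i(v_i)=\bigcap_{n\ge 1}\bigcup_{i\ge n}V_i(v_i). \] Define \[ s=\inf\Bigl\{\,t\in(0,d] : \sum_{i=1}^\infty \frac{\lambda(U_i)^2}{I_t(U_i)}<\infty \ \text{ or } \ t=d\,\Bigr\}. \] Then almost surely $E(v)\in\mathscr{G}^s(\mathbb{T}^d)$.
   Context: $\mathbb{T}^d=\mathbb{R}^d/\mathbb{Z}^d$ is the $d$-dimensional torus, with addition inherited from $\mathbb{R}^d$, and $|x-y|$ denotes the distance between the points $x,y\in\mathbb{T}^d$ (the quotient of the Euclidean distance). $\lambda$ denotes the $d$-dimensional Lebesgue measure on $\mathbb{T}^d$ (so $\lambda(\mathbb{T}^d)=1$); "uniformly distributed" means with law $\lambda$. For $0<t<d$ and $A\subset\mathbb{T}^d$ measurable, the $t$-energy of $A$ is \[ I_t(A)=\iint_{A\times A}|x-y|^{-t}\,\mathrm{d}x\,\mathrm{d}y . \] In the set defining $s$, the summability condition is considered for $0<t<d$, and $t=d$ always belongs to the set. Large intersection classes (Falconer). Identify $\mathbb{T}^d$ with $[0,1)^d$. A dyadic cube is a set of the form $\prod_{j=1}^d[k_j2^{-n},(k_j+1)2^{-n})$ with integers $n\ge 0$ and $0\le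 k_j<2^n$; $|Q|$ denotes the diameter of the cube $Q$. For $t>0$ and $A\subset\mathbb{T}^d$ let \[ \mathcal{M}^t_\infty(A)=\inf\Bigl\{\sum_j|Q_j|^t : (Q_j)\text{ a countable family of dyadic cubes with } A\subset\bigcup_jQ_j\Bigr\}. \] The class $\mathscr{G}^s(\mathbb{T}^d)$ consists of all $G_\delta$ sets $A\subset\mathbb{T}^d$ such that $\mathcal{M}^t_\infty(A\cap Q)=\mathcal{M}^t_\infty(Q)$ for every $0<t<s$ and every dyadic cube $Q$ (for $s=0$ this condition is empty). For $0<s\le d$, countable intersections of sets in $\mathscr{G}^s(\mathbb{T}^d)$ belong to $\mathscr{G}^s(\mathbb{T}^d)$, and every set in $\mathscr{G}^s(\mathbb{T}^d)$ has Hausdorff dimension at least $s$. *)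

theory Defs
  imports "HOL-Probability.Probability"
begin

text \<open>The torus \<open>\<real>\<^sup>d / \<int>\<^sup>d\<close>, with \<open>d = CARD('n)\<close>, is represented by its fundamental domain
  \<open>[0,1)\<^sup>d\<close> in \<open>real ^ 'n\<close>; subsets of the torus are sets contained in \<open>torus\<close>.\<close>

definition torus :: "(real ^ 'n::finite) set" where
  "torus = {x. \<forall>j. 0 \<le> x $ j \<and> x $ j < 1}"

definition int_lattice :: "(real ^ 'n::finite) set" where
  "int_lattice = {k. \<forall>j. k $ j \<in> \<int>}"

definition torus_proj :: "real ^ 'n::finite \<Rightarrow> real ^ 'n" where
  "torus_proj x = (\<chi> j. frac (x $ j))"

definition torus_translate :: "real ^ 'n::finite \<Rightarrow> (real ^ 'n) set \<Rightarrow> (real ^ 'n) set" where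
  "torus_translate v A = (\<lambda>x. torus_proj (x + v)) ` A"

definition torus_dist :: "real ^ 'n::finite \<Rightarrow> real ^ 'n \<Rightarrow> real" where
  "torus_dist x y = (INF k\<in>int_lattice. norm (x - y + k))"

definition torus_topology :: "(real ^ 'n::finite) topology" where
  "torus_topology = Metric_space.mtopology torus torus_dist"

definition torus_measure :: "(real ^ 'n::finite) measure" where
  "torus_measure = restrict_space lborel torus"

text \<open>The kernel is written as an \<open>ennreal\<close> inverse so that it is \<open>\<infinity>\<close> (and not \<open>0 powr _ = 0\<close>)
  on the diagonal.\<close>

definition torus_energy :: "real \<Rightarrow> (real ^ 'n::finite) set \<Rightarrow> ennreal" where
  "torus_energy t A =
     (\<integral>\<^sup>+p\<in>A \<times> A. inverse (ennreal (torus_dist (fst p) (snd p) powr t))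
        \<partial>(torus_measure \<Otimes>\<^sub>M torus_measure))"

definition dyadic_cube :: "nat \<Rightarrow> ('n \<Rightarrow> nat) \<Rightarrow> (real ^ 'n::finite) set" where
  "dyadic_cube n k = {x. \<forall>j. real (k j) / 2 ^ n \<le> x $ j \<and> x $ j < (real (k j) + 1) / 2 ^ n}"

definition dyadic_cubes :: "(real ^ 'n::finite) set set" where
  "dyadic_cubes = {dyadic_cube n k |n k. \<forall>j. k j < 2 ^ n}"

text \<open>Countable families, finite ones included, are indexed by arbitrary sets of naturals.
  \<open>diameter\<close> is the Euclidean diameter of the cube in \<open>[0,1)\<^sup>d\<close>.\<close>

definition dyadic_net_content :: "real \<Rightarrow> (real ^ 'n::finite) set \<Rightarrow> ennreal" where
  "dyadic_net_content t A =
     Inf {(\<Sum>\<^sub>\<infinity>j\<in>J. ennreal (diameter (Q j) powr t)) |(J :: nat set) Q.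
            (\<forall>j\<in>J. Q j \<in> dyadic_cubes) \<and> A \<subseteq> (\<Union>j\<in>J. Q j)}"

definition large_intersection_class :: "real \<Rightarrow> (real ^ 'n::finite) set set" where
  "large_intersection_class s =
     {A. gdelta_in torus_topology A \<and>
         (\<forall>t Q. 0 < t \<and> t < s \<and> Q \<in> dyadic_cubes \<longrightarrow>
            dyadic_net_content t (A \<inter> Q) = dyadic_net_content t Q)}"

definition energy_exponent :: "(nat \<Rightarrow> (real ^ 'n::finite) set) \<Rightarrow> real" where
  "energy_exponent U =
     Inf {t. 0 < t \<and> t \<le> real CARD('n) \<and>
             ((t < real CARD('n) \<and>
                 (\<Sum>i. emeasure torus_measure (U i) ^ 2 / torus_energy t (U i)) < \<infinity>)
              \<or> t = real CARD('n))}"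


subsection \<open>Basic facts about the torus\<close>

lemma zero_in_int_lattice: "0 \<in> int_lattice"
  by (simp add: int_lattice_def)

lemma int_lattice_add: "k \<in> int_lattice \<Longrightarrow> l \<in> int_lattice \<Longrightarrow> k + l \<in> int_lattice"
  by (simp add: int_lattice_def)

lemma int_lattice_minus: "k \<in> int_lattice \<Longrightarrow> - k \<in> int_lattice"
  by (simp add: int_lattice_def)

lemma torus_dist_le: "k \<in> int_lattice \<Longrightarrow> torus_dist x y \<le> norm (x - y + k)"
  unfolding torus_dist_def by (rule cINF_lower) (auto intro!: bdd_belowI[of _ 0])

lemma torus_dist_greatest:
  "(\<And>k. k \<in> int_lattice \<Longrightarrow> c \<le> norm (x - y + k)) \<Longrightarrow> c \<le> torus_dist x y"
  unfolding torus_dist_def using zero_in_int_lattice by (intro cINF_greatest) auto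

lemma torus_dist_lessD:
  assumes "torus_dist x y < r"
  obtains k where "k \<in> int_lattice" "norm (x - y + k) < r"
  using assms torus_dist_greatest[of r x y] by (meson not_le)

lemma torus_proj_in_torus: "torus_proj x \<in> torus"
  by (simp add: torus_proj_def torus_def frac_lt_1)

lemma torus_proj_lattice: "torus_proj x - x \<in> int_lattice"
  by (simp add: torus_proj_def int_lattice_def frac_def)

lemma torus_proj_eq:
  assumes "x \<in> torus" "x - y \<in> int_lattice" shows "torus_proj y = x"
  unfolding vec_eq_iff
proof
  fix j
  show "torus_proj y $ j = x $ j"
    using assms frac_unique_iff[of "y $ j" "x $ j"] Ints_minus[of "x $ j - y $ j"]
    by (auto simp: torus_proj_def torus_def int_lattice_def)
qed

lemma torus_proj_ident: "x \<in> torus \<Longrightarrow> torus_proj x = x"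
  by (rule torus_proj_eq) (simp_all add: zero_in_int_lattice)

lemma Metric_space_torus:
  "Metric_space (torus :: (real ^ 'n::finite) set) torus_dist"
proof
  fix x y z :: "real ^ 'n"
  show "0 \<le> torus_dist x y"
    by (rule torus_dist_greatest) simp
  have le: "torus_dist x y \<le> torus_dist y x" for x y :: "real ^ 'n"
  proof (rule torus_dist_greatest)
    fix k :: "real ^ 'n" assume "k \<in> int_lattice"
    then show "torus_dist x y \<le> norm (y - x + k)"
      using torus_dist_le[OF int_lattice_minus, of k x y] norm_minus_cancel[of "y - x + k"]
      by (simp add: algebra_simps)
  qed
  show "torus_dist x y = torus_dist y x"
    by (intro antisym le)
  show "torus_dist x z \<le> torus_dist x y + torus_dist y z"
  proof (rule field_le_epsilon)
    fix e :: real assume "0 < e"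
    obtain k where k: "k \<in> int_lattice" "norm (x - y + k) < torus_dist x y + e / 2"
      using torus_dist_lessD[of x y "torus_dist x y + e / 2"] \<open>0 < e\<close> by auto
    obtain l where l: "l \<in> int_lattice" "norm (y - z + l) < torus_dist y z + e / 2"
      using torus_dist_lessD[of y z "torus_dist y z + e / 2"] \<open>0 < e\<close> by auto
    have "torus_dist x z \<le> norm (x - z + (k + l))"
      by (intro torus_dist_le int_lattice_add k l)
    also have "x - z + (k + l) = (x - y + k) + (y - z + l)"
      by simp
    also have "norm \<dots> \<le> norm (x - y + k) + norm (y - z + l)"
      by (rule norm_triangle_ineq)
    finally show "torus_dist x z \<le> torus_dist x y + torus_dist y z + e"
      using k(2) l(2) by linarith
  qed
  assume xy: "x \<in> torus" "y \<in> torus"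
  show "torus_dist x y = 0 \<longleftrightarrow> x = y"
  proof
    assume "x = y"
    then show "torus_dist x y = 0"
      using torus_dist_le[OF zero_in_int_lattice, of x y] \<open>0 \<le> torus_dist x y\<close> by simp
  next
    assume zero: "torus_dist x y = 0"
    show "x = y"
    proof (rule ccontr)
      assume "x \<noteq> y"
      then obtain j where j: "x $ j \<noteq> y $ j"
        by (auto simp: vec_eq_iff)
      define a where "a = \<bar>x $ j - y $ j\<bar>"
      have bounds: "0 \<le> x $ j" "x $ j < 1" "0 \<le> y $ j" "y $ j < 1"
        using xy by (auto simp: torus_def)
      then have a: "0 < a" "a < 1"
        using j by (auto simp: a_def)
      have "min a (1 - a) \<le> torus_dist x y"
      proof (rule torus_dist_greatest)
        fix k :: "real ^ 'n" assume "k \<in> int_lattice"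
        then obtain m :: int where m: "k $ j = of_int m"
          by (auto simp: int_lattice_def elim!: Ints_cases)
        consider "m = 0" | "1 \<le> m" | "m \<le> -1" by linarith
        then have "min a (1 - a) \<le> \<bar>x $ j - y $ j + of_int m\<bar>"
          by cases (auto simp: a_def)
        also have "\<dots> \<le> norm (x - y + k)"
          using component_le_norm_cart[of "x - y + k" j] by (simp add: m)
        finally show "min a (1 - a) \<le> norm (x - y + k)" .
      qed
      with zero a show False by auto
    qed
  qed
qed

lemma topspace_torus_topology: "topspace torus_topology = torus"
  unfolding torus_topology_def by (rule Metric_space.topspace_mtopology[OF Metric_space_torus])

lemma openin_torus_topology_iff:
  "openin torus_topology U \<longleftrightarrow> U \<subseteq> torus \<and> open (torus_proj -` U)"
proof -
  interpret Metric_space "torus :: (real ^ 'n) set" torus_dist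
    by (rule Metric_space_torus)
  show ?thesis
    unfolding torus_topology_def openin_mtopology
  proof (intro conj_cong refl iffI)
    assume U: "\<forall>x. x \<in> U \<longrightarrow> (\<exists>r>0. mball x r \<subseteq> U)"
    show "open (torus_proj -` U)"
      unfolding open_dist
    proof (intro ballI)
      fix x assume "x \<in> torus_proj -` U"
      then obtain r where r: "r > 0" "mball (torus_proj x) r \<subseteq> U"
        using U by auto
      have "torus_proj y \<in> U" if "dist y x < r" for y
      proof -
        have "(torus_proj y - y) + - (torus_proj x - x) \<in> int_lattice"
          by (intro int_lattice_add int_lattice_minus torus_proj_lattice)
        from torus_dist_le[OF this, of "torus_proj x" "torus_proj y"]
        have "torus_dist (torus_proj x) (torus_proj y) \<le> dist y x"
          unfolding dist_norm by (subst norm_minus_commute) (simp add: algebra_simps)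
        then have "torus_dist (torus_proj x) (torus_proj y) < r"
          using that by (rule le_less_trans)
        then show ?thesis
          using r(2) by (auto simp: torus_proj_in_torus)
      qed
      then show "\<exists>e>0. \<forall>y. dist y x < e \<longrightarrow> y \<in> torus_proj -` U"
        using r(1) by auto
    qed
  next
    assume sub: "U \<subseteq> torus" and op: "open (torus_proj -` U)"
    show "\<forall>x. x \<in> U \<longrightarrow> (\<exists>r>0. mball x r \<subseteq> U)"
    proof (intro allI impI)
      fix x assume x: "x \<in> U"
      then have "x \<in> torus_proj -` U"
        using sub by (auto simp: torus_proj_ident)
      then obtain r where r: "r > 0" "\<And>y. dist y x < r \<Longrightarrow> torus_proj y \<in> U"
        using op unfolding open_dist vimage_eq by blast
      have "mball x r \<subseteq> U"
      proof
        fix y assume "y \<in> mball x r"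
        then have y: "y \<in> torus" "torus_dist x y < r" by auto
        obtain k where k: "k \<in> int_lattice" "norm (x - y + k) < r"
          using torus_dist_lessD[OF y(2)] by blast
        have "torus_proj (y - k) \<in> U"
        proof (rule r(2))
          have "dist (y - k) x = norm (x - y + k)"
            unfolding dist_norm by (subst norm_minus_commute) (simp add: algebra_simps)
          then show "dist (y - k) x < r"
            using k(2) by simp
        qed
        moreover have "torus_proj (y - k) = y"
          using y(1) k(1) by (intro torus_proj_eq) auto
        ultimately show "y \<in> U" by simp
      qed
      then show "\<exists>r>0. mball x r \<subseteq> U"
        using r(1) by auto
    qed
  qed
qed

text \<open>The metric topology is the quotient topology of \<open>\<real>\<^sup>d / \<int>\<^sup>d\<close>.\<close>

lemma quotient_map_torus_proj: "quotient_map euclidean torus_topology torus_proj"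
proof -
  have "torus_proj ` UNIV = torus"
    by (metis image_subsetI rangeI subsetI subset_antisym torus_proj_ident torus_proj_in_torus)
  then show ?thesis
    by (auto simp: quotient_map_def topspace_torus_topology openin_torus_topology_iff vimage_def)
qed

lemma torus_in_borel: "torus \<in> sets borel"
proof -
  have "torus = (\<Inter>j. {x :: real ^ 'n. 0 \<le> x $ j} \<inter> {x. x $ j < 1})"
    by (auto simp: torus_def)
  also have "\<dots> \<in> sets borel"
    by (intro sets.finite_INT sets.Int borel_closed borel_open closed_halfspace_component_ge_cart
        open_halfspace_component_lt_cart) auto
  finally show ?thesis .
qed

lemma space_torus_measure: "space torus_measure = torus"
  by (simp add: torus_measure_def space_restrict_space)

lemma prob_space_torus_measure: "prob_space (torus_measure :: (real ^ 'n::finite) measure)"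
proof
  let ?T = "torus :: (real ^ 'n) set"
  have box: "box 0 1 \<subseteq> ?T" "?T \<subseteq> cbox 0 1"
    by (auto simp: torus_def mem_box_cart less_imp_le)
  have "emeasure lborel (box 0 (1 :: real ^ 'n)) = 1"
    by (simp add: emeasure_lborel_box_eq Basis_vec_def inner_axis prod.neutral)
  moreover have "emeasure lborel (cbox 0 (1 :: real ^ 'n)) = 1"
    by (simp add: emeasure_lborel_cbox_eq Basis_vec_def inner_axis prod.neutral)
  ultimately have "emeasure lborel ?T = 1"
    using emeasure_mono[OF box(1), of lborel] emeasure_mono[OF box(2), of lborel] torus_in_borel
    by (intro antisym) auto
  then show "emeasure (torus_measure :: (real ^ 'n) measure) (space torus_measure) = 1"
    using torus_in_borel emeasure_restrict_space[of ?T lborel ?T]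
    unfolding space_torus_measure by (simp add: torus_measure_def)
qed

end

theory Submission
  imports Defs
begin

text \<open>Fix \<open>0 < t < s\<close>. Then \<open>t < d\<close> and \<open>\<Sum>\<^sub>i \<lambda>(U\<^sub>i)\<^sup>2 / I\<^sub>t(U\<^sub>i) = \<infinity>\<close>. Write \<open>w(Q) = |Q|\<^sup>t\<close> for
  the weight of a dyadic cube. The sum of the weights of a family of cubes is its cost.

  \<^bold>\<open>A uniform bound by second moments.\<close> For a finite set \<open>I\<close> of indices consider the random density
  \<open>f = \<Sum>\<^sub>i a\<^sub>i 1\<^bsub>V\<^sub>i\<^esub>\<close> with \<open>a\<^sub>i = \<lambda>(U\<^sub>i) / I\<^sub>t(U\<^sub>i)\<close>, restricted to the interior of a cube \<open>R\<close>. By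
  independence and translation invariance its mean mass is \<open>S \<lambda>(R)\<close> and its mean energy is at most
  \<open>S\<^sup>2 I\<^sub>t(R) + S \<lambda>(R)\<close>, where \<open>S = \<Sum>\<^bsub>i\<in>I\<^esub> \<lambda>(U\<^sub>i)\<^sup>2 / I\<^sub>t(U\<^sub>i)\<close>; the weights \<open>a\<^sub>i\<close> are the ones for
  which the diagonal terms add up to \<open>S \<lambda>(R)\<close>. As \<open>I\<^sub>t(R) \<le> const \<lambda>(R)\<^sup>2 / w(R)\<close>, for large \<open>S\<close> the
  ratio mass\<open>\<^sup>2\<close>/energy is at least \<open>c w(R)\<close> with probability at least \<open>p\<close>, where \<open>c, p > 0\<close> depend
  only on \<open>t\<close> and \<open>d\<close> (\<open>prob_large_window\<close>). That ratio bounds from below the cost of every cover of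
  the set carrying the mass (\<open>cover_cost_ge_of_energy\<close>). The series diverges, so any tail of it contains
  infinitely many disjoint blocks with large \<open>S\<close>; these are independent, and one of them succeeds
  almost surely (\<open>AE_ex_large_window\<close>). Hence almost surely, for all \<open>n\<close> and \<open>R\<close>, every cover of
  \<open>G\<^sub>n \<inter> interior R\<close> costs at least \<open>c w(R)\<close>, where \<open>G\<^sub>n = \<Union>\<^bsub>i\<ge>n\<^esub> V\<^sub>i\<close>.

  \<^bold>\<open>From \<open>c\<close> to \<open>1\<close>.\<close> The constant improves by itself (\<open>cover_cost_self_improvement\<close>): the
  cubes \<open>m\<close> levels below \<open>R\<close> have total weight \<open>2\<^bsup>m(d-t)\<^esup> w(R)\<close>, and for large \<open>m\<close> the factor outweighs \<open>c\<close>.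

  \<^bold>\<open>The intersection of the \<open>G\<^sub>n\<close>.\<close> Suppose that a family of cubes covers \<open>R \<inter> \<Inter>\<^sub>n G\<^sub>n\<close> at a cost
  below \<open>w(R)\<close>. Then \<open>R\<close> contains a cube inside \<open>G\<^sub>0\<close> that is again covered too cheaply by the cubes
  inside it (\<open>undercovered_descend\<close>). Repeating this with \<open>G\<^sub>1, G\<^sub>2, \<dots>\<close> gives shrinking cubes and in
  the limit a point of \<open>R \<inter> \<Inter>\<^sub>n G\<^sub>n\<close> outside all covering cubes, a contradiction
  (\<open>cover_cost_Inter_ge\<close>). So the net content of \<open>R \<inter> \<Inter>\<^sub>n G\<^sub>n\<close> is that of \<open>R\<close>. This is done for
  countably many exponents increasing to \<open>s\<close> and passes to the smaller ones.\<close>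

section \<open>Integration on the torus\<close>

lemma countable_int_lattice: "countable (int_lattice :: (real ^ 'n::finite) set)"
proof -
  have "x \<in> range (\<lambda>k :: 'n \<Rightarrow> int. \<chi> j. of_int (k j))" if "x \<in> int_lattice" for x :: "real ^ 'n"
    using that by (intro image_eqI[of _ _ "\<lambda>j. \<lfloor>x $ j\<rfloor>"]) (auto simp: int_lattice_def vec_eq_iff)
  then have "int_lattice \<subseteq> range (\<lambda>k :: 'n \<Rightarrow> int. (\<chi> j. of_int (k j)) :: real ^ 'n)"
    by blast
  then show ?thesis
    by (rule countable_subset) simp
qed

lemma torus_proj_add_lattice: "k \<in> int_lattice \<Longrightarrow> torus_proj (x + k) = torus_proj x"
  by (rule torus_proj_eq[OF torus_proj_in_torus])
    (metis add_diff_eq diff_diff_add int_lattice_add int_lattice_minus torus_proj_lattice uminus_add_conv_diff add.commute)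

lemma torus_proj_cong:
  assumes "x - y \<in> int_lattice" shows "torus_proj x = torus_proj y"
  using torus_proj_add_lattice[OF assms, of y] by simp

lemma torus_dist_lattice_cong:
  fixes x y :: "real ^ 'n::finite"
  assumes "(x - y) - (x' - y') \<in> int_lattice" shows "torus_dist x y = torus_dist x' y'"
proof -
  have le: "torus_dist x y \<le> torus_dist x' y'" if *: "(x - y) - (x' - y') \<in> int_lattice"
    for x y x' y' :: "real ^ 'n"
  proof (rule torus_dist_greatest)
    fix k :: "real ^ 'n" assume "k \<in> int_lattice"
    then have "k + - ((x - y) - (x' - y')) \<in> int_lattice"
      by (intro int_lattice_add int_lattice_minus *)
    from torus_dist_le[OF this, of x y] show "torus_dist x y \<le> norm (x' - y' + k)"
      by (simp add: algebra_simps)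
  qed
  show ?thesis
    using le[OF assms] le[of x' y' x y] int_lattice_minus[OF assms] by simp
qed

lemma torus_dist_le_dist: "torus_dist x y \<le> dist x y"
  using torus_dist_le[OF zero_in_int_lattice, of x y] by (simp add: dist_norm)

lemma torus_dist_nonneg: "0 \<le> torus_dist x y"
  by (rule torus_dist_greatest) simp

lemma borel_measurable_torus_proj [measurable]:
  "(torus_proj :: real ^ 'n::finite \<Rightarrow> _) \<in> borel_measurable borel"
proof (subst borel_measurable_euclidean_space, intro ballI)
  fix i :: "real ^ 'n" assume "i \<in> Basis"
  then obtain j where i: "i = axis j 1" by (auto simp: Basis_vec_def)
  have [measurable]: "(\<lambda>x :: real ^ 'n. x $ j) \<in> borel_measurable borel"
    by (intro borel_measurable_continuous_onI continuous_intros)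
  show "(\<lambda>x. torus_proj x \<bullet> i) \<in> borel_measurable borel"
    unfolding i inner_axis torus_proj_def frac_def by simp
qed

lemma borel_measurable_torus_dist [measurable (raw)]:
  fixes f g :: "'b \<Rightarrow> real ^ 'n::finite"
  assumes [measurable]: "f \<in> borel_measurable M" "g \<in> borel_measurable M"
  shows "(\<lambda>p. torus_dist (f p) (g p)) \<in> borel_measurable M"
  unfolding torus_dist_def using countable_int_lattice by measurable

lemmas [measurable] = torus_in_borel

lemma measurable_ident_torus: "(\<lambda>x. x) \<in> torus_measure \<rightarrow>\<^sub>M borel"
  unfolding torus_measure_def by (intro measurable_restrict_space1) simp

lemma nn_integral_torus_measure:
  "(\<integral>\<^sup>+x. f x \<partial>torus_measure) = (\<integral>\<^sup>+x. f x * indicator torus x \<partial>lborel)"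
  unfolding torus_measure_def by (rule nn_integral_restrict_space) simp

text \<open>The uniform distribution as a measure on the whole space. All Borel functions on
  \<open>real ^ 'n\<close> are then measurable for it, without restriction to the fundamental domain.\<close>

definition uniform_torus :: "(real ^ 'n::finite) measure" where
  "uniform_torus = distr torus_measure borel (\<lambda>x. x)"

lemma sets_uniform_torus [simp, measurable_cong]: "sets uniform_torus = sets borel"
  by (simp add: uniform_torus_def)

lemma space_uniform_torus [simp]: "space uniform_torus = UNIV"
  by (simp add: uniform_torus_def)

lemma prob_space_uniform_torus: "prob_space uniform_torus"
  unfolding uniform_torus_def
  by (intro prob_space.prob_space_distr prob_space_torus_measure measurable_ident_torus)

interpretation uniform_torus: prob_space "uniform_torus :: (real ^ 'n::finite) measure"
  by (rule prob_space_uniform_torus)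

interpretation uniform_torus_pair:
  pair_sigma_finite "uniform_torus :: (real ^ 'n::finite) measure" "uniform_torus :: (real ^ 'n) measure" ..

lemma nn_integral_uniform_torus:
  "f \<in> borel_measurable borel \<Longrightarrow> (\<integral>\<^sup>+x. f x \<partial>uniform_torus) = (\<integral>\<^sup>+x. f x \<partial>torus_measure)"
  unfolding uniform_torus_def by (subst nn_integral_distr) (auto intro: measurable_ident_torus)

lemma nn_integral_uniform_torus_lborel:
  assumes "f \<in> borel_measurable borel"
  shows "(\<integral>\<^sup>+x. f x \<partial>uniform_torus) = (\<integral>\<^sup>+x. f x * indicator torus x \<partial>lborel)"
  using assms by (simp add: nn_integral_uniform_torus nn_integral_torus_measure)

lemma emeasure_uniform_torus:
  assumes "A \<in> sets borel" "A \<subseteq> torus"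
  shows "emeasure uniform_torus A = emeasure lborel A"
proof -
  have "emeasure uniform_torus A = (\<integral>\<^sup>+x. indicator A x * indicator torus x \<partial>lborel)"
    using assms by (simp add: nn_integral_indicator[symmetric] nn_integral_uniform_torus
        nn_integral_torus_measure borel_measurable_indicator del: nn_integral_indicator)
  also have "\<dots> = (\<integral>\<^sup>+x. indicator A x \<partial>lborel)"
    using assms(2) by (intro nn_integral_cong) (auto simp: indicator_def)
  finally show ?thesis using assms(1) by simp
qed

lemma emeasure_torus_measure:
  assumes "A \<in> sets borel" "A \<subseteq> torus"
  shows "emeasure torus_measure A = emeasure uniform_torus A"
  using assms emeasure_restrict_space[of torus lborel A]
  by (simp add: emeasure_uniform_torus torus_measure_def torus_in_borel)

lemma openin_torus_borel:
  assumes "openin torus_topology U" shows "U \<in> sets borel"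
proof -
  have "U = torus \<inter> torus_proj -` U"
    using assms by (auto simp: openin_torus_topology_iff torus_proj_ident)
  moreover have "torus_proj -` U \<in> sets borel"
    using assms by (simp add: openin_torus_topology_iff)
  ultimately show ?thesis
    by (metis sets.Int torus_in_borel)
qed

lemma nn_integral_count_space_ex1:
  assumes "\<exists>!k. k \<in> L \<and> k \<in> P"
  shows "(\<integral>\<^sup>+k. indicator P k \<partial>count_space L) = 1"
proof -
  obtain k where k: "L \<inter> P = {k}" "k \<in> L" using assms by auto
  have "(\<integral>\<^sup>+k. indicator P k \<partial>count_space L) = (\<integral>\<^sup>+k. indicator (L \<inter> P) k \<partial>count_space L)"
    by (intro nn_integral_cong) (auto simp: indicator_def)
  also have "\<dots> = 1"
    using k by (subst nn_integral_indicator) (auto simp: emeasure_count_space_finite)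
  finally show ?thesis .
qed

lemma nn_integral_lborel_translate:
  fixes f :: "real ^ 'n::finite \<Rightarrow> ennreal"
  assumes [measurable]: "f \<in> borel_measurable borel"
  shows "(\<integral>\<^sup>+x. f (x + a) \<partial>lborel) = (\<integral>\<^sup>+x. f x \<partial>lborel)"
proof -
  have "(\<integral>\<^sup>+x. f x \<partial>lborel) = (\<integral>\<^sup>+x. f x \<partial>distr lborel borel ((+) a))"
    by (simp add: lborel_distr_plus)
  also have "\<dots> = (\<integral>\<^sup>+x. f (x + a) \<partial>lborel)"
    by (subst nn_integral_distr) (auto simp: add.commute)
  finally show ?thesis by simp
qed

lemma nn_integral_lborel_reflect:
  fixes f :: "real ^ 'n::finite \<Rightarrow> ennreal"
  assumes [measurable]: "f \<in> borel_measurable borel"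
  shows "(\<integral>\<^sup>+x. f (a - x) \<partial>lborel) = (\<integral>\<^sup>+x. f x \<partial>lborel)"
proof -
  have "(lborel :: (real ^ 'n) measure) = distr lborel borel (\<lambda>x. a - x)"
    using lborel_affine[of "-1" a] by (simp add: density_1)
  then have "(\<integral>\<^sup>+x. f x \<partial>lborel) = (\<integral>\<^sup>+x. f x \<partial>distr lborel borel (\<lambda>x. a - x))"
    by simp
  also have "\<dots> = (\<integral>\<^sup>+x. f (a - x) \<partial>lborel)"
    by (subst nn_integral_distr) auto
  finally show ?thesis by simp
qed

text \<open>The translates of a fundamental domain by the lattice tile space: shifting the \<open>k\<close>-th term
  of the sum by \<open>k\<close> turns the integral over one tile into the integral over all tiles.\<close>

lemma nn_integral_fundamental_domain:
  fixes g :: "real ^ 'n::finite \<Rightarrow> ennreal"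
  assumes F [measurable]: "F \<in> sets borel"
    and fund: "\<And>x. \<exists>!k. k \<in> int_lattice \<and> x + k \<in> F"
    and [measurable]: "g \<in> borel_measurable borel"
  shows "(\<integral>\<^sup>+x. (\<integral>\<^sup>+k. g (x + k) \<partial>count_space int_lattice) * indicator F x \<partial>lborel) = (\<integral>\<^sup>+x. g x \<partial>lborel)"
proof -
  let ?L = "count_space (int_lattice :: (real ^ 'n) set)"
  have one: "(\<integral>\<^sup>+k. indicator F (x - k) \<partial>?L) = 1" for x
  proof -
    obtain k where k: "k \<in> int_lattice" "x + k \<in> F"
      and uniq: "\<And>l. l \<in> int_lattice \<Longrightarrow> x + l \<in> F \<Longrightarrow> l = k"
      using fund[of x] by blast
    have "(\<integral>\<^sup>+k. indicator {k. x - k \<in> F} k \<partial>?L) = 1"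
    proof (intro nn_integral_count_space_ex1 ex1I[of _ "- k"])
      show "- k \<in> int_lattice \<and> - k \<in> {k. x - k \<in> F}"
        using k by (simp add: int_lattice_minus)
      fix l assume "l \<in> int_lattice \<and> l \<in> {k. x - k \<in> F}"
      then show "l = - k" using uniq[of "- l"] by (auto simp: int_lattice_minus)
    qed
    then show ?thesis by (simp add: indicator_def)
  qed
  have "(\<integral>\<^sup>+x. (\<integral>\<^sup>+k. g (x + k) \<partial>?L) * indicator F x \<partial>lborel)
      = (\<integral>\<^sup>+x. (\<integral>\<^sup>+k. g (x + k) * indicator F x \<partial>?L) \<partial>lborel)"
    by (simp add: nn_integral_multc)
  also have "\<dots> = (\<integral>\<^sup>+k. (\<integral>\<^sup>+x. g (x + k) * indicator F x \<partial>lborel) \<partial>?L)"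
    by (rule nn_integral_count_space_nn_integral) (auto simp: countable_int_lattice)
  also have "\<dots> = (\<integral>\<^sup>+k. (\<integral>\<^sup>+x. g x * indicator F (x - k) \<partial>lborel) \<partial>?L)"
  proof (rule nn_integral_cong)
    fix k
    show "(\<integral>\<^sup>+x. g (x + k) * indicator F x \<partial>lborel) = (\<integral>\<^sup>+x. g x * indicator F (x - k) \<partial>lborel)"
      by (subst nn_integral_lborel_translate[symmetric, where a = k]) auto
  qed
  also have "\<dots> = (\<integral>\<^sup>+x. (\<integral>\<^sup>+k. g x * indicator F (x - k) \<partial>?L) \<partial>lborel)"
    by (rule nn_integral_count_space_nn_integral[symmetric]) (auto simp: countable_int_lattice)
  also have "\<dots> = (\<integral>\<^sup>+x. g x \<partial>lborel)"
    by (simp add: nn_integral_cmult one)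
  finally show ?thesis .
qed

lemma torus_fundamental_domain: "\<exists>!k. k \<in> int_lattice \<and> x + k \<in> torus"
proof (intro ex1I[of _ "torus_proj x - x"])
  show "torus_proj x - x \<in> int_lattice \<and> x + (torus_proj x - x) \<in> torus"
    by (simp add: torus_proj_lattice torus_proj_in_torus)
  fix k assume "k \<in> int_lattice \<and> x + k \<in> torus"
  then show "k = torus_proj x - x"
    using torus_proj_eq[of "x + k" x] by simp
qed

text \<open>Unfolding applied to \<open>g\<close> times the indicator of \<open>torus\<close>, whose sum over the lattice is the
  periodic extension of \<open>g\<close>: a periodic function has the same integral over every fundamental
  domain. Invariance under translation and reflection follows, because they map fundamental domains
  to fundamental domains.\<close>

lemma nn_integral_fundamental_domain_eq_torus:
  fixes g :: "real ^ 'n::finite \<Rightarrow> ennreal"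
  assumes F [measurable]: "F \<in> sets borel"
    and fund: "\<And>x. \<exists>!k. k \<in> int_lattice \<and> x + k \<in> F"
    and g [measurable]: "g \<in> borel_measurable borel"
  shows "(\<integral>\<^sup>+x. g (torus_proj x) * indicator F x \<partial>lborel) = (\<integral>\<^sup>+x. g x \<partial>uniform_torus)"
proof -
  let ?L = "count_space (int_lattice :: (real ^ 'n) set)"
  have "(\<integral>\<^sup>+k. g (x + k) * indicator torus (x + k) \<partial>?L) = g (torus_proj x)" for x
  proof -
    have "(\<integral>\<^sup>+k. g (x + k) * indicator torus (x + k) \<partial>?L)
        = (\<integral>\<^sup>+k. g (torus_proj x) * indicator {k. x + k \<in> torus} k \<partial>?L)"
      using torus_proj_eq[of "x + _" x]
      by (intro nn_integral_cong) (auto simp: indicator_def)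
    also have "\<dots> = g (torus_proj x)"
      using nn_integral_count_space_ex1[of int_lattice "{k. x + k \<in> torus}"]
      by (simp add: nn_integral_cmult torus_fundamental_domain)
    finally show ?thesis .
  qed
  then have "(\<integral>\<^sup>+x. g (torus_proj x) * indicator F x \<partial>lborel)
      = (\<integral>\<^sup>+x. (\<integral>\<^sup>+k. g (x + k) * indicator torus (x + k) \<partial>?L) * indicator F x \<partial>lborel)"
    by simp
  also have "\<dots> = (\<integral>\<^sup>+x. g x * indicator torus x \<partial>lborel)"
    using fund by (intro nn_integral_fundamental_domain) auto
  finally show ?thesis
    by (simp only: nn_integral_uniform_torus_lborel[OF g])
qed

lemma nn_integral_uniform_torus_translate:
  fixes g :: "real ^ 'n::finite \<Rightarrow> ennreal"
  assumes g [measurable]: "g \<in> borel_measurable borel"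
  shows "(\<integral>\<^sup>+x. g (torus_proj (x + a)) \<partial>uniform_torus) = (\<integral>\<^sup>+x. g x \<partial>uniform_torus)"
proof -
  have [measurable]: "{x. x - a \<in> torus} \<in> sets borel"
    by measurable
  have fund: "\<exists>!k. k \<in> int_lattice \<and> x + k \<in> {x. x - a \<in> torus}" for x
    using torus_fundamental_domain[of "x - a"] by (simp add: algebra_simps)
  have "(\<integral>\<^sup>+x. g (torus_proj (x + a)) \<partial>uniform_torus)
      = (\<integral>\<^sup>+x. g (torus_proj (x + a)) * indicator {x. x - a \<in> torus} (x + a) \<partial>lborel)"
    by (subst nn_integral_uniform_torus_lborel, measurable) (simp add: indicator_def)
  also have "\<dots> = (\<integral>\<^sup>+x. g (torus_proj x) * indicator {x. x - a \<in> torus} x \<partial>lborel)"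
    by (rule nn_integral_lborel_translate) measurable
  also have "\<dots> = (\<integral>\<^sup>+x. g x \<partial>uniform_torus)"
    using fund by (intro nn_integral_fundamental_domain_eq_torus) auto
  finally show ?thesis .
qed

lemma nn_integral_uniform_torus_reflect:
  fixes g :: "real ^ 'n::finite \<Rightarrow> ennreal"
  assumes g [measurable]: "g \<in> borel_measurable borel"
  shows "(\<integral>\<^sup>+x. g (torus_proj (a - x)) \<partial>uniform_torus) = (\<integral>\<^sup>+x. g x \<partial>uniform_torus)"
proof -
  have [measurable]: "{x. a - x \<in> torus} \<in> sets borel"
    by measurable
  have fund: "\<exists>!k. k \<in> int_lattice \<and> x + k \<in> {x. a - x \<in> torus}" for x
  proof -
    obtain k where k: "k \<in> int_lattice" "(a - x) + k \<in> torus"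
      and uniq: "\<And>l. l \<in> int_lattice \<Longrightarrow> (a - x) + l \<in> torus \<Longrightarrow> l = k"
      using torus_fundamental_domain[of "a - x"] by blast
    show ?thesis
    proof (intro ex1I[of _ "- k"])
      show "- k \<in> int_lattice \<and> x + - k \<in> {x. a - x \<in> torus}"
        using k by (simp add: int_lattice_minus algebra_simps)
      fix l assume "l \<in> int_lattice \<and> x + l \<in> {x. a - x \<in> torus}"
      then show "l = - k" using uniq[of "- l"] by (auto simp: int_lattice_minus algebra_simps)
    qed
  qed
  have "(\<integral>\<^sup>+x. g (torus_proj (a - x)) \<partial>uniform_torus)
      = (\<integral>\<^sup>+x. g (torus_proj (a - x)) * indicator {x. a - x \<in> torus} (a - x) \<partial>lborel)"
    by (subst nn_integral_uniform_torus_lborel, measurable) (simp add: indicator_def)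
  also have "\<dots> = (\<integral>\<^sup>+x. g (torus_proj x) * indicator {x. a - x \<in> torus} x \<partial>lborel)"
    by (rule nn_integral_lborel_reflect[where f = "\<lambda>x. g (torus_proj x) * indicator {x. a - x \<in> torus} x"]) measurable
  also have "\<dots> = (\<integral>\<^sup>+x. g x \<partial>uniform_torus)"
    using fund by (intro nn_integral_fundamental_domain_eq_torus) auto
  finally show ?thesis .
qed

text \<open>A torus ball is the projection of a Euclidean ball, and projecting does not increase volume.\<close>

lemma emeasure_uniform_torus_ball_le:
  fixes x :: "real ^ 'n::finite"
  assumes "0 \<le> r"
  shows "(\<integral>\<^sup>+y. indicator {y. torus_dist x y < r} y \<partial>uniform_torus)
    \<le> ennreal (unit_ball_vol (real CARD('n)) * r ^ CARD('n))"
proof -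
  let ?L = "count_space (int_lattice :: (real ^ 'n) set)"
  have [measurable]: "(\<lambda>y. torus_dist x y) \<in> borel_measurable borel"
    by measurable
  have "indicator {y. torus_dist x y < r} y \<le> (\<integral>\<^sup>+k. indicator (ball x r) (y + k) \<partial>?L)" for y
  proof (cases "torus_dist x y < r")
    case True
    then obtain k where k: "k \<in> int_lattice" "norm (x - y + k) < r"
      by (rule torus_dist_lessD)
    have "indicator {y. torus_dist x y < r} y = (1 :: ennreal)" using True by simp
    also have "\<dots> = (\<integral>\<^sup>+l. indicator {- k} l \<partial>?L)"
      using k(1) by (subst nn_integral_indicator) (auto simp: int_lattice_minus)
    also have "\<dots> \<le> (\<integral>\<^sup>+k. indicator (ball x r) (y + k) \<partial>?L)"
      using k(2) by (intro nn_integral_mono) (auto simp: indicator_def dist_norm algebra_simps)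
    finally show ?thesis .
  qed simp
  then have "(\<integral>\<^sup>+y. indicator {y. torus_dist x y < r} y \<partial>uniform_torus)
      \<le> (\<integral>\<^sup>+y. (\<integral>\<^sup>+k. indicator (ball x r) (y + k) \<partial>?L) * indicator torus y \<partial>lborel)"
    by (subst nn_integral_uniform_torus_lborel, measurable) (intro nn_integral_mono mult_right_mono, auto)
  also have "\<dots> = (\<integral>\<^sup>+y. indicator (ball x r) y \<partial>lborel)"
    by (rule nn_integral_fundamental_domain)
      (auto simp: torus_fundamental_domain torus_in_borel intro!: borel_measurable_indicator)
  also have "\<dots> = ennreal (unit_ball_vol (real CARD('n)) * r ^ CARD('n))"
    using assms emeasure_ball[of r x] by simp
  finally show ?thesis .
qed

section \<open>The Riesz kernel\<close>

text \<open>The kernel of \<open>torus_energy\<close>, with value \<open>\<infinity>\<close> on the diagonal for \<open>t > 0\<close>.\<close>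

definition riesz_kernel :: "real \<Rightarrow> real ^ 'n::finite \<Rightarrow> real ^ 'n \<Rightarrow> ennreal" where
  "riesz_kernel t x y = inverse (ennreal (torus_dist x y powr t))"

lemma borel_measurable_riesz_kernel [measurable (raw)]:
  assumes [measurable]: "f \<in> borel_measurable M" "g \<in> borel_measurable M"
  shows "(\<lambda>p. riesz_kernel t (f p) (g p)) \<in> borel_measurable M"
  unfolding riesz_kernel_def by measurable

lemma torus_energy_eq_uniform_torus:
  fixes U :: "(real ^ 'n::finite) set"
  assumes [measurable]: "U \<in> sets borel"
  shows "torus_energy t U
    = (\<integral>\<^sup>+x. (\<integral>\<^sup>+y. riesz_kernel t x y * indicator U y \<partial>uniform_torus) * indicator U x \<partial>uniform_torus)"
proof -
  interpret T: prob_space "torus_measure :: (real ^ 'n) measure" by (rule prob_space_torus_measure)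
  have [measurable]: "fst \<in> (torus_measure \<Otimes>\<^sub>M torus_measure) \<rightarrow>\<^sub>M (borel :: (real ^ 'n) measure)"
    "snd \<in> (torus_measure \<Otimes>\<^sub>M torus_measure) \<rightarrow>\<^sub>M (borel :: (real ^ 'n) measure)"
    by (rule measurable_compose[OF measurable_fst measurable_ident_torus]
      measurable_compose[OF measurable_snd measurable_ident_torus])+
  have "torus_energy t U
      = (\<integral>\<^sup>+p. riesz_kernel t (fst p) (snd p) * (indicator U (snd p) * indicator U (fst p))
          \<partial>(torus_measure \<Otimes>\<^sub>M torus_measure))"
    unfolding torus_energy_def riesz_kernel_def
    by (intro nn_integral_cong) (auto simp: indicator_def)
  also have "\<dots> = (\<integral>\<^sup>+x. \<integral>\<^sup>+y. riesz_kernel t x y * (indicator U y * indicator U x)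
          \<partial>torus_measure \<partial>torus_measure)"
    by (subst T.nn_integral_fst[symmetric]) auto
  also have "\<dots> = (\<integral>\<^sup>+x. (\<integral>\<^sup>+y. riesz_kernel t x y * indicator U y * indicator U x
          \<partial>uniform_torus) \<partial>uniform_torus)"
  proof -
    have "(\<integral>\<^sup>+y. riesz_kernel t x y * (indicator U y * indicator U x) \<partial>torus_measure)
        = (\<integral>\<^sup>+y. riesz_kernel t x y * indicator U y * indicator U x \<partial>uniform_torus)" for x
      by (subst nn_integral_uniform_torus, measurable) (simp add: mult.assoc)
    then show ?thesis
      by (subst nn_integral_uniform_torus, measurable)
  qed
  also have "\<dots> = (\<integral>\<^sup>+x. (\<integral>\<^sup>+y. riesz_kernel t x y * indicator U y \<partial>uniform_torus) * indicator U x
          \<partial>uniform_torus)"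
    by (intro nn_integral_cong nn_integral_multc) measurable
  finally show ?thesis .
qed

lemma riesz_kernel_lattice_cong:
  "(x - y) - (x' - y') \<in> int_lattice \<Longrightarrow> riesz_kernel t x y = riesz_kernel t x' y'"
  unfolding riesz_kernel_def by (simp only: torus_dist_lattice_cong)

text \<open>The probability that a random translate of \<open>U\<close> contains both \<open>x\<close> and \<open>y\<close> is a function of
  \<open>y - x\<close>. Substituting the position \<open>u\<close> of \<open>x\<close> inside \<open>U\<close> and then the position \<open>w\<close> of \<open>y\<close> turns its
  integral against the kernel into the double integral over \<open>U \<times> U\<close>.\<close>

lemma nn_integral_riesz_kernel_autocorrelation:
  fixes U :: "(real ^ 'n::finite) set"
  assumes [measurable]: "U \<in> sets borel"
  shows "(\<integral>\<^sup>+y. riesz_kernel t x y *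
        (\<integral>\<^sup>+v. indicator U (torus_proj (x - v)) * indicator U (torus_proj (y - v)) \<partial>uniform_torus)
      \<partial>uniform_torus) = torus_energy t U"
proof -
  have inner: "(\<integral>\<^sup>+v. indicator U (torus_proj (x - v)) * indicator U (torus_proj (y - v)) \<partial>uniform_torus)
      = (\<integral>\<^sup>+u. indicator U u * indicator U (torus_proj (y + (u - x))) \<partial>uniform_torus :: ennreal)" for y
  proof -
    have "torus_proj (y - v) = torus_proj (y + (torus_proj (x - v) - x))" for v
      using int_lattice_minus[OF torus_proj_lattice[of "x - v"]]
      by (intro torus_proj_cong) (simp add: algebra_simps)
    then have "(\<integral>\<^sup>+v. indicator U (torus_proj (x - v)) * indicator U (torus_proj (y - v)) \<partial>uniform_torus)
        = (\<integral>\<^sup>+v. (\<lambda>u. indicator U u * indicator U (torus_proj (y + (u - x)))) (torus_proj (x - v))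
            \<partial>uniform_torus :: ennreal)"
      by simp
    also have "\<dots> = (\<integral>\<^sup>+u. indicator U u * indicator U (torus_proj (y + (u - x))) \<partial>uniform_torus)"
      by (rule nn_integral_uniform_torus_reflect) measurable
    finally show ?thesis .
  qed
  have shift: "(\<integral>\<^sup>+y. riesz_kernel t x y * indicator U (torus_proj (y + (u - x))) \<partial>uniform_torus)
      = (\<integral>\<^sup>+w. riesz_kernel t u w * indicator U w \<partial>uniform_torus)" for u
  proof -
    have "riesz_kernel t x y = riesz_kernel t u (torus_proj (y + (u - x)))" for y
      using torus_proj_lattice[of "y + (u - x)"]
      by (intro riesz_kernel_lattice_cong) (simp add: algebra_simps)
    then have "(\<integral>\<^sup>+y. riesz_kernel t x y * indicator U (torus_proj (y + (u - x))) \<partial>uniform_torus)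
       = (\<integral>\<^sup>+y. (\<lambda>w. riesz_kernel t u w * indicator U w) (torus_proj (y + (u - x))) \<partial>uniform_torus)"
      by simp
    also have "\<dots> = (\<integral>\<^sup>+w. riesz_kernel t u w * indicator U w \<partial>uniform_torus)"
      by (rule nn_integral_uniform_torus_translate) measurable
    finally show ?thesis .
  qed
  have "(\<integral>\<^sup>+y. riesz_kernel t x y *
        (\<integral>\<^sup>+v. indicator U (torus_proj (x - v)) * indicator U (torus_proj (y - v)) \<partial>uniform_torus)
      \<partial>uniform_torus)
    = (\<integral>\<^sup>+y. (\<integral>\<^sup>+u. riesz_kernel t x y * indicator U (torus_proj (y + (u - x))) * indicator U u
       \<partial>uniform_torus) \<partial>uniform_torus)"
    unfolding inner by (subst nn_integral_cmult[symmetric], measurable) (simp add: mult_ac)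
  also have "\<dots> = (\<integral>\<^sup>+u. (\<integral>\<^sup>+y. riesz_kernel t x y * indicator U (torus_proj (y + (u - x))) * indicator U u
       \<partial>uniform_torus) \<partial>uniform_torus)"
    by (rule uniform_torus_pair.Fubini') measurable
  also have "\<dots> = torus_energy t U"
    by (simp add: nn_integral_multc shift torus_energy_eq_uniform_torus)
  finally show ?thesis .
qed

lemma suminf_const_ennreal: "c \<noteq> 0 \<Longrightarrow> (\<Sum>k::nat. c) = (\<infinity> :: ennreal)"
  using nn_integral_count_space_nat[of "\<lambda>_. c"]
  by (simp add: ennreal_mult_eq_top_iff)

text \<open>If \<open>y\<close> lies between the radii \<open>r / 2\<^bsup>k+1\<^esup>\<close> and \<open>r / 2\<^sup>k\<close> around \<open>x\<close>, the \<open>k\<close>-th term alone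
  dominates the kernel. On the diagonal all terms are at least \<open>(r / 2) powr (-t)\<close>, so the series
  diverges.\<close>

lemma riesz_kernel_le_shells:
  assumes t: "0 < t" and r: "torus_dist x y < r"
  shows "riesz_kernel t x y
    \<le> (\<Sum>k. ennreal ((r / 2 ^ Suc k) powr (- t)) * indicator {y. torus_dist x y < r / 2 ^ k} y)"
    (is "_ \<le> (\<Sum>k. ?f k)")
proof (cases "torus_dist x y = 0")
  case True
  have r0: "0 < r" using r True by simp
  have "ennreal ((r / 2) powr (- t)) \<le> ?f k" for k
  proof -
    have "(r / 2) powr (- t) \<le> (r / 2 ^ Suc k) powr (- t)"
      using r0 t by (intro powr_mono2') (auto simp: field_simps)
    then show ?thesis
      using True r0 by (simp add: ennreal_leI)
  qed
  then have "(\<Sum>k::nat. ennreal ((r / 2) powr (- t))) \<le> (\<Sum>k. ?f k)"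
    by (intro suminf_le) auto
  moreover have "ennreal ((r / 2) powr (- t)) \<noteq> 0"
    using r0 by simp
  ultimately show ?thesis
    by (simp add: suminf_const_ennreal top_unique)
next
  case False
  define \<rho> where "\<rho> = torus_dist x y"
  have \<rho>: "0 < \<rho>" "\<rho> < r"
    using False r torus_dist_nonneg[of x y] by (auto simp: \<rho>_def)
  have ex: "\<exists>k. r / 2 ^ Suc k \<le> \<rho>"
  proof -
    obtain k where "(1 / 2 :: real) ^ k < \<rho> / r"
      using real_arch_pow_inv[of "\<rho> / r" "1 / 2"] \<rho> by auto
    then have "r / 2 ^ Suc k \<le> \<rho>"
      using \<rho> by (simp add: field_simps power_one_over)
    then show ?thesis ..
  qed
  define k where "k = (LEAST k. r / 2 ^ Suc k \<le> \<rho>)"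
  have k: "r / 2 ^ Suc k \<le> \<rho>"
    unfolding k_def using ex by (rule LeastI_ex)
  have k': "\<rho> < r / 2 ^ k"
  proof (cases k)
    case (Suc l)
    then have "\<not> r / 2 ^ Suc l \<le> \<rho>"
      using not_less_Least[of l "\<lambda>k. r / 2 ^ Suc k \<le> \<rho>"] by (simp add: k_def)
    then show ?thesis using Suc by simp
  qed (use \<rho> in simp)
  have "riesz_kernel t x y = ennreal (\<rho> powr (- t))"
    using \<rho> by (simp add: riesz_kernel_def \<rho>_def[symmetric] inverse_ennreal powr_minus)
  also have "\<dots> \<le> ennreal ((r / 2 ^ Suc k) powr (- t))"
    using k \<rho> t by (intro ennreal_leI powr_mono2') auto
  also have "\<dots> = ?f k"
    using k' by (simp add: \<rho>_def)
  also have "\<dots> = sum ?f {k}" by (simp only: sum.insert sum.empty finite.emptyI empty_iff not_False_eq_True add_0_right)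
  also have "\<dots> \<le> (\<Sum>k. ?f k)"
    by (rule sum_le_suminf) auto
  finally show ?thesis .
qed

text \<open>Integrating the shell bound termwise gives a geometric series of ratio \<open>2 powr (t - d)\<close>.\<close>

lemma nn_integral_riesz_kernel_ball_le:
  assumes t: "0 < t" "t < real CARD('n::finite)"
  shows "\<exists>C>0. \<forall>(x :: real ^ 'n) r. 0 < r \<longrightarrow>
    (\<integral>\<^sup>+y. riesz_kernel t x y * indicator {y. torus_dist x y < r} y \<partial>uniform_torus)
      \<le> ennreal (C * r powr (real CARD('n) - t))"
proof -
  define d where "d = real CARD('n)"
  define \<omega> where "\<omega> = unit_ball_vol d"
  define q where "q = 2 powr (t - d)"
  have \<omega>: "0 < \<omega>" by (simp add: \<omega>_def d_def unit_ball_vol_pos)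
  have q: "0 < q" "q < 1" using t by (auto simp: q_def d_def powr_less_one)
  define C where "C = \<omega> * 2 powr t / (1 - q)"
  have "0 < C" using \<omega> q by (simp add: C_def)
  moreover have "(\<integral>\<^sup>+y. riesz_kernel t x y * indicator {y. torus_dist x y < r} y \<partial>uniform_torus)
      \<le> ennreal (C * r powr (real CARD('n) - t))" if r: "0 < r" for x :: "real ^ 'n" and r
  proof -
    have "(\<integral>\<^sup>+y. riesz_kernel t x y * indicator {y. torus_dist x y < r} y \<partial>uniform_torus)
       \<le> (\<integral>\<^sup>+y. (\<Sum>k. ennreal ((r / 2 ^ Suc k) powr (- t)) * indicator {y. torus_dist x y < r / 2 ^ k} y) \<partial>uniform_torus)"
    proof (rule nn_integral_mono)
      fix y
      show "riesz_kernel t x y * indicator {y. torus_dist x y < r} y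
        \<le> (\<Sum>k. ennreal ((r / 2 ^ Suc k) powr (- t)) * indicator {y. torus_dist x y < r / 2 ^ k} y)"
      proof (cases "torus_dist x y < r")
        case True
        then have "indicator {y. torus_dist x y < r} y = (1 :: ennreal)" by simp
        then show ?thesis
          using riesz_kernel_le_shells[OF t(1) True] by (simp only: mult_1_right)
      next
        case False
        then have "indicator {y. torus_dist x y < r} y = (0 :: ennreal)" by simp
        then show ?thesis by (simp only: mult_zero_right zero_le)
      qed
    qed
    also have "\<dots> = (\<Sum>k. ennreal ((r / 2 ^ Suc k) powr (- t)) * (\<integral>\<^sup>+y. indicator {y. torus_dist x y < r / 2 ^ k} y \<partial>uniform_torus))"
      by (subst nn_integral_suminf, measurable) (intro suminf_cong nn_integral_cmult, measurable)
    also have "\<dots> \<le> (\<Sum>k. ennreal (\<omega> * 2 powr t * r powr (d - t) * q ^ k))"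
    proof (intro suminf_le)
      fix k
      have "(\<integral>\<^sup>+y. indicator {y. torus_dist x y < r / 2 ^ k} y \<partial>uniform_torus) \<le> ennreal (\<omega> * (r / 2 ^ k) ^ CARD('n))"
        using emeasure_uniform_torus_ball_le[of "r / 2 ^ k" x] r by (simp add: \<omega>_def d_def del: nn_integral_indicator)
      then have "ennreal ((r / 2 ^ Suc k) powr (- t)) * (\<integral>\<^sup>+y. indicator {y. torus_dist x y < r / 2 ^ k} y \<partial>uniform_torus)
        \<le> ennreal ((r / 2 ^ Suc k) powr (- t)) * ennreal (\<omega> * (r / 2 ^ k) ^ CARD('n))"
        by (rule mult_left_mono) simp
      also have "\<dots> = ennreal ((r / 2 ^ Suc k) powr (- t) * (\<omega> * (r / 2 ^ k) ^ CARD('n)))"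
        using \<omega> r by (subst ennreal_mult) auto
      also have "(r / 2 ^ Suc k) powr (- t) * (\<omega> * (r / 2 ^ k) ^ CARD('n)) = \<omega> * 2 powr t * r powr (d - t) * q ^ k"
      proof -
        have a: "(r / 2 ^ k) ^ CARD('n) = (r / 2 ^ k) powr d"
          using r by (simp add: powr_realpow d_def)
        have b: "(r / 2 ^ Suc k) powr (- t) = 2 powr t * (r / 2 ^ k) powr (- t)"
        proof -
          have "(r / 2 ^ Suc k) powr (- t) = ((r / 2 ^ k) / 2) powr (- t)"
            by (simp add: mult.commute)
          also have "\<dots> = (r / 2 ^ k) powr (- t) / 2 powr (- t)"
            by (rule powr_divide)
          finally show ?thesis by (simp add: powr_minus_divide)
        qed
        have c: "(r / 2 ^ k) powr (d - t) = r powr (d - t) * q ^ k"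
        proof -
          have "(r / 2 ^ k) powr (d - t) = r powr (d - t) / (2 ^ k) powr (d - t)"
            by (rule powr_divide)
          also have "((2 :: real) ^ k) powr (d - t) = 2 powr (real k * (d - t))"
            by (simp add: powr_realpow[symmetric] powr_powr)
          also have "\<dots> = 1 / 2 powr ((t - d) * real k)"
            by (simp add: powr_minus_divide[symmetric] algebra_simps)
          also have "2 powr ((t - d) * real k) = q ^ k"
            by (simp add: q_def powr_power mult.commute)
          finally show ?thesis by simp
        qed
        have "(r / 2 ^ Suc k) powr (- t) * (\<omega> * (r / 2 ^ k) ^ CARD('n)) = \<omega> * 2 powr t * (r / 2 ^ k) powr (d - t)"
        proof -
          have "(r / 2 ^ k) powr (- t) * (r / 2 ^ k) powr d = (r / 2 ^ k) powr (d - t)"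
            by (simp add: powr_add[symmetric])
          then show ?thesis unfolding a b by (simp add: mult_ac)
        qed
        then show ?thesis unfolding c by simp
      qed
      finally show "ennreal ((r / 2 ^ Suc k) powr (- t)) * (\<integral>\<^sup>+y. indicator {y. torus_dist x y < r / 2 ^ k} y \<partial>uniform_torus)
        \<le> ennreal (\<omega> * 2 powr t * r powr (d - t) * q ^ k)" .
    qed auto
    also have "\<dots> = ennreal (C * r powr (real CARD('n) - t))"
    proof (rule suminf_ennreal_eq)
      have "(\<lambda>k. \<omega> * 2 powr t * r powr (d - t) * q ^ k) sums (\<omega> * 2 powr t * r powr (d - t) * (1 / (1 - q)))"
        using q by (intro sums_mult geometric_sums) auto
      then show "(\<lambda>k. \<omega> * 2 powr t * r powr (d - t) * q ^ k) sums (C * r powr (real CARD('n) - t))"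
        by (simp add: C_def d_def mult_ac)
    qed (use \<omega> q in auto)
    finally show ?thesis .
  qed
  ultimately show ?thesis by blast
qed

section \<open>Dyadic cubes\<close>

text \<open>The dyadic cube of level \<open>n\<close> containing \<open>x\<close>. Indexing cubes by their points rather than by
  their corners makes nestedness immediate: two cubes with a common point \<open>x\<close> are
  \<open>dyadic_cube_at n x\<close> and \<open>dyadic_cube_at m x\<close>.\<close>

definition dyadic_cube_at :: "nat \<Rightarrow> real ^ 'n::finite \<Rightarrow> (real ^ 'n) set" where
  "dyadic_cube_at n x = {y. \<forall>j. \<lfloor>2 ^ n * y $ j\<rfloor> = \<lfloor>2 ^ n * x $ j\<rfloor>}"

lemma dyadic_cube_at_self: "x \<in> dyadic_cube_at n x"
  by (simp add: dyadic_cube_at_def)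

lemma dyadic_cube_at_cong: "y \<in> dyadic_cube_at n x \<Longrightarrow> dyadic_cube_at n y = dyadic_cube_at n x"
  by (simp add: dyadic_cube_at_def)

lemma dyadic_cube_at_antimono:
  fixes x :: "real ^ 'n::finite"
  assumes "n \<le> m" shows "dyadic_cube_at m x \<subseteq> dyadic_cube_at n x"
proof -
  have "\<lfloor>2 ^ n * a\<rfloor> = \<lfloor>2 ^ m * a\<rfloor> div 2 ^ (m - n)" for a :: real
  proof -
    have "(2 :: real) ^ m = 2 ^ n * 2 ^ (m - n)"
      using assms by (simp flip: power_add)
    then have "2 ^ n * a = (2 ^ m * a) / real_of_int (2 ^ (m - n))"
      by simp
    then show ?thesis
      using floor_divide_real_eq_div[of "2 ^ (m - n)" "2 ^ m * a"] by simp
  qed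
  then show ?thesis
    by (auto simp: dyadic_cube_at_def)
qed

lemma dyadic_cube_floor:
  "dyadic_cube n k = {x :: real ^ 'n::finite. \<forall>j. \<lfloor>2 ^ n * x $ j\<rfloor> = int (k j)}"
proof -
  have "real (k j) / 2 ^ n \<le> a \<and> a < (real (k j) + 1) / 2 ^ n \<longleftrightarrow> \<lfloor>2 ^ n * a\<rfloor> = int (k j)" for a :: real and j
    unfolding floor_eq_iff by (simp add: field_simps)
  then show ?thesis
    by (simp add: dyadic_cube_def)
qed

lemma dyadic_cube_at_in_dyadic_cubes:
  fixes x :: "real ^ 'n::finite"
  assumes "x \<in> torus" shows "dyadic_cube_at n x \<in> dyadic_cubes"
proof -
  have x: "0 \<le> x $ j" "x $ j < 1" for j using assms by (auto simp: torus_def)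
  define k where "k = (\<lambda>j. nat \<lfloor>2 ^ n * x $ j\<rfloor>)"
  have k: "int (k j) = \<lfloor>2 ^ n * x $ j\<rfloor>" for j
    using x by (simp add: k_def)
  have "k j < 2 ^ n" for j
  proof -
    have "\<lfloor>2 ^ n * x $ j\<rfloor> < 2 ^ n"
      using x[of j] by (simp add: floor_less_iff)
    then show ?thesis
      using k[of j] by (metis of_nat_less_numeral_power_cancel_iff)
  qed
  moreover have "dyadic_cube_at n x = dyadic_cube n k"
    by (simp add: dyadic_cube_floor dyadic_cube_at_def k)
  ultimately show ?thesis
    by (auto simp: dyadic_cubes_def)
qed

lemma dyadic_cubesE:
  assumes "Q \<in> dyadic_cubes"
  obtains n x where "x \<in> torus" "Q = dyadic_cube_at n x"
proof -
  obtain n and k :: "'a \<Rightarrow> nat" where k: "Q = dyadic_cube n k" "\<And>j. k j < 2 ^ n"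
    using assms by (auto simp: dyadic_cubes_def)
  define x :: "real ^ 'a" where "x = (\<chi> j. real (k j) / 2 ^ n)"
  have "x \<in> torus"
    using k(2) by (simp add: x_def torus_def)
  moreover have "Q = dyadic_cube_at n x"
    by (simp add: k(1) dyadic_cube_floor dyadic_cube_at_def x_def)
  ultimately show thesis by (rule that)
qed

lemma dyadic_cube_at_of_mem:
  assumes "Q \<in> dyadic_cubes" "x \<in> Q"
  obtains n where "Q = dyadic_cube_at n x"
  using assms by (metis dyadic_cubesE dyadic_cube_at_cong)

lemma dyadic_cube_at_0: "x \<in> torus \<Longrightarrow> dyadic_cube_at 0 x = torus"
proof -
  have fl: "\<lfloor>a\<rfloor> = 0 \<longleftrightarrow> 0 \<le> a \<and> a < 1" for a :: real by linarith
  assume "x \<in> torus"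
  then have z: "\<lfloor>x $ j\<rfloor> = 0" for j
    unfolding fl by (simp add: torus_def)
  show "dyadic_cube_at 0 x = torus"
    unfolding dyadic_cube_at_def torus_def by (simp only: z fl power_0 mult_1_left)
qed

lemma dyadic_cubes_subset_torus: "Q \<in> dyadic_cubes \<Longrightarrow> Q \<subseteq> torus"
  by (metis dyadic_cubesE dyadic_cube_at_0 dyadic_cube_at_antimono le0)

lemma dyadic_cubes_nonempty: "Q \<in> dyadic_cubes \<Longrightarrow> Q \<noteq> {}"
  by (metis dyadic_cubesE dyadic_cube_at_self empty_iff)

lemma dyadic_cubes_nested:
  assumes "Q \<in> dyadic_cubes" "R \<in> dyadic_cubes" "Q \<inter> R \<noteq> {}"
  shows "Q \<subseteq> R \<or> R \<subseteq> Q"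
proof -
  obtain x where x: "x \<in> Q" "x \<in> R" using assms(3) by blast
  obtain n m where "Q = dyadic_cube_at n x" "R = dyadic_cube_at m x"
    using dyadic_cube_at_of_mem[OF assms(1) x(1)] dyadic_cube_at_of_mem[OF assms(2) x(2)] by metis
  then show ?thesis
    using dyadic_cube_at_antimono[of n m x] dyadic_cube_at_antimono[of m n x] by (cases "n \<le> m") auto
qed

lemma countable_dyadic_cubes: "countable (dyadic_cubes :: (real ^ 'n::finite) set set)"
proof -
  have "dyadic_cubes \<subseteq> range (\<lambda>(n, k). dyadic_cube n k :: (real ^ 'n) set)"
    by (auto simp: dyadic_cubes_def)
  then show ?thesis
    by (rule countable_subset) simp
qed

lemma dyadic_cube_at_between_boxes:
  fixes x :: "real ^ 'n::finite"
  obtains a :: "real ^ 'n" where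
    "box a (a + (\<chi> j. 1 / 2 ^ n)) \<subseteq> dyadic_cube_at n x"
    "dyadic_cube_at n x \<subseteq> cbox a (a + (\<chi> j. 1 / 2 ^ n))"
proof
  let ?a = "(\<chi> j. \<lfloor>2 ^ n * x $ j\<rfloor> / 2 ^ n) :: real ^ 'n"
  have iff: "y \<in> dyadic_cube_at n x \<longleftrightarrow>
      (\<forall>j. ?a $ j \<le> y $ j \<and> y $ j < (?a + (\<chi> j. 1 / 2 ^ n)) $ j)" for y
    by (simp add: dyadic_cube_at_def floor_eq_iff field_simps)
  show "box ?a (?a + (\<chi> j. 1 / 2 ^ n)) \<subseteq> dyadic_cube_at n x"
    by (rule subsetI, unfold iff mem_box_cart, blast intro: less_imp_le)
  show "dyadic_cube_at n x \<subseteq> cbox ?a (?a + (\<chi> j. 1 / 2 ^ n))"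
    by (rule subsetI, unfold iff mem_box_cart, blast intro: less_imp_le)
qed

lemma
  fixes x :: "real ^ 'n::finite"
  shows bounded_dyadic_cube_at: "bounded (dyadic_cube_at n x)"
    and diameter_dyadic_cube_at: "diameter (dyadic_cube_at n x) = sqrt (real CARD('n)) / 2 ^ n"
    and emeasure_interior_dyadic_cube_at:
      "emeasure lborel (interior (dyadic_cube_at n x)) = ennreal ((1 / 2 ^ n) ^ CARD('n))"
    and emeasure_dyadic_cube_at:
      "emeasure lborel (dyadic_cube_at n x) = ennreal ((1 / 2 ^ n) ^ CARD('n))"
    and dyadic_cube_at_borel: "dyadic_cube_at n x \<in> sets borel"
proof -
  let ?e = "(\<chi> j. 1 / 2 ^ n) :: real ^ 'n" and ?Q = "dyadic_cube_at n x"
  obtain a where a: "box a (a + ?e) \<subseteq> ?Q" "?Q \<subseteq> cbox a (a + ?e)"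
    by (rule dyadic_cube_at_between_boxes)
  have le: "\<And>i. i \<in> Basis \<Longrightarrow> a \<bullet> i \<le> (a + ?e) \<bullet> i"
    by (auto simp: Basis_vec_def inner_axis)
  have ne: "box a (a + ?e) \<noteq> {}"
    by (auto simp: box_ne_empty Basis_vec_def inner_axis)
  show bdd: "bounded ?Q"
    using a(2) bounded_cbox bounded_subset by blast
  have "norm ?e = sqrt (real CARD('n)) / 2 ^ n"
    by (simp add: norm_vec_def L2_set_def power_divide real_sqrt_divide)
  then have "diameter (cbox a (a + ?e)) = sqrt (real CARD('n)) / 2 ^ n"
    using diameter_cbox[of a "a + ?e"] le by (simp add: dist_norm)
  moreover have "diameter (box a (a + ?e)) = diameter (cbox a (a + ?e))"
    using diameter_closure[OF bounded_box, of a "a + ?e"] closure_box[OF ne] by simp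
  ultimately show "diameter ?Q = sqrt (real CARD('n)) / 2 ^ n"
    using diameter_subset[OF a(1) bdd] diameter_subset[OF a(2) bounded_cbox] by simp
  show borel: "?Q \<in> sets borel"
  proof -
    have "?Q = (\<Inter>j. {y. \<lfloor>2 ^ n * y $ j\<rfloor> = \<lfloor>2 ^ n * x $ j\<rfloor>})"
      by (auto simp: dyadic_cube_at_def)
    also have "\<dots> \<in> sets borel"
    proof (intro sets.finite_INT)
      fix j
      have [measurable]: "(\<lambda>y :: real ^ 'n. y $ j) \<in> borel_measurable borel"
        by (intro borel_measurable_continuous_onI continuous_intros)
      show "{y :: real ^ 'n. \<lfloor>2 ^ n * y $ j\<rfloor> = \<lfloor>2 ^ n * x $ j\<rfloor>} \<in> sets borel"
        by measurable
    qed auto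
    finally show ?thesis .
  qed
  have 1: "emeasure lborel (box a (a + ?e)) = ennreal ((1 / 2 ^ n) ^ CARD('n))"
    "emeasure lborel (cbox a (a + ?e)) = ennreal ((1 / 2 ^ n) ^ CARD('n))"
  proof -
    have "(\<Prod>i\<in>Basis. ((a + ?e) - a) \<bullet> i) = (\<Prod>i\<in>(Basis :: (real ^ 'n) set). 1 / 2 ^ n)"
      by (intro prod.cong) (auto simp: Basis_vec_def inner_axis)
    also have "\<dots> = (1 / 2 ^ n) ^ CARD('n)" by simp
    finally show "emeasure lborel (box a (a + ?e)) = ennreal ((1 / 2 ^ n) ^ CARD('n))"
      "emeasure lborel (cbox a (a + ?e)) = ennreal ((1 / 2 ^ n) ^ CARD('n))"
      using le by (simp_all only: emeasure_lborel_box emeasure_lborel_cbox)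
  qed
  have "box a (a + ?e) \<subseteq> interior ?Q"
    using a(1) by (intro interior_maximal open_box)
  then have 2: "emeasure lborel (box a (a + ?e)) \<le> emeasure lborel (interior ?Q)"
    by (intro emeasure_mono) auto
  have 3: "emeasure lborel (interior ?Q) \<le> emeasure lborel ?Q"
    using borel by (intro emeasure_mono interior_subset) auto
  have 4: "emeasure lborel ?Q \<le> emeasure lborel (cbox a (a + ?e))"
    using a(2) by (intro emeasure_mono) auto
  show "emeasure lborel (interior ?Q) = ennreal ((1 / 2 ^ n) ^ CARD('n))"
    using 2 order_trans[OF 3 4] unfolding 1 by (rule antisym[rotated])
  show "emeasure lborel ?Q = ennreal ((1 / 2 ^ n) ^ CARD('n))"
    using order_trans[OF 2 3] 4 unfolding 1 by (rule antisym[rotated])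
qed

lemma bounded_dyadic_cubes: "Q \<in> dyadic_cubes \<Longrightarrow> bounded Q"
  by (metis dyadic_cubesE bounded_dyadic_cube_at)

lemma diameter_dyadic_cubes_pos: "Q \<in> dyadic_cubes \<Longrightarrow> 0 < diameter Q"
  by (rule dyadic_cubesE, assumption) (simp add: diameter_dyadic_cube_at)

lemma diameter_dyadic_cubes_mono:
  "Q \<subseteq> R \<Longrightarrow> R \<in> dyadic_cubes \<Longrightarrow> diameter Q \<le> diameter R"
  by (intro diameter_subset bounded_dyadic_cubes)

lemma dyadic_cube_at_level_mono:
  fixes x y :: "real ^ 'n::finite"
  assumes "dyadic_cube_at m y \<subseteq> dyadic_cube_at n x" shows "n \<le> m"
proof -
  have "sqrt (real CARD('n)) / 2 ^ m \<le> sqrt (real CARD('n)) / 2 ^ n"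
    using diameter_subset[OF assms bounded_dyadic_cube_at] by (simp add: diameter_dyadic_cube_at)
  then have "(2 :: real) ^ n \<le> 2 ^ m" by (simp add: field_simps)
  then show ?thesis by simp
qed

lemma dyadic_cube_at_closure_subset_open:
  fixes x :: "real ^ 'n::finite"
  assumes "open S" "x \<in> S"
  obtains n where "closure (dyadic_cube_at n x) \<subseteq> S"
proof -
  obtain e where e: "0 < e" "ball x e \<subseteq> S"
    using assms open_contains_ball by blast
  obtain n where n: "(1 / 2 :: real) ^ n < e / sqrt (real CARD('n))"
    using real_arch_pow_inv[of "e / sqrt (real CARD('n))" "1 / 2"] e by auto
  have "y \<in> ball x e" if "y \<in> closure (dyadic_cube_at n x)" for y
  proof -
    have "dist x y \<le> diameter (closure (dyadic_cube_at n x))"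
      using that closure_subset[of "dyadic_cube_at n x"] dyadic_cube_at_self
      by (intro diameter_bounded_bound) (auto simp: bounded_closure bounded_dyadic_cube_at)
    also have "\<dots> = sqrt (real CARD('n)) / 2 ^ n"
      by (simp add: diameter_closure bounded_dyadic_cube_at diameter_dyadic_cube_at)
    also have "\<dots> < e"
      using n by (simp add: field_simps power_one_over)
    finally show ?thesis by simp
  qed
  then show thesis using e(2) by (intro that[of n]) blast
qed

text \<open>Replacing a family of cubes by its maximal members keeps the union and makes the family
  disjoint; maximal members exist because a cube has only finitely many dyadic ancestors.\<close>

definition maximal_cubes :: "(real ^ 'n::finite) set set \<Rightarrow> (real ^ 'n) set set" where
  "maximal_cubes \<Q> = {Q \<in> \<Q>. \<forall>Q'\<in>\<Q>. Q \<subseteq> Q' \<longrightarrow> Q' = Q}"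

lemma maximal_cubes_subset: "maximal_cubes \<Q> \<subseteq> \<Q>"
  by (auto simp: maximal_cubes_def)

lemma subset_maximal_cube:
  assumes "\<Q> \<subseteq> dyadic_cubes" "Q \<in> \<Q>"
  obtains Q' where "Q' \<in> maximal_cubes \<Q>" "Q \<subseteq> Q'"
proof -
  obtain n x where Q: "Q = dyadic_cube_at n x"
    using assms by (metis dyadic_cubesE subsetD)
  define m where "m = (LEAST m. dyadic_cube_at m x \<in> \<Q>)"
  have m: "dyadic_cube_at m x \<in> \<Q>"
    unfolding m_def using assms(2) Q by (metis LeastI)
  have "Q' = dyadic_cube_at m x" if "Q' \<in> \<Q>" "dyadic_cube_at m x \<subseteq> Q'" for Q'
  proof -
    have "x \<in> Q'" using that dyadic_cube_at_self by blast
    moreover have "Q' \<in> dyadic_cubes" using that assms(1) by blast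
    ultimately obtain k where k: "Q' = dyadic_cube_at k x"
      using dyadic_cube_at_of_mem by metis
    then have "m \<le> k"
      unfolding m_def using that(1) by (intro Least_le) simp
    then show ?thesis
      using dyadic_cube_at_antimono[of m k x] that(2) k by blast
  qed
  then have "dyadic_cube_at m x \<in> maximal_cubes \<Q>"
    using m by (auto simp: maximal_cubes_def)
  moreover have "Q \<subseteq> dyadic_cube_at m x"
    unfolding Q m_def using assms(2) Q by (intro dyadic_cube_at_antimono Least_le) simp
  ultimately show thesis by (rule that)
qed

lemma Union_maximal_cubes: "\<Q> \<subseteq> dyadic_cubes \<Longrightarrow> \<Union>(maximal_cubes \<Q>) = \<Union>\<Q>"
  using maximal_cubes_subset[of \<Q>] subset_maximal_cube[of \<Q>] by blast

lemma disjoint_maximal_cubes: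
  assumes "\<Q> \<subseteq> dyadic_cubes" shows "disjoint (maximal_cubes \<Q>)"
  unfolding disjoint_def
proof (intro ballI impI)
  fix P Q assume PQ: "P \<in> maximal_cubes \<Q>" "Q \<in> maximal_cubes \<Q>" "P \<noteq> Q"
  then have "\<not> P \<subseteq> Q" "\<not> Q \<subseteq> P" "P \<in> dyadic_cubes" "Q \<in> dyadic_cubes"
    using assms by (auto simp: maximal_cubes_def)
  then show "P \<inter> Q = {}"
    using dyadic_cubes_nested[of P Q] by blast
qed

section \<open>The cost of a cover\<close>

text \<open>Covers are sets of cubes here, not indexed families; \<open>cover_cost_le_infsum\<close> is the link with
  \<open>dyadic_net_content\<close>. As an integral for a counting measure the cost is additive over disjoint
  unions of families.\<close>

definition cover_cost :: "real \<Rightarrow> (real ^ 'n::finite) set set \<Rightarrow> ennreal" where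
  "cover_cost t \<Q> = (\<integral>\<^sup>+Q. ennreal (diameter Q powr t) \<partial>count_space \<Q>)"

lemma emeasure_density_count_space:
  "emeasure (density (count_space UNIV) f) B = (\<integral>\<^sup>+x. f x \<partial>count_space B)"
  by (subst emeasure_density) (auto simp: nn_integral_count_space_indicator)

lemma nn_integral_count_space_mono_set:
  "A \<subseteq> B \<Longrightarrow> (\<integral>\<^sup>+x. f x \<partial>count_space A) \<le> (\<integral>\<^sup>+x. f x \<partial>count_space B)"
  unfolding emeasure_density_count_space[symmetric] by (rule emeasure_mono) auto

lemma cover_cost_mono: "\<P> \<subseteq> \<Q> \<Longrightarrow> cover_cost t \<P> \<le> cover_cost t \<Q>"
  unfolding cover_cost_def by (rule nn_integral_count_space_mono_set)

lemma le_cover_cost: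
  assumes "Q \<in> \<Q>" shows "ennreal (diameter Q powr t) \<le> cover_cost t \<Q>"
  using cover_cost_mono[of "{Q}" \<Q> t] assms
  by (simp add: cover_cost_def nn_integral_count_space_finite)

lemma cover_cost_ge_of_superset:
  assumes "R \<in> dyadic_cubes" "\<Q> \<subseteq> dyadic_cubes" "Q \<in> \<Q>" "R \<subseteq> Q" "0 < t"
  shows "ennreal (diameter R powr t) \<le> cover_cost t \<Q>"
proof -
  have "diameter R powr t \<le> diameter Q powr t"
    using assms diameter_dyadic_cubes_mono[of R Q] diameter_dyadic_cubes_pos[of R]
    by (intro powr_mono2) auto
  then have "ennreal (diameter R powr t) \<le> ennreal (diameter Q powr t)" by (rule ennreal_leI)
  also have "\<dots> \<le> cover_cost t \<Q>" using assms(3) by (rule le_cover_cost)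
  finally show ?thesis .
qed

lemma nn_integral_count_space_UN:
  assumes "countable I" "disjoint_family_on A I"
  shows "(\<integral>\<^sup>+i. (\<integral>\<^sup>+x. f x \<partial>count_space (A i)) \<partial>count_space I) = (\<integral>\<^sup>+x. f x \<partial>count_space (\<Union>i\<in>I. A i))"
proof -
  let ?M = "density (count_space UNIV) f"
  have "emeasure ?M (\<Union>i\<in>I. A i) = (\<integral>\<^sup>+i. emeasure ?M (A i) \<partial>count_space I)"
    using assms by (intro emeasure_UN_countable) auto
  then show ?thesis by (simp only: emeasure_density_count_space)
qed

lemma nn_integral_count_space_Un:
  assumes "A \<inter> B = {}"
  shows "(\<integral>\<^sup>+x. f x \<partial>count_space (A \<union> B)) = (\<integral>\<^sup>+x. f x \<partial>count_space A) + (\<integral>\<^sup>+x. f x \<partial>count_space B)"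
  unfolding emeasure_density_count_space[symmetric]
  using assms by (intro plus_emeasure[symmetric]) auto

text \<open>If the part of \<open>\<Q>\<close> inside each \<open>P\<close> of a disjoint family \<open>\<D>\<close> is exchanged for \<open>P\<close> itself,
  and \<open>P\<close> is no more expensive than what it replaces, the total does not grow. Allowing a second
  weight \<open>\<phi>\<close> for the new family serves the comparison with volume in \<open>cover_cost_self_improvement\<close>.\<close>

lemma nn_integral_replace_subcovers:
  fixes \<phi> w :: "'b set \<Rightarrow> ennreal"
  assumes "countable \<D>" "disjoint \<D>" and ne: "{} \<notin> \<Q>"
    and D: "\<And>P. P \<in> \<D> \<Longrightarrow> \<phi> P \<le> (\<integral>\<^sup>+Q. w Q \<partial>count_space {Q \<in> \<Q>. Q \<subseteq> P})"
    and Q: "\<And>Q. Q \<in> \<Q> \<Longrightarrow> \<phi> Q \<le> w Q"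
  shows "(\<integral>\<^sup>+Q. \<phi> Q \<partial>count_space (\<D> \<union> {Q \<in> \<Q>. \<forall>P\<in>\<D>. \<not> Q \<subseteq> P})) \<le> (\<integral>\<^sup>+Q. w Q \<partial>count_space \<Q>)"
    (is "(\<integral>\<^sup>+Q. \<phi> Q \<partial>count_space (\<D> \<union> ?O)) \<le> _")
proof -
  let ?in = "\<lambda>P. {Q \<in> \<Q>. Q \<subseteq> P}"
  have disj: "disjoint_family_on ?in \<D>"
    unfolding disjoint_family_on_def
  proof (intro ballI impI)
    fix P P' assume "P \<in> \<D>" "P' \<in> \<D>" "P \<noteq> P'"
    then have "P \<inter> P' = {}" using assms(2) by (auto simp: disjoint_def)
    then have "Q = {}" if "Q \<subseteq> P" "Q \<subseteq> P'" for Q using that by blast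
    then show "?in P \<inter> ?in P' = {}" using ne by blast
  qed
  have "\<D> \<inter> ?O = {}" by auto
  then have "(\<integral>\<^sup>+Q. \<phi> Q \<partial>count_space (\<D> \<union> ?O)) = (\<integral>\<^sup>+Q. \<phi> Q \<partial>count_space \<D>) + (\<integral>\<^sup>+Q. \<phi> Q \<partial>count_space ?O)"
    by (rule nn_integral_count_space_Un)
  also have "\<dots> \<le> (\<integral>\<^sup>+P. (\<integral>\<^sup>+Q. w Q \<partial>count_space (?in P)) \<partial>count_space \<D>) + (\<integral>\<^sup>+Q. w Q \<partial>count_space ?O)"
    using D Q by (intro add_mono nn_integral_mono) auto
  also have "\<dots> = (\<integral>\<^sup>+Q. w Q \<partial>count_space (\<Union>P\<in>\<D>. ?in P)) + (\<integral>\<^sup>+Q. w Q \<partial>count_space ?O)"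
    using assms(1) disj by (subst nn_integral_count_space_UN) auto
  also have "\<dots> = (\<integral>\<^sup>+Q. w Q \<partial>count_space ((\<Union>P\<in>\<D>. ?in P) \<union> ?O))"
    by (rule nn_integral_count_space_Un[symmetric]) auto
  also have "(\<Union>P\<in>\<D>. ?in P) \<union> ?O = \<Q>" by auto
  finally show ?thesis .
qed

lemma emeasure_le_count_space_cover:
  assumes "countable \<C>" "\<And>Q. Q \<in> \<C> \<Longrightarrow> Q \<in> sets M" "R \<subseteq> \<Union>\<C>"
  shows "emeasure M R \<le> (\<integral>\<^sup>+Q. emeasure M Q \<partial>count_space \<C>)"
proof -
  have "emeasure M R \<le> emeasure M (\<Union>\<C>)"
    using assms by (intro emeasure_mono sets.countable_Union) auto
  also have "\<dots> = (\<integral>\<^sup>+x. indicator (\<Union>\<C>) x \<partial>M)"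
    using assms by (intro nn_integral_indicator[symmetric] sets.countable_Union) auto
  also have "\<dots> \<le> (\<integral>\<^sup>+x. (\<integral>\<^sup>+Q. indicator Q x \<partial>count_space \<C>) \<partial>M)"
  proof (rule nn_integral_mono)
    fix x
    show "indicator (\<Union>\<C>) x \<le> (\<integral>\<^sup>+Q. indicator Q x \<partial>count_space \<C> :: ennreal)"
    proof (cases "x \<in> \<Union>\<C>")
      case True
      then obtain Q where Q: "Q \<in> \<C>" "x \<in> Q" by auto
      have "indicator (\<Union>\<C>) x = (1 :: ennreal)"
        using True by (rule indicator_simps(1))
      also have "\<dots> = (\<integral>\<^sup>+Q. indicator Q x \<partial>count_space {Q})"
        using Q by (simp add: nn_integral_count_space_finite)
      also have "\<dots> \<le> (\<integral>\<^sup>+Q. indicator Q x \<partial>count_space \<C>)"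
        using Q by (intro nn_integral_count_space_mono_set) auto
      finally show ?thesis .
    qed simp
  qed
  also have "\<dots> = (\<integral>\<^sup>+Q. (\<integral>\<^sup>+x. indicator Q x \<partial>M) \<partial>count_space \<C>)"
    using assms by (intro nn_integral_count_space_nn_integral) auto
  also have "\<dots> = (\<integral>\<^sup>+Q. emeasure M Q \<partial>count_space \<C>)"
    using assms(2) by (intro nn_integral_cong) auto
  finally show ?thesis .
qed


lemma dyadic_cubes_borel: "Q \<in> dyadic_cubes \<Longrightarrow> Q \<in> sets borel"
  by (metis dyadic_cubesE dyadic_cube_at_borel)

section \<open>Self-improvement and intersections\<close>

text \<open>Rescaled so that volume and weight agree on a cube of level \<open>n\<close>, the volume of a cube of
  level \<open>k \<ge> n\<close> is its weight times \<open>(2 powr (t - d)) ^ (k - n)\<close>.\<close>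

lemma volume_vs_diameter_powr:
  fixes x y :: "real ^ 'n::finite"
  assumes "n \<le> k"
  shows "emeasure lborel (dyadic_cube_at k y) * ennreal (diameter (dyadic_cube_at n x) powr t * 2 ^ (n * CARD('n)))
    = ennreal ((2 powr (t - real CARD('n))) ^ (k - n) * diameter (dyadic_cube_at k y) powr t)"
proof -
  let ?d = "CARD('n)"
  define D where "D = sqrt (real ?d)"
  have D: "0 < D" by (simp add: D_def)
  have k: "real k = real n + real (k - n)" using assms by simp
  have pow: "(2 :: real) ^ m = 2 powr real m" for m by (simp add: powr_realpow)
  have dpow: "(D / 2 ^ m) powr t = D powr t * 2 powr (- (real m * t))" for m
    unfolding pow using D by (simp add: powr_divide powr_powr powr_minus_divide)
  have "(1 / 2 ^ k) ^ ?d * ((D / 2 ^ n) powr t * 2 ^ (n * ?d))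
      = D powr t * (2 powr (- (real k * real ?d)) * 2 powr (- (real n * t)) * 2 powr (real n * real ?d))"
  proof -
    have a: "(1 / 2 ^ k :: real) ^ ?d = 2 powr (- (real k * real ?d))"
      using pow[of "k * ?d"] by (simp add: power_one_over power_mult powr_minus_divide)
    have b: "(2 :: real) ^ (n * ?d) = 2 powr (real n * real ?d)"
      using pow[of "n * ?d"] by simp
    show ?thesis unfolding a b dpow by (simp only: mult_ac)
  qed
  also have "2 powr (- (real k * real ?d)) * 2 powr (- (real n * t)) * 2 powr (real n * real ?d)
      = 2 powr ((t - real ?d) * real (k - n)) * 2 powr (- (real k * t))"
    unfolding powr_add[symmetric] k by (simp add: algebra_simps)
  also have "2 powr ((t - real ?d) * real (k - n)) = (2 powr (t - real ?d)) ^ (k - n)"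
    by (simp add: powr_power mult.commute)
  finally have "(1 / 2 ^ k) ^ ?d * ((D / 2 ^ n) powr t * 2 ^ (n * ?d))
      = (2 powr (t - real ?d)) ^ (k - n) * (D / 2 ^ k) powr t"
    by (simp add: dpow mult_ac)
  then show ?thesis
    unfolding emeasure_dyadic_cube_at diameter_dyadic_cube_at D_def[symmetric]
    by (simp add: ennreal_mult[symmetric])
qed

text \<open>Let no cube of the cover contain \<open>R\<close>, and let \<open>\<D>\<close> be the cubes \<open>m\<close> levels below \<open>R\<close> that lie
  in no cube of the cover. The part of the cover inside \<open>P \<in> \<D>\<close> costs at least \<open>c\<close> times the
  weight of \<open>P\<close>, which for large \<open>m\<close> is at least the volume of \<open>P\<close>, rescaled to match the weight on \<open>R\<close>.
  The weight of any other covering cube inside \<open>R\<close> is at least its rescaled volume as well. Together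
  with \<open>\<D>\<close> these cubes cover \<open>R\<close>, so the cost is at least the rescaled volume of \<open>R\<close>.\<close>

lemma cover_cost_self_improvement:
  fixes G :: "(real ^ 'n::finite) set"
  assumes t: "t < real CARD('n)" and c: "0 < c"
    and big: "\<And>R \<Q>. R \<in> dyadic_cubes \<Longrightarrow> \<Q> \<subseteq> dyadic_cubes \<Longrightarrow> G \<inter> interior R \<subseteq> \<Union>\<Q> \<Longrightarrow>
        ennreal (c * diameter R powr t) \<le> cover_cost t \<Q>"
    and t0: "0 < t"
    and R: "R \<in> dyadic_cubes" and QQ: "\<Q> \<subseteq> dyadic_cubes" and cover: "G \<inter> interior R \<subseteq> \<Union>\<Q>"
  shows "ennreal (diameter R powr t) \<le> cover_cost t \<Q>"
proof (cases "\<exists>Q\<in>\<Q>. R \<subseteq> Q")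
  case True
  then show ?thesis using cover_cost_ge_of_superset[OF R QQ] t0 by blast
next
  case False
  obtain n z where z: "z \<in> torus" "R = dyadic_cube_at n z"
    using R by (rule dyadic_cubesE)
  define q where "q = 2 powr (t - real CARD('n))"
  have q: "0 < q" "q < 1" using t by (auto simp: q_def powr_less_one)
  obtain m where m: "q ^ m < c" using real_arch_pow_inv[OF c q(2)] by blast
  define K where "K = ennreal (diameter R powr t * 2 ^ (n * CARD('n)))"
  define \<phi> where "\<phi> = (\<lambda>Q :: (real ^ 'n) set. emeasure lborel Q * K)"
  have \<phi>: "\<phi> (dyadic_cube_at k y) = ennreal (q ^ (k - n) * diameter (dyadic_cube_at k y) powr t)" if "n \<le> k" for k y
    unfolding \<phi>_def K_def z q_def using that by (rule volume_vs_diameter_powr)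
  let ?Q = "{Q \<in> \<Q>. Q \<subseteq> R}"
  \<comment> \<open>\<open>K\<close> scales volume so that \<open>\<phi> R\<close> is the weight of \<open>R\<close>; \<open>m\<close> is chosen so that \<open>\<phi> P \<le> c w(P)\<close> on \<open>\<D>\<close>.\<close>
  define \<D> where "\<D> = {P. P \<subseteq> R \<and> (\<exists>y\<in>torus. P = dyadic_cube_at (n + m) y) \<and> (\<forall>Q\<in>\<Q>. \<not> P \<subseteq> Q)}"
  have D_cubes: "\<D> \<subseteq> dyadic_cubes"
    by (auto simp: \<D>_def dyadic_cube_at_in_dyadic_cubes)
  have at: "P = dyadic_cube_at (n + m) x" if P: "P \<in> \<D>" "x \<in> P" for P x
  proof -
    obtain y where y: "P = dyadic_cube_at (n + m) y" using P(1) by (auto simp: \<D>_def)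
    show ?thesis using dyadic_cube_at_cong[of x "n + m" y] P(2) unfolding y by simp
  qed
  have "(\<integral>\<^sup>+Q. \<phi> Q \<partial>count_space (\<D> \<union> {Q \<in> ?Q. \<forall>P\<in>\<D>. \<not> Q \<subseteq> P})) \<le> (\<integral>\<^sup>+Q. ennreal (diameter Q powr t) \<partial>count_space ?Q)"
  proof (rule nn_integral_replace_subcovers)
    show "countable \<D>" using D_cubes countable_dyadic_cubes countable_subset by blast
    show "disjoint \<D>" unfolding disjoint_def using at by blast
    show "{} \<notin> ?Q" using QQ dyadic_cubes_nonempty by blast
  next
    fix P assume P: "P \<in> \<D>"
    then have PR: "P \<subseteq> R" and Pc: "P \<in> dyadic_cubes" using D_cubes by (auto simp: \<D>_def)
    have "\<phi> P \<le> ennreal (c * diameter P powr t)"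
    proof -
      obtain y where y: "P = dyadic_cube_at (n + m) y" using P by (auto simp: \<D>_def)
      show ?thesis unfolding y by (subst \<phi>) (use m in \<open>auto intro!: ennreal_leI mult_right_mono\<close>)
    qed
    also have "\<dots> \<le> cover_cost t {Q \<in> ?Q. Q \<subseteq> P}"
    proof (rule big[OF Pc])
      show "{Q \<in> ?Q. Q \<subseteq> P} \<subseteq> dyadic_cubes" using QQ by auto
      show "G \<inter> interior P \<subseteq> \<Union>{Q \<in> ?Q. Q \<subseteq> P}"
      proof
        fix x assume x: "x \<in> G \<inter> interior P"
        then obtain Q where Q: "Q \<in> \<Q>" "x \<in> Q"
          using cover interior_mono[OF PR] by blast
        have "x \<in> P" using x interior_subset by blast
        then have "Q \<inter> P \<noteq> {}" using Q(2) by blast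
        moreover have "\<not> P \<subseteq> Q" using P Q(1) by (simp add: \<D>_def)
        moreover have "Q \<in> dyadic_cubes" using Q(1) QQ by (rule subsetD[rotated])
        ultimately have "Q \<subseteq> P" using dyadic_cubes_nested[of Q P] Pc by simp
        then show "x \<in> \<Union>{Q \<in> ?Q. Q \<subseteq> P}" using Q PR by blast
      qed
    qed
    finally show "\<phi> P \<le> (\<integral>\<^sup>+Q. ennreal (diameter Q powr t) \<partial>count_space {Q \<in> ?Q. Q \<subseteq> P})"
      by (simp add: cover_cost_def)
  next
    fix Q assume "Q \<in> ?Q"
    then have Q: "Q \<in> \<Q>" "Q \<subseteq> R" by auto
    obtain k y where y: "Q = dyadic_cube_at k y" using Q(1) QQ by (meson dyadic_cubesE subsetD)
    have "n \<le> k" using Q(2) unfolding y z by (rule dyadic_cube_at_level_mono)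
    moreover have "q ^ (k - n) \<le> 1" using q by (simp add: power_le_one)
    ultimately show "\<phi> Q \<le> ennreal (diameter Q powr t)"
      unfolding y by (subst \<phi>) (auto intro!: ennreal_leI mult_left_le_one_le simp: q less_imp_le)
  qed
  also have "\<dots> \<le> cover_cost t \<Q>"
    unfolding cover_cost_def by (rule nn_integral_count_space_mono_set) auto
  finally have 1: "(\<integral>\<^sup>+Q. \<phi> Q \<partial>count_space (\<D> \<union> {Q \<in> ?Q. \<forall>P\<in>\<D>. \<not> Q \<subseteq> P})) \<le> cover_cost t \<Q>" .
  let ?C = "\<D> \<union> {Q \<in> ?Q. \<forall>P\<in>\<D>. \<not> Q \<subseteq> P}"
  have C: "?C \<subseteq> dyadic_cubes" using D_cubes QQ by auto
  have "R \<subseteq> \<Union>?C"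
  proof
    fix x assume x: "x \<in> R"
    then have Rx: "R = dyadic_cube_at n x" using dyadic_cube_at_cong z by blast
    have xt: "x \<in> torus" using x dyadic_cubes_subset_torus[OF R] by blast
    let ?P = "dyadic_cube_at (n + m) x"
    have PR: "?P \<subseteq> R" unfolding Rx by (intro dyadic_cube_at_antimono) simp
    have xP: "x \<in> ?P" by (rule dyadic_cube_at_self)
    show "x \<in> \<Union>?C"
    proof (cases "?P \<in> \<D>")
      case True then show ?thesis using xP by blast
    next
      case notD: False
      then obtain Q where Q: "Q \<in> \<Q>" "?P \<subseteq> Q"
        using PR xt by (auto simp: \<D>_def)
      have xQ: "x \<in> Q" using Q(2) xP by (rule subsetD)
      have "Q \<in> dyadic_cubes" using Q(1) QQ by (rule subsetD[rotated])
      moreover have "Q \<inter> R \<noteq> {}" "\<not> R \<subseteq> Q" using x xQ False Q(1) by blast+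
      ultimately have "Q \<subseteq> R"
        using dyadic_cubes_nested[of Q R] R by simp
      moreover have "\<not> Q \<subseteq> P" if P: "P \<in> \<D>" for P
      proof
        assume "Q \<subseteq> P"
        then have "x \<in> P" using xQ by (rule subsetD)
        then have "P = ?P" by (rule at[OF P])
        then show False using P notD by simp
      qed
      ultimately show ?thesis using Q xP by blast
    qed
  qed
  then have "emeasure lborel R \<le> (\<integral>\<^sup>+Q. emeasure lborel Q \<partial>count_space ?C)"
    using C by (intro emeasure_le_count_space_cover countable_subset[OF C countable_dyadic_cubes])
      (auto simp: dyadic_cubes_borel)
  then have "emeasure lborel R * K \<le> (\<integral>\<^sup>+Q. \<phi> Q \<partial>count_space ?C)"
    unfolding \<phi>_def by (subst nn_integral_multc) (auto intro: mult_right_mono)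
  moreover have "emeasure lborel R * K = ennreal (diameter R powr t)"
    using \<phi>[of n z] by (simp add: \<phi>_def z)
  ultimately show ?thesis using 1 by simp
qed

text \<open>Positions from which the limit point of \<open>cover_cost_Inter_ge\<close> can still escape the cover.\<close>

definition undercovered :: "real \<Rightarrow> (real ^ 'n::finite) set set \<Rightarrow> (real ^ 'n) set \<Rightarrow> bool" where
  "undercovered t \<Q> R \<longleftrightarrow> (\<forall>Q\<in>\<Q>. \<not> R \<subseteq> Q) \<and> cover_cost t {Q \<in> \<Q>. Q \<subseteq> R} < ennreal (diameter R powr t)"

text \<open>If every cube \<open>P\<close> deep inside \<open>G \<inter> interior R\<close> were contained in a cube of \<open>\<Q>\<close> or covered at
  full price by the cubes of \<open>\<Q>\<close> inside it, exchanging the latter cubes for \<open>P\<close> would give a cover of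
  \<open>G \<inter> interior R\<close> that is cheaper than \<open>R\<close>.\<close>

lemma undercovered_descend:
  fixes G :: "(real ^ 'n::finite) set"
  assumes op: "open (G \<inter> interior R)"
    and big: "\<And>\<Q>. \<Q> \<subseteq> dyadic_cubes \<Longrightarrow> G \<inter> interior R \<subseteq> \<Union>\<Q> \<Longrightarrow>
        ennreal (diameter R powr t) \<le> cover_cost t \<Q>"
    and R: "R \<in> dyadic_cubes" and QQ: "\<Q> \<subseteq> dyadic_cubes" and under: "undercovered t \<Q> R"
  shows "\<exists>P\<in>dyadic_cubes. undercovered t \<Q> P \<and> P \<subseteq> G \<and> closure P \<subseteq> interior R"
proof (rule ccontr)
  assume none: "\<not> ?thesis"
  let ?w = "\<lambda>Q :: (real ^ 'n) set. ennreal (diameter Q powr t)"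
  let ?Q = "{Q \<in> \<Q>. Q \<subseteq> R}"
  define \<C> where "\<C> = {P \<in> dyadic_cubes. closure P \<subseteq> interior R \<and> ?w P \<le> cover_cost t {Q \<in> \<Q>. Q \<subseteq> P}}"
  have C: "\<C> \<subseteq> dyadic_cubes" by (auto simp: \<C>_def)
  let ?D = "maximal_cubes \<C>"
  have D: "?D \<subseteq> dyadic_cubes" using C maximal_cubes_subset by blast
  let ?O = "{Q \<in> ?Q. \<forall>P\<in>?D. \<not> Q \<subseteq> P}"
  have "cover_cost t (?D \<union> ?O) \<le> cover_cost t ?Q"
    unfolding cover_cost_def
  proof (rule nn_integral_replace_subcovers)
    show "countable ?D" using D countable_dyadic_cubes countable_subset by blast
    show "disjoint ?D" using C by (rule disjoint_maximal_cubes)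
    show "{} \<notin> ?Q" using QQ dyadic_cubes_nonempty by blast
  next
    fix P assume "P \<in> ?D"
    then have P: "closure P \<subseteq> interior R" "?w P \<le> cover_cost t {Q \<in> \<Q>. Q \<subseteq> P}"
      using maximal_cubes_subset by (auto simp: \<C>_def)
    then have "P \<subseteq> R" using closure_subset interior_subset by blast
    then have "{Q \<in> ?Q. Q \<subseteq> P} = {Q \<in> \<Q>. Q \<subseteq> P}" by blast
    then show "?w P \<le> (\<integral>\<^sup>+Q. ?w Q \<partial>count_space {Q \<in> ?Q. Q \<subseteq> P})"
      using P(2) by (simp add: cover_cost_def)
  qed simp
  also have "\<dots> < ?w R" using under by (simp add: undercovered_def)
  finally have "cover_cost t (?D \<union> ?O) < ?w R" .
  moreover have "?w R \<le> cover_cost t (?D \<union> ?O)"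
  proof (rule big)
    show "?D \<union> ?O \<subseteq> dyadic_cubes" using D QQ by auto
    show "G \<inter> interior R \<subseteq> \<Union>(?D \<union> ?O)"
    proof
      fix x assume x: "x \<in> G \<inter> interior R"
      obtain n where n: "closure (dyadic_cube_at n x) \<subseteq> G \<inter> interior R"
        using dyadic_cube_at_closure_subset_open[OF op x] by blast
      let ?P = "dyadic_cube_at n x"
      have xR: "x \<in> R" using x interior_subset by blast
      then have "x \<in> torus" using dyadic_cubes_subset_torus[OF R] by blast
      then have P: "?P \<in> dyadic_cubes" by (rule dyadic_cube_at_in_dyadic_cubes)
      have xP: "x \<in> ?P" by (rule dyadic_cube_at_self)
      have "?P \<subseteq> G" "closure ?P \<subseteq> interior R" using n closure_subset[of ?P] by blast+
      then have "\<not> undercovered t \<Q> ?P" using none P by blast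
      then consider "?P \<in> \<C>" | Q where "Q \<in> \<Q>" "?P \<subseteq> Q"
        using P \<open>closure ?P \<subseteq> interior R\<close> by (force simp: undercovered_def \<C>_def not_less)
      then show "x \<in> \<Union>(?D \<union> ?O)"
      proof cases
        case 1
        then have "x \<in> \<Union>\<C>" using xP by blast
        then show ?thesis using Union_maximal_cubes[OF C] by auto
      next
        case (2 Q)
        have "\<not> R \<subseteq> Q" using under 2 by (simp add: undercovered_def)
        then have "Q \<subseteq> R"
          using dyadic_cubes_nested[of Q R] 2 xR xP R QQ by blast
        then show ?thesis using 2 xP by blast
      qed
    qed
  qed
  ultimately show False by simp
qed

text \<open>Descending through undercovered cubes \<open>f 0 = R, f 1, f 2, \<dots>\<close> with \<open>f (n + 1) \<subseteq> G n\<close>. The closure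
  of each cube lies in the interior of its predecessor; so the limit point belongs to all of
  the half-open cubes, and the cubes shrink. A cube of \<open>\<Q>\<close> containing the limit point would contain
  some \<open>f q\<close>.\<close>

lemma cover_cost_Inter_ge:
  fixes G :: "nat \<Rightarrow> (real ^ 'n::finite) set"
  assumes op: "\<And>n R. R \<in> dyadic_cubes \<Longrightarrow> open (G n \<inter> interior R)"
    and big: "\<And>n R \<Q>. R \<in> dyadic_cubes \<Longrightarrow> \<Q> \<subseteq> dyadic_cubes \<Longrightarrow> G n \<inter> interior R \<subseteq> \<Union>\<Q> \<Longrightarrow>
        ennreal (diameter R powr t) \<le> cover_cost t \<Q>"
    and t: "0 < t"
    and R: "R \<in> dyadic_cubes" and QQ: "\<Q> \<subseteq> dyadic_cubes" and cover: "(\<Inter>n. G n) \<inter> R \<subseteq> \<Union>\<Q>"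
  shows "ennreal (diameter R powr t) \<le> cover_cost t \<Q>"
proof (rule ccontr)
  assume less: "\<not> ?thesis"
  have "\<not> R \<subseteq> Q" if "Q \<in> \<Q>" for Q
    using cover_cost_ge_of_superset[OF R QQ that _ t] less by blast
  moreover have "cover_cost t {Q \<in> \<Q>. Q \<subseteq> R} \<le> cover_cost t \<Q>"
    by (rule cover_cost_mono) auto
  ultimately have under: "undercovered t \<Q> R"
    using less by (auto simp: undercovered_def not_le)
  have "\<exists>f. \<forall>n. (f n \<in> dyadic_cubes \<and> undercovered t \<Q> (f n) \<and> (n = 0 \<longrightarrow> f n = R)) \<and>
      (f (Suc n) \<subseteq> G n \<and> closure (f (Suc n)) \<subseteq> interior (f n))"
  proof (rule dependent_nat_choice)
    show "\<exists>P. P \<in> dyadic_cubes \<and> undercovered t \<Q> P \<and> (0 = (0 :: nat) \<longrightarrow> P = R)"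
      using R under by blast
  next
    fix P and n :: nat assume P: "P \<in> dyadic_cubes \<and> undercovered t \<Q> P \<and> (n = 0 \<longrightarrow> P = R)"
    have "\<exists>P'\<in>dyadic_cubes. undercovered t \<Q> P' \<and> P' \<subseteq> G n \<and> closure P' \<subseteq> interior P"
      using P by (intro undercovered_descend op big QQ) auto
    then show "\<exists>P'. (P' \<in> dyadic_cubes \<and> undercovered t \<Q> P' \<and> (Suc n = 0 \<longrightarrow> P' = R)) \<and>
        (P' \<subseteq> G n \<and> closure P' \<subseteq> interior P)"
      by auto
  qed
  then obtain f where f': "\<forall>n. (f n \<in> dyadic_cubes \<and> undercovered t \<Q> (f n) \<and> (n = 0 \<longrightarrow> f n = R)) \<and>
      (f (Suc n) \<subseteq> G n \<and> closure (f (Suc n)) \<subseteq> interior (f n))"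
    by (elim exE)
  have f: "\<And>n. f n \<in> dyadic_cubes" "\<And>n. undercovered t \<Q> (f n)" "f 0 = R"
    "\<And>n. f (Suc n) \<subseteq> G n" "\<And>n. closure (f (Suc n)) \<subseteq> interior (f n)"
    using f' by simp_all
  have step: "closure (f (Suc n)) \<subseteq> f n" for n
    using f(5)[of n] interior_subset by blast
  have "(\<Inter>n. closure (f n)) \<noteq> {}"
  proof (rule compact_nest)
    show "compact (closure (f n))" for n
      using bounded_dyadic_cubes[OF f(1)] by (simp add: compact_closure)
    show "closure (f n) \<noteq> {}" for n using dyadic_cubes_nonempty[OF f(1)] by simp
    show "m \<le> n \<Longrightarrow> closure (f n) \<subseteq> closure (f m)" for m n :: nat
      using order_trans[OF step closure_subset] by (rule lift_Suc_antimono_le)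
  qed
  then obtain x where x: "\<And>n. x \<in> closure (f n)" by auto
  have xf: "x \<in> f n" for n using step x by (rule subsetD)
  have "x \<in> G n" for n using f(4) xf by (rule subsetD)
  then have "x \<in> (\<Inter>n. G n) \<inter> R" using xf[of 0] f(3) by simp
  then obtain Q where Q: "Q \<in> \<Q>" "x \<in> Q" using cover by blast
  obtain q where q: "Q = dyadic_cube_at q x" using Q QQ by (meson dyadic_cube_at_of_mem subsetD)
  have "\<exists>l. f n = dyadic_cube_at l x" for n
    using dyadic_cube_at_of_mem[OF f(1) xf] by metis
  then obtain l where l: "\<And>n. f n = dyadic_cube_at (l n) x" by metis
  have "l n < l (Suc n)" for n
  proof (rule ccontr)
    assume "\<not> l n < l (Suc n)"
    then have "f n \<subseteq> f (Suc n)" unfolding l by (intro dyadic_cube_at_antimono) simp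
    then have "closure (f n) \<subseteq> interior (f n)"
      using f(5)[of n] closure_mono[of "f n" "f (Suc n)"] by simp
    then have "closure (f n) = f n" "interior (f n) = f n"
      using closure_subset[of "f n"] interior_subset[of "f n"] by simp_all
    \<comment> \<open>Equal consecutive cubes would be both open and closed.\<close>
    then have "open (f n) \<and> closed (f n)"
      using open_interior[of "f n"] closed_closure[of "f n"] by simp
    then have "f n = UNIV"
      using dyadic_cubes_nonempty[OF f(1)[of n]] clopen[of "f n"] by simp
    then show False
      using bounded_dyadic_cubes[OF f(1)[of n]] not_bounded_UNIV by simp
  qed
  then have "strict_mono l" by (simp add: strict_mono_Suc_iff)
  then have "q \<le> l q" by (rule strict_mono_imp_increasing)
  then have "f q \<subseteq> Q" unfolding l q by (rule dyadic_cube_at_antimono)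
  then show False using f(2)[of q] Q(1) by (simp add: undercovered_def)
qed

text \<open>For \<open>Q \<subseteq> R\<close> the relative weight \<open>(|Q| / |R|) powr t\<close> increases when \<open>t\<close> decreases.\<close>

lemma cover_cost_exponent_mono:
  fixes R :: "(real ^ 'n::finite) set"
  assumes big: "\<And>\<Q>. \<Q> \<subseteq> dyadic_cubes \<Longrightarrow> A \<inter> R \<subseteq> \<Union>\<Q> \<Longrightarrow>
        ennreal (diameter R powr u) \<le> cover_cost u \<Q>"
    and t: "0 < t" "t \<le> u"
    and R: "R \<in> dyadic_cubes" and QQ: "\<Q> \<subseteq> dyadic_cubes" and cover: "A \<inter> R \<subseteq> \<Union>\<Q>"
  shows "ennreal (diameter R powr t) \<le> cover_cost t \<Q>"
proof (cases "\<exists>Q\<in>\<Q>. R \<subseteq> Q")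
  case True
  then show ?thesis using cover_cost_ge_of_superset[OF R QQ] t by blast
next
  case False
  let ?Q = "{Q \<in> \<Q>. Q \<subseteq> R}"
  have "A \<inter> R \<subseteq> \<Union>?Q"
  proof
    fix x assume x: "x \<in> A \<inter> R"
    then obtain Q where Q: "Q \<in> \<Q>" "x \<in> Q" using cover by blast
    then have "Q \<in> dyadic_cubes" "Q \<inter> R \<noteq> {}" "\<not> R \<subseteq> Q" using x QQ False by auto
    then have "Q \<subseteq> R" using dyadic_cubes_nested[of Q R] R by simp
    then show "x \<in> \<Union>?Q" using Q by blast
  qed
  then have "ennreal (diameter R powr u) \<le> cover_cost u ?Q"
    using QQ by (intro big) auto
  then have "ennreal (diameter R powr (t - u)) * ennreal (diameter R powr u)
      \<le> ennreal (diameter R powr (t - u)) * cover_cost u ?Q"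
    by (rule mult_left_mono) simp
  also have "\<dots> = (\<integral>\<^sup>+Q. ennreal (diameter R powr (t - u)) * ennreal (diameter Q powr u) \<partial>count_space ?Q)"
    unfolding cover_cost_def by (rule nn_integral_cmult[symmetric]) simp
  also have "\<dots> \<le> cover_cost t ?Q"
    unfolding cover_cost_def
  proof (rule nn_integral_mono)
    fix Q assume "Q \<in> space (count_space ?Q)"
    then have Q: "Q \<in> dyadic_cubes" "Q \<subseteq> R" using QQ by auto
    have "diameter R powr (t - u) * diameter Q powr u \<le> diameter Q powr (t - u) * diameter Q powr u"
      using diameter_dyadic_cubes_pos[OF Q(1)] diameter_dyadic_cubes_mono[OF Q(2) R] t
      by (intro mult_right_mono powr_mono2') auto
    also have "\<dots> = diameter Q powr t" by (simp add: powr_add[symmetric])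
    finally show "ennreal (diameter R powr (t - u)) * ennreal (diameter Q powr u) \<le> ennreal (diameter Q powr t)"
      by (simp add: ennreal_mult[symmetric] ennreal_leI)
  qed
  also have "\<dots> \<le> cover_cost t \<Q>" by (rule cover_cost_mono) auto
  finally show ?thesis
    by (simp add: ennreal_mult[symmetric] powr_add[symmetric])
qed

lemma cover_cost_le_infsum:
  fixes Q :: "nat \<Rightarrow> (real ^ 'n::finite) set"
  shows "cover_cost t (Q ` J) \<le> (\<Sum>\<^sub>\<infinity>j\<in>J. ennreal (diameter (Q j) powr t))"
proof -
  let ?w = "\<lambda>Q :: (real ^ 'n) set. ennreal (diameter Q powr t)"
  obtain K where K: "K \<subseteq> J" "inj_on Q K" "Q ` K = Q ` J"
    using subset_image_inj[of "Q ` J" Q J] by auto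
  have "cover_cost t (Q ` J) = (\<integral>\<^sup>+j. ?w (Q j) \<partial>count_space K)"
    unfolding cover_cost_def
    using nn_integral_bij_count_space[of Q K "Q ` J" ?w] K by (simp add: bij_betw_def)
  also have "\<dots> = (\<integral>\<^sup>+j. ?w (Q j) * indicator K j \<partial>count_space UNIV)"
    by (simp add: nn_integral_count_space_indicator)
  also have "\<dots> = (\<Sum>j. ?w (Q j) * indicator K j)"
    by (rule nn_integral_count_space_nat)
  also have "\<dots> \<le> (\<Sum>\<^sub>\<infinity>j\<in>J. ?w (Q j))"
  proof (rule suminf_le_const)
    fix n
    have "(\<Sum>j<n. ?w (Q j) * indicator K j) = (\<Sum>j\<in>K \<inter> {..<n}. ?w (Q j))"
      by (intro sum.mono_neutral_cong_right) (auto simp: indicator_def)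
    also have "\<dots> = (\<Sum>\<^sub>\<infinity>j\<in>K \<inter> {..<n}. ?w (Q j))" by simp
    also have "\<dots> \<le> (\<Sum>\<^sub>\<infinity>j\<in>J. ?w (Q j))"
      using K(1) by (intro infsum_mono_neutral nonneg_summable_on_complete) auto
    finally show "(\<Sum>j<n. ?w (Q j) * indicator K j) \<le> (\<Sum>\<^sub>\<infinity>j\<in>J. ?w (Q j))" .
  qed auto
  finally show ?thesis .
qed

lemma dyadic_net_content_eqI:
  fixes R :: "(real ^ 'n::finite) set"
  assumes big: "\<And>\<Q>. \<Q> \<subseteq> dyadic_cubes \<Longrightarrow> A \<inter> R \<subseteq> \<Union>\<Q> \<Longrightarrow>
        ennreal (diameter R powr t) \<le> cover_cost t \<Q>"
    and R: "R \<in> dyadic_cubes"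
  shows "dyadic_net_content t (A \<inter> R) = dyadic_net_content t R"
proof (rule antisym)
  show "dyadic_net_content t (A \<inter> R) \<le> dyadic_net_content t R"
    unfolding dyadic_net_content_def by (rule Inf_superset_mono) blast
  have "dyadic_net_content t R \<le> ennreal (diameter R powr t)"
    unfolding dyadic_net_content_def
    by (rule Inf_lower, rule CollectI, rule exI[of _ "{0}"], rule exI[of _ "\<lambda>_. R"]) (use R in simp)
  also have "\<dots> \<le> dyadic_net_content t (A \<inter> R)"
    unfolding dyadic_net_content_def
  proof (rule Inf_greatest, safe)
    fix J :: "nat set" and Q
    assume J: "\<forall>j\<in>J. Q j \<in> dyadic_cubes" "A \<inter> R \<subseteq> (\<Union>j\<in>J. Q j)"
    have "ennreal (diameter R powr t) \<le> cover_cost t (Q ` J)"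
      using J by (intro big) auto
    also have "\<dots> \<le> (\<Sum>\<^sub>\<infinity>j\<in>J. ennreal (diameter (Q j) powr t))" by (rule cover_cost_le_infsum)
    finally show "ennreal (diameter R powr t) \<le> (\<Sum>\<^sub>\<infinity>j\<in>J. ennreal (diameter (Q j) powr t))" .
  qed
  finally show "dyadic_net_content t R \<le> dyadic_net_content t (A \<inter> R)" .
qed

section \<open>Energy bounds cost from below\<close>

text \<open>The inequality between the arithmetic and the geometric mean turns a quadratic bound into
  linear ones. As \<open>\<beta>\<close> is free, these can be summed or integrated first and optimised afterwards.\<close>

lemma ennreal_am_gm:
  fixes a e :: ennreal
  assumes sq: "a * a \<le> ennreal w * e" and w: "0 \<le> w" and \<beta>: "0 < \<beta>"
  shows "a \<le> ennreal \<beta> * e + ennreal (w / (4 * \<beta>))"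
proof (cases "e = \<top>")
  case True
  then show ?thesis using \<beta> by (simp add: ennreal_mult_top)
next
  case False
  then obtain e' where e: "e = ennreal e'" "0 \<le> e'" by (cases e) auto
  have "a * a < \<top>"
    using sq by (rule le_less_trans) (simp add: e ennreal_mult_less_top)
  then obtain a' where a: "a = ennreal a'" "0 \<le> a'" by (cases a) (auto simp: ennreal_mult_less_top)
  have "a' ^ 2 \<le> w * e'"
    using sq a e w by (simp add: ennreal_mult[symmetric] power2_eq_square)
  also have "w * e' \<le> (\<beta> * e' + w / (4 * \<beta>)) ^ 2"
  proof -
    have "(\<beta> * e' + w / (4 * \<beta>)) ^ 2 - w * e' = (\<beta> * e' - w / (4 * \<beta>)) ^ 2"
      using \<beta> by (simp add: power2_eq_square field_simps)
    then show ?thesis using zero_le_power2[of "\<beta> * e' - w / (4 * \<beta>)"] by linarith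
  qed
  finally have "a' \<le> \<beta> * e' + w / (4 * \<beta>)"
    by (rule power2_le_imp_le) (use \<beta> e w in auto)
  then show ?thesis
    using a e w \<beta> by (simp add: ennreal_mult[symmetric] ennreal_plus[symmetric] ennreal_leI del: ennreal_plus)
qed

definition weighted_energy :: "real \<Rightarrow> (real ^ 'n::finite \<Rightarrow> ennreal) \<Rightarrow> ennreal" where
  "weighted_energy t f = (\<integral>\<^sup>+p. riesz_kernel t (fst p) (snd p) * (f (fst p) * f (snd p))
      \<partial>(uniform_torus \<Otimes>\<^sub>M uniform_torus))"

lemma weighted_energy_iterated:
  assumes [measurable]: "f \<in> borel_measurable borel"
  shows "weighted_energy t f = (\<integral>\<^sup>+x. (\<integral>\<^sup>+y. riesz_kernel t x y * (f x * f y) \<partial>uniform_torus) \<partial>uniform_torus)"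
  unfolding weighted_energy_def by (subst uniform_torus.nn_integral_fst[symmetric]) auto

lemma weighted_energy_indicator:
  assumes [measurable]: "U \<in> sets borel"
  shows "weighted_energy t (indicator U) = torus_energy t U"
proof -
  have "(\<integral>\<^sup>+y. riesz_kernel t x y * (indicator U x * indicator U y) \<partial>uniform_torus)
      = (\<integral>\<^sup>+y. riesz_kernel t x y * indicator U y \<partial>uniform_torus) * indicator U x" for x
    by (subst nn_integral_multc[symmetric], measurable) (simp add: mult_ac)
  then show ?thesis
    by (simp add: weighted_energy_iterated torus_energy_eq_uniform_torus)
qed

lemma riesz_kernel_ge:
  assumes t: "0 < t" and bdd: "bounded Q" and xy: "x \<in> Q" "y \<in> Q"
  shows "inverse (ennreal (diameter Q powr t)) \<le> riesz_kernel t x y"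
proof -
  have "torus_dist x y \<le> diameter Q"
    using torus_dist_le_dist[of x y] diameter_bounded_bound[OF bdd xy] by (rule order_trans)
  then have le: "torus_dist x y powr t \<le> diameter Q powr t"
    using t torus_dist_nonneg[of x y] by (intro powr_mono2) auto
  show ?thesis
  proof (cases "torus_dist x y = 0")
    case False
    then have pos: "0 < torus_dist x y powr t" by simp
    then have "0 < diameter Q powr t" using le by (rule less_le_trans)
    then show ?thesis
      using le_imp_inverse_le[OF le pos] pos
      unfolding riesz_kernel_def by (simp add: inverse_ennreal ennreal_leI del: powr_gt_zero)
  qed (simp add: riesz_kernel_def)
qed

text \<open>On \<open>Q \<times> Q\<close> the kernel is at least \<open>1 / |Q|\<^sup>t\<close>.\<close>

lemma mass_squared_le_energy:
  fixes f :: "real ^ 'n::finite \<Rightarrow> ennreal"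
  assumes t: "0 < t" and [measurable]: "f \<in> borel_measurable borel" and Q: "Q \<in> dyadic_cubes"
  shows "(\<integral>\<^sup>+x. f x * indicator Q x \<partial>uniform_torus) * (\<integral>\<^sup>+x. f x * indicator Q x \<partial>uniform_torus)
    \<le> ennreal (diameter Q powr t) * weighted_energy t (\<lambda>x. f x * indicator Q x)"
proof -
  let ?w = "ennreal (diameter Q powr t)" and ?f = "\<lambda>x. f x * indicator Q x"
  have [measurable]: "Q \<in> sets borel" using Q by (rule dyadic_cubes_borel)
  have w: "?w * inverse ?w = 1"
    using diameter_dyadic_cubes_pos[OF Q] by (simp add: inverse_ennreal ennreal_mult[symmetric])
  have "(\<integral>\<^sup>+x. ?f x \<partial>uniform_torus) * (\<integral>\<^sup>+x. ?f x \<partial>uniform_torus)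
      = (\<integral>\<^sup>+x. (\<integral>\<^sup>+y. ?f x * ?f y \<partial>uniform_torus) \<partial>uniform_torus)"
    by (simp add: nn_integral_cmult nn_integral_multc)
  also have "\<dots> \<le> (\<integral>\<^sup>+x. (\<integral>\<^sup>+y. ?w * (riesz_kernel t x y * (?f x * ?f y)) \<partial>uniform_torus) \<partial>uniform_torus)"
  proof (intro nn_integral_mono)
    fix x y
    show "?f x * ?f y \<le> ?w * (riesz_kernel t x y * (?f x * ?f y))"
    proof (cases "x \<in> Q \<and> y \<in> Q")
      case True
      then have "1 \<le> ?w * riesz_kernel t x y"
        using mult_left_mono[OF riesz_kernel_ge[OF t bounded_dyadic_cubes[OF Q]], of x y ?w] w by simp
      then have "1 * (?f x * ?f y) \<le> (?w * riesz_kernel t x y) * (?f x * ?f y)"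
        by (rule mult_right_mono) simp
      then show ?thesis by (simp add: mult.assoc)
    qed auto
  qed
  also have "\<dots> = ?w * weighted_energy t ?f"
    by (simp add: weighted_energy_iterated nn_integral_cmult)
  finally show ?thesis .
qed

text \<open>The maximal cubes \<open>Q\<close> of the cover are disjoint, hence so are the squares \<open>Q \<times> Q\<close>, and the
  energies of the pieces add up to at most the total energy. The inequality of
  \<open>ennreal_am_gm\<close> is applied on each piece and summed.\<close>

lemma mass_le_energy_plus_cost:
  fixes f :: "real ^ 'n::finite \<Rightarrow> ennreal"
  assumes t: "0 < t" and f [measurable]: "f \<in> borel_measurable borel"
    and QQ: "\<Q> \<subseteq> dyadic_cubes" and supp: "\<And>x. f x \<noteq> 0 \<Longrightarrow> x \<in> \<Union>\<Q>" and \<beta>: "0 < \<beta>"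
  shows "(\<integral>\<^sup>+x. f x \<partial>uniform_torus) \<le> ennreal \<beta> * weighted_energy t f + ennreal (1 / (4 * \<beta>)) * cover_cost t \<Q>"
proof -
  let ?M = "maximal_cubes \<Q>" and ?\<mu> = "uniform_torus :: (real ^ 'n) measure"
  let ?w = "\<lambda>Q :: (real ^ 'n) set. ennreal (diameter Q powr t)"
  let ?E = "density (?\<mu> \<Otimes>\<^sub>M ?\<mu>) (\<lambda>p. riesz_kernel t (fst p) (snd p) * (f (fst p) * f (snd p)))"
  have M: "?M \<subseteq> dyadic_cubes" using maximal_cubes_subset QQ by blast
  have cM: "countable ?M" using M countable_dyadic_cubes by (rule countable_subset)
  have bM: "Q \<in> sets borel" if "Q \<in> ?M" for Q using that M dyadic_cubes_borel by blast
  have S [measurable]: "{x. f x \<noteq> 0} \<in> sets borel" by measurable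
  have "(\<integral>\<^sup>+x. f x \<partial>?\<mu>) = emeasure (density ?\<mu> f) {x. f x \<noteq> 0}"
    by (subst emeasure_density) (auto intro!: nn_integral_cong simp: indicator_def)
  also have "\<dots> \<le> (\<integral>\<^sup>+Q. emeasure (density ?\<mu> f) Q \<partial>count_space ?M)"
    using supp cM bM by (intro emeasure_le_count_space_cover) (auto simp: Union_maximal_cubes[OF QQ])
  also have "\<dots> \<le> (\<integral>\<^sup>+Q. ennreal \<beta> * emeasure ?E (Q \<times> Q) + ennreal (1 / (4 * \<beta>)) * ?w Q \<partial>count_space ?M)"
  proof (rule nn_integral_mono)
    fix Q assume "Q \<in> space (count_space ?M)"
    then have Q: "Q \<in> ?M" by simp
    have Qc: "Q \<in> dyadic_cubes" using Q M by blast
    have [measurable]: "Q \<in> sets borel" using Q by (rule bM)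
    have 1: "emeasure (density ?\<mu> f) Q = (\<integral>\<^sup>+x. f x * indicator Q x \<partial>?\<mu>)"
      by (subst emeasure_density) auto
    have 2: "emeasure ?E (Q \<times> Q) = weighted_energy t (\<lambda>x. f x * indicator Q x)"
      unfolding weighted_energy_def
      by (subst emeasure_density) (auto intro!: nn_integral_cong simp: indicator_def)
    have "emeasure (density ?\<mu> f) Q \<le> ennreal \<beta> * emeasure ?E (Q \<times> Q) + ennreal (diameter Q powr t / (4 * \<beta>))"
      unfolding 1 2 by (intro ennreal_am_gm mass_squared_le_energy t f Qc \<beta>) simp
    also have "ennreal (diameter Q powr t / (4 * \<beta>)) = ennreal (1 / (4 * \<beta>)) * ?w Q"
      using \<beta> by (simp add: ennreal_mult[symmetric])
    finally show "emeasure (density ?\<mu> f) Q \<le> ennreal \<beta> * emeasure ?E (Q \<times> Q) + ennreal (1 / (4 * \<beta>)) * ?w Q" .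
  qed
  also have "\<dots> = ennreal \<beta> * (\<integral>\<^sup>+Q. emeasure ?E (Q \<times> Q) \<partial>count_space ?M) + ennreal (1 / (4 * \<beta>)) * cover_cost t ?M"
    by (simp add: nn_integral_add nn_integral_cmult cover_cost_def)
  also have "\<dots> \<le> ennreal \<beta> * weighted_energy t f + ennreal (1 / (4 * \<beta>)) * cover_cost t \<Q>"
  proof (intro add_mono mult_left_mono)
    have "(\<integral>\<^sup>+Q. emeasure ?E (Q \<times> Q) \<partial>count_space ?M) = emeasure ?E (\<Union>Q\<in>?M. Q \<times> Q)"
    proof (rule emeasure_UN_countable[symmetric])
      show "Q \<times> Q \<in> sets ?E" if "Q \<in> ?M" for Q using bM[OF that] by simp
      show "disjoint_family_on (\<lambda>Q. Q \<times> Q) ?M"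
        using disjoint_maximal_cubes[OF QQ] by (auto simp: disjoint_family_on_def disjoint_def)
    qed (rule cM)
    also have "\<dots> \<le> emeasure ?E (space ?E)" by (rule emeasure_space)
    also have "\<dots> = weighted_energy t f"
    proof -
      have "UNIV \<in> sets (?\<mu> \<Otimes>\<^sub>M ?\<mu>)"
        using sets.top[of "?\<mu> \<Otimes>\<^sub>M ?\<mu>"] by (simp add: space_pair_measure)
      then show ?thesis
        unfolding weighted_energy_def
        by (subst emeasure_density) (auto intro!: nn_integral_cong simp: space_pair_measure)
    qed
    finally show "(\<integral>\<^sup>+Q. emeasure ?E (Q \<times> Q) \<partial>count_space ?M) \<le> weighted_energy t f" .
    show "cover_cost t ?M \<le> cover_cost t \<Q>"
      using maximal_cubes_subset by (rule cover_cost_mono)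
  qed auto
  finally show ?thesis .
qed

text \<open>The bound cost \<open>\<ge>\<close> mass\<open>\<^sup>2\<close>/energy of the mass distribution principle.\<close>

lemma cover_cost_ge_of_energy:
  fixes f :: "real ^ 'n::finite \<Rightarrow> ennreal"
  assumes t: "0 < t" and f [measurable]: "f \<in> borel_measurable borel"
    and QQ: "\<Q> \<subseteq> dyadic_cubes" and supp: "\<And>x. f x \<noteq> 0 \<Longrightarrow> x \<in> \<Union>\<Q>"
    and m: "m = (\<integral>\<^sup>+x. f x \<partial>uniform_torus)" "0 < m" "m < \<top>"
    and c: "0 < c" "ennreal c * weighted_energy t f \<le> m * m"
  shows "ennreal c \<le> cover_cost t \<Q>"
proof (cases "cover_cost t \<Q> = \<top>")
  case False
  then obtain W where W: "cover_cost t \<Q> = ennreal W" "0 \<le> W" by (cases "cover_cost t \<Q>") auto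
  obtain m' where m': "m = ennreal m'" "0 < m'" using m(2,3) by (cases m) auto
  have "ennreal c * weighted_energy t f < \<top>"
    using c(2) by (rule le_less_trans) (simp add: m' ennreal_mult_less_top)
  then have "weighted_energy t f < \<top>"
    using c(1) by (auto simp: ennreal_mult_less_top)
  then obtain e where e: "weighted_energy t f = ennreal e" "0 \<le> e" by (cases "weighted_energy t f") auto
  have ce: "c * e \<le> m' * m'"
    using c m' e by (simp add: ennreal_mult[symmetric])
  define \<beta> where "\<beta> = c / (2 * m')"
  have \<beta>: "0 < \<beta>" using c(1) m' by (simp add: \<beta>_def)
  have "ennreal m' \<le> ennreal \<beta> * ennreal e + ennreal (1 / (4 * \<beta>)) * ennreal W"
    using mass_le_energy_plus_cost[OF t f QQ supp \<beta>] m m' e W by simp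
  then have "m' \<le> \<beta> * e + 1 / (4 * \<beta>) * W"
    using \<beta> e W by (simp add: ennreal_mult[symmetric] ennreal_plus[symmetric] del: ennreal_plus)
  moreover have "\<beta> * e \<le> m' / 2"
    using ce m' by (simp add: \<beta>_def field_simps)
  moreover have "1 / (4 * \<beta>) * W = m' * W / (2 * c)"
    using m' c by (simp add: \<beta>_def)
  ultimately have "m' / 2 \<le> m' * W / (2 * c)" by linarith
  then have "c \<le> W" using m' c(1) by (simp add: field_simps)
  then show ?thesis unfolding W by (rule ennreal_leI)
qed simp

section \<open>Two probabilistic lemmas\<close>

text \<open>A Paley--Zygmund inequality. Let \<open>\<mu> = \<E> m\<close> for a mass \<open>m\<close> and an energy \<open>e\<close> with \<open>m\<^sup>2 \<le> w e\<close>. If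
  \<open>w \<E> e \<le> D \<mu>\<^sup>2\<close>, then \<open>m\<^sup>2 \<ge> w e / (4 D)\<close> with probability at least \<open>1 / (2 D)\<close>. On the event,
  \<open>m \<le> \<beta> e + D \<mu>\<close>; off it \<open>m\<^sup>2 \<le> w e / (4 D)\<close> and so \<open>m \<le> \<beta> e + \<mu> / 4\<close>. The choice
  of \<open>\<beta>\<close> makes the expectation of \<open>\<beta> e\<close> at most \<open>\<mu> / 4\<close>.\<close>

lemma (in prob_space) second_moment_event:
  fixes m e :: "'a \<Rightarrow> ennreal"
  assumes [measurable]: "m \<in> borel_measurable M" "e \<in> borel_measurable M"
    and pos: "0 < w" "0 < \<mu>" "0 < D"
    and sq: "\<And>\<omega>. m \<omega> * m \<omega> \<le> ennreal w * e \<omega>"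
    and m: "(\<integral>\<^sup>+\<omega>. m \<omega> \<partial>M) = ennreal \<mu>"
    and e: "ennreal w * (\<integral>\<^sup>+\<omega>. e \<omega> \<partial>M) \<le> ennreal (D * \<mu>\<^sup>2)"
  shows "1 / (2 * D) \<le> prob {\<omega> \<in> space M. 0 < m \<omega> \<and> ennreal (w / (4 * D)) * e \<omega> \<le> m \<omega> * m \<omega>}"
proof -
  let ?A = "{\<omega> \<in> space M. 0 < m \<omega> \<and> ennreal (w / (4 * D)) * e \<omega> \<le> m \<omega> * m \<omega>}"
  have A [measurable]: "?A \<in> events" by measurable
  define \<beta> where "\<beta> = w / (4 * D * \<mu>)"
  have \<beta>: "0 < \<beta>" using pos by (simp add: \<beta>_def)
  have le: "m \<omega> \<le> ennreal \<beta> * e \<omega> + ennreal (D * \<mu>) * indicator ?A \<omega> + ennreal (\<mu> / 4)" if \<omega>: "\<omega> \<in> space M" for \<omega>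
  proof (cases "\<omega> \<in> ?A")
    case True
    have "m \<omega> \<le> ennreal \<beta> * e \<omega> + ennreal (w / (4 * \<beta>))"
      using pos by (intro ennreal_am_gm sq \<beta>) auto
    also have "w / (4 * \<beta>) = D * \<mu>" using pos by (simp add: \<beta>_def)
    also have "ennreal \<beta> * e \<omega> + ennreal (D * \<mu>) = ennreal \<beta> * e \<omega> + ennreal (D * \<mu>) * indicator ?A \<omega>"
      unfolding indicator_simps(1)[OF True] by (simp only: mult_1_right)
    finally show ?thesis by (rule order_trans) simp
  next
    case False
    have "m \<omega> * m \<omega> \<le> ennreal (w / (4 * D)) * e \<omega>"
      using False \<omega> by (cases "m \<omega> = 0") (auto simp: not_le less_imp_le zero_less_iff_neq_zero)
    then have "m \<omega> \<le> ennreal \<beta> * e \<omega> + ennreal (w / (4 * D) / (4 * \<beta>))"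
      using pos by (intro ennreal_am_gm \<beta>) auto
    also have "w / (4 * D) / (4 * \<beta>) = \<mu> / 4" using pos by (simp add: \<beta>_def)
    also have "ennreal \<beta> * e \<omega> + ennreal (\<mu> / 4) \<le> ennreal \<beta> * e \<omega> + ennreal (D * \<mu>) * indicator ?A \<omega> + ennreal (\<mu> / 4)"
      by (intro add_right_mono) simp
    finally show ?thesis .
  qed
  have "ennreal \<mu> \<le> (\<integral>\<^sup>+\<omega>. ennreal \<beta> * e \<omega> + ennreal (D * \<mu>) * indicator ?A \<omega> + ennreal (\<mu> / 4) \<partial>M)"
    unfolding m[symmetric] using le by (rule nn_integral_mono)
  also have "\<dots> = ennreal \<beta> * (\<integral>\<^sup>+\<omega>. e \<omega> \<partial>M) + ennreal (D * \<mu>) * emeasure M ?A + ennreal (\<mu> / 4)"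
    by (simp add: nn_integral_add nn_integral_cmult emeasure_space_1)
  also have "ennreal \<beta> * (\<integral>\<^sup>+\<omega>. e \<omega> \<partial>M) = ennreal (1 / (4 * D * \<mu>)) * (ennreal w * (\<integral>\<^sup>+\<omega>. e \<omega> \<partial>M))"
    using pos by (simp add: \<beta>_def mult.assoc[symmetric] ennreal_mult[symmetric])
  also have "\<dots> \<le> ennreal (1 / (4 * D * \<mu>)) * ennreal (D * \<mu>\<^sup>2)"
    using e by (rule mult_left_mono) simp
  also have "\<dots> = ennreal (\<mu> / 4)"
    using pos by (simp add: ennreal_mult[symmetric] power2_eq_square)
  finally have "ennreal \<mu> \<le> ennreal (\<mu> / 4) + ennreal (D * \<mu>) * ennreal (prob ?A) + ennreal (\<mu> / 4)"
    by (simp add: emeasure_eq_measure add_right_mono)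
  then have "\<mu> \<le> \<mu> / 4 + D * \<mu> * prob ?A + \<mu> / 4"
    using pos by (simp add: ennreal_mult[symmetric] ennreal_plus[symmetric] del: ennreal_plus)
  then have "\<mu> * 1 \<le> \<mu> * (2 * D * prob ?A)" by (simp add: algebra_simps)
  then have "1 \<le> 2 * D * prob ?A" using pos by (simp only: mult_le_cancel_left_pos)
  then show ?thesis using pos by (simp add: field_simps)
qed

text \<open>By the Borel zero-one law the upper limit of the events has probability \<open>0\<close> or \<open>1\<close>, and it
  has probability at least \<open>p\<close>.\<close>

lemma (in prob_space) AE_ex_indep_events:
  fixes A :: "nat \<Rightarrow> 'a set"
  assumes indep: "indep_events A UNIV" and p: "0 < p" "\<And>k. p \<le> prob (A k)"
  shows "AE \<omega> in M. \<exists>k. \<omega> \<in> A k"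
proof -
  have ev [measurable]: "A k \<in> events" for k using indep by (auto simp: indep_events_def)
  let ?T = "\<lambda>n. \<Union>m\<in>{n..}. A m"
  have "(\<lambda>n. prob (?T n)) \<longlonglongrightarrow> prob (\<Inter>n. ?T n)"
    by (rule finite_Lim_measure_decseq) (auto simp: decseq_def intro: order_trans)
  moreover have "p \<le> prob (?T n)" for n
    using p(2)[of n] finite_measure_mono[of "A n" "?T n"] by (force intro: order_trans)
  ultimately have "p \<le> prob (\<Inter>n. ?T n)"
    by (intro LIMSEQ_le_const) auto
  then have "prob (\<Inter>n. ?T n) = 1"
    using borel_0_1_law[OF indep] p(1) by auto
  then have "AE \<omega> in M. \<omega> \<in> (\<Inter>n. ?T n)"
    by (subst (asm) prob_eq_1) auto
  then show ?thesis by eventually_elim auto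
qed

section \<open>Superpositions of random translates\<close>

lemma mem_torus_translate_iff:
  assumes "U \<subseteq> torus" "x \<in> torus"
  shows "x \<in> torus_translate v U \<longleftrightarrow> torus_proj (x - v) \<in> U"
proof
  assume "x \<in> torus_translate v U"
  then obtain u where u: "u \<in> U" "x = torus_proj (u + v)" by (auto simp: torus_translate_def)
  then have "torus_proj (x - v) = torus_proj u"
    using torus_proj_lattice[of "u + v"] by (intro torus_proj_cong) (simp add: algebra_simps)
  then show "torus_proj (x - v) \<in> U"
    using u assms(1) by (simp add: torus_proj_ident subset_iff)
next
  assume *: "torus_proj (x - v) \<in> U"
  have "torus_proj (torus_proj (x - v) + v) = torus_proj x"
    using torus_proj_lattice[of "x - v"] by (intro torus_proj_cong) (simp add: algebra_simps)
  then have "x = torus_proj (torus_proj (x - v) + v)"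
    using assms(2) by (simp add: torus_proj_ident)
  then show "x \<in> torus_translate v U"
    using * by (auto simp: torus_translate_def)
qed

lemma openin_torus_translate:
  assumes "openin torus_topology U" shows "openin torus_topology (torus_translate v U)"
proof -
  have U: "U \<subseteq> torus" "open (torus_proj -` U)"
    using assms by (auto simp: openin_torus_topology_iff)
  have sub: "torus_translate v U \<subseteq> torus"
    by (auto simp: torus_translate_def torus_proj_in_torus)
  have "torus_proj (torus_proj x - v) = torus_proj (x - v)" for x
    using torus_proj_lattice[of x] by (intro torus_proj_cong) (simp add: algebra_simps)
  then have "torus_proj -` torus_translate v U = (\<lambda>x. x - v) -` (torus_proj -` U)"
    using mem_torus_translate_iff[OF U(1) torus_proj_in_torus] by auto
  also have "open \<dots>"
    by (intro open_vimage[OF U(2)] continuous_intros)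
  finally show ?thesis
    using sub by (simp add: openin_torus_topology_iff)
qed

text \<open>The density \<open>\<Sum>\<^sub>i a\<^sub>i 1\<^bsub>V\<^sub>i\<^esub>\<close> at \<open>x\<close>, with membership in the translate \<open>V\<^sub>i\<close> expressed through \<open>U\<^sub>i\<close>
  as in \<open>mem_torus_translate_iff\<close>.\<close>

definition superposition ::
    "(nat \<Rightarrow> ennreal) \<Rightarrow> (nat \<Rightarrow> (real ^ 'n::finite) set) \<Rightarrow> nat set \<Rightarrow> (nat \<Rightarrow> real ^ 'n) \<Rightarrow> real ^ 'n \<Rightarrow> ennreal" where
  "superposition a U I v x = (\<Sum>i\<in>I. a i * indicator (U i) (torus_proj (x - v i)))"

lemma borel_measurable_superposition:
  fixes U :: "nat \<Rightarrow> (real ^ 'n::finite) set"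
  assumes U: "\<And>i. U i \<in> sets borel"
    and V: "\<And>i. i \<in> I \<Longrightarrow> V i \<in> borel_measurable N" and X [measurable]: "X \<in> borel_measurable N"
  shows "(\<lambda>w. superposition a U I (\<lambda>i. V i w) (X w)) \<in> borel_measurable N"
  unfolding superposition_def
proof (intro borel_measurable_sum)
  fix i assume "i \<in> I"
  then have [measurable]: "V i \<in> borel_measurable N" by (rule V)
  have [measurable]: "U i \<in> sets borel" by (rule U)
  show "(\<lambda>w. a i * indicator (U i) (torus_proj (X w - V i w))) \<in> borel_measurable N"
    by measurable
qed

lemma superposition_cong:
  "(\<And>i. i \<in> I \<Longrightarrow> v i = v' i) \<Longrightarrow> superposition a U I v = superposition a U I v'"
  by (auto simp: superposition_def fun_eq_iff intro!: sum.cong)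

text \<open>The random vectors take values in the Borel space \<open>real ^ 'n\<close> here, in accordance with
  \<open>uniform_torus\<close>.\<close>

locale random_translates = prob_space M
  for M :: "'a measure" +
  fixes U :: "nat \<Rightarrow> (real ^ 'n::finite) set" and v :: "nat \<Rightarrow> 'a \<Rightarrow> real ^ 'n"
  assumes borel_U [measurable]: "\<And>i. U i \<in> sets borel"
    and subset_U: "\<And>i. U i \<subseteq> torus"
    and indep: "indep_vars (\<lambda>_. borel) v UNIV"
    and uniform: "\<And>i. distr M borel (v i) = uniform_torus"
begin

lemma borel_v [measurable]: "v i \<in> borel_measurable M"
  using indep by (simp add: indep_vars_def)

lemma nn_integral_v:
  "g \<in> borel_measurable borel \<Longrightarrow> (\<integral>\<^sup>+\<omega>. g (v i \<omega>) \<partial>M) = (\<integral>\<^sup>+u. g u \<partial>uniform_torus)"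
  unfolding uniform[of i, symmetric] by (simp add: nn_integral_distr)

lemma nn_integral_indicator_translate:
  "(\<integral>\<^sup>+\<omega>. indicator (U i) (torus_proj (x - v i \<omega>)) \<partial>M) = emeasure uniform_torus (U i)"
proof -
  have "(\<integral>\<^sup>+\<omega>. indicator (U i) (torus_proj (x - v i \<omega>)) \<partial>M)
      = (\<integral>\<^sup>+u. indicator (U i) (torus_proj (x - u)) \<partial>uniform_torus)"
    by (rule nn_integral_v) measurable
  also have "\<dots> = (\<integral>\<^sup>+u. indicator (U i) u \<partial>uniform_torus)"
    by (rule nn_integral_uniform_torus_reflect) measurable
  finally show ?thesis by simp
qed

lemma borel_measurable_superposition_v [measurable]:
  assumes "X \<in> borel_measurable (M \<Otimes>\<^sub>M N)"
  shows "(\<lambda>p. superposition a U I (\<lambda>i. v i (fst p)) (X p)) \<in> borel_measurable (M \<Otimes>\<^sub>M N)"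
  by (rule borel_measurable_superposition) (use assms in measurable)

lemma expected_mass:
  assumes [measurable]: "B \<in> sets borel"
  shows "(\<integral>\<^sup>+\<omega>. (\<integral>\<^sup>+x. superposition a U I (\<lambda>i. v i \<omega>) x * indicator B x \<partial>uniform_torus) \<partial>M)
    = (\<Sum>i\<in>I. a i * emeasure uniform_torus (U i)) * emeasure uniform_torus B"
proof -
  interpret P: pair_sigma_finite M "uniform_torus :: (real ^ 'n) measure" ..
  have *: "(\<integral>\<^sup>+\<omega>. superposition a U I (\<lambda>i. v i \<omega>) x \<partial>M) = (\<Sum>i\<in>I. a i * emeasure uniform_torus (U i))" for x
    unfolding superposition_def
    by (simp add: nn_integral_sum nn_integral_cmult nn_integral_indicator_translate)
  have "(\<integral>\<^sup>+\<omega>. (\<integral>\<^sup>+x. superposition a U I (\<lambda>i. v i \<omega>) x * indicator B x \<partial>uniform_torus) \<partial>M)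
      = (\<integral>\<^sup>+x. (\<integral>\<^sup>+\<omega>. superposition a U I (\<lambda>i. v i \<omega>) x * indicator B x \<partial>M) \<partial>uniform_torus)"
    by (rule P.Fubini'[symmetric]) (simp add: case_prod_beta)
  also have "\<dots> = (\<integral>\<^sup>+x. (\<Sum>i\<in>I. a i * emeasure uniform_torus (U i)) * indicator B x \<partial>uniform_torus)"
  proof (rule nn_integral_cong)
    fix x
    have "(\<lambda>\<omega>. superposition a U I (\<lambda>i. v i \<omega>) x) \<in> borel_measurable M"
      by (rule borel_measurable_superposition) measurable
    then show "(\<integral>\<^sup>+\<omega>. superposition a U I (\<lambda>i. v i \<omega>) x * indicator B x \<partial>M)
        = (\<Sum>i\<in>I. a i * emeasure uniform_torus (U i)) * indicator B x"
      by (simp add: nn_integral_multc *)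
  qed
  finally show ?thesis by (simp add: nn_integral_cmult_indicator)
qed

text \<open>The probability that the random translate of \<open>U i\<close> contains both points.\<close>

definition autocorrelation :: "nat \<Rightarrow> real ^ 'n \<Rightarrow> real ^ 'n \<Rightarrow> ennreal" where
  "autocorrelation i x y = (\<integral>\<^sup>+u. indicator (U i) (torus_proj (x - u)) * indicator (U i) (torus_proj (y - u)) \<partial>uniform_torus)"

lemma borel_measurable_autocorrelation [measurable (raw)]:
  assumes [measurable]: "f \<in> borel_measurable N" "g \<in> borel_measurable N"
  shows "(\<lambda>p. autocorrelation i (f p) (g p)) \<in> borel_measurable N"
  unfolding autocorrelation_def by measurable

text \<open>The product of the volumes is added on the diagonal too, so that in
  \<open>expected_product_superposition\<close> these products sum to a full square.\<close>

lemma expected_product_indicators: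
  "(\<integral>\<^sup>+\<omega>. indicator (U i) (torus_proj (x - v i \<omega>)) * indicator (U j) (torus_proj (y - v j \<omega>)) \<partial>M)
    \<le> emeasure uniform_torus (U i) * emeasure uniform_torus (U j) + (if i = j then autocorrelation i x y else 0)"
proof (cases "i = j")
  case True
  have "(\<integral>\<^sup>+\<omega>. indicator (U i) (torus_proj (x - v i \<omega>)) * indicator (U i) (torus_proj (y - v i \<omega>)) \<partial>M)
      = autocorrelation i x y"
    unfolding autocorrelation_def
    by (rule nn_integral_v[where g = "\<lambda>u. indicator (U i) (torus_proj (x - u)) * indicator (U i) (torus_proj (y - u))"]) measurable
  then show ?thesis using True by simp
next
  case False
  define Y :: "nat \<Rightarrow> real ^ 'n \<Rightarrow> ennreal" where
    "Y = (\<lambda>k u. if k = i then indicator (U i) (torus_proj (x - u)) else indicator (U j) (torus_proj (y - u)))"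
  have Y: "Y k \<in> borel_measurable borel" for k
    unfolding Y_def by (cases "k = i") simp_all
  have "indep_vars (\<lambda>_. borel) (\<lambda>k \<omega>. Y k (v k \<omega>)) {i, j}"
    by (rule indep_vars_compose2[OF indep_vars_subset[OF indep]]) (use Y in auto)
  then have "(\<integral>\<^sup>+\<omega>. (\<Prod>k\<in>{i, j}. Y k (v k \<omega>)) \<partial>M) = (\<Prod>k\<in>{i, j}. \<integral>\<^sup>+\<omega>. Y k (v k \<omega>) \<partial>M)"
    by (intro indep_vars_nn_integral) auto
  then show ?thesis
    using False by (simp add: Y_def nn_integral_indicator_translate)
qed

lemma expected_product_superposition:
  "(\<integral>\<^sup>+\<omega>. superposition a U I (\<lambda>i. v i \<omega>) x * superposition a U I (\<lambda>i. v i \<omega>) y \<partial>M)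
    \<le> (\<Sum>i\<in>I. a i * emeasure uniform_torus (U i)) * (\<Sum>i\<in>I. a i * emeasure uniform_torus (U i))
      + (\<Sum>i\<in>I. a i * a i * autocorrelation i x y)"
proof (cases "finite I")
  case fin: True
  let ?X = "\<lambda>x i \<omega>. indicator (U i) (torus_proj (x - v i \<omega>)) :: ennreal"
  let ?l = "\<lambda>i. emeasure uniform_torus (U i)"
  have "(\<integral>\<^sup>+\<omega>. superposition a U I (\<lambda>i. v i \<omega>) x * superposition a U I (\<lambda>i. v i \<omega>) y \<partial>M)
      = (\<integral>\<^sup>+\<omega>. (\<Sum>i\<in>I. \<Sum>j\<in>I. (a i * a j) * (?X x i \<omega> * ?X y j \<omega>)) \<partial>M)"
    unfolding superposition_def sum_product by (simp only: mult_ac)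
  also have "\<dots> = (\<Sum>i\<in>I. \<Sum>j\<in>I. (a i * a j) * (\<integral>\<^sup>+\<omega>. ?X x i \<omega> * ?X y j \<omega> \<partial>M))"
    by (simp add: nn_integral_sum nn_integral_cmult)
  also have "\<dots> \<le> (\<Sum>i\<in>I. \<Sum>j\<in>I. (a i * a j) * (?l i * ?l j + (if i = j then autocorrelation i x y else 0)))"
    by (intro sum_mono mult_left_mono expected_product_indicators) simp
  also have "\<dots> = (\<Sum>i\<in>I. \<Sum>j\<in>I. (a i * ?l i) * (a j * ?l j)) + (\<Sum>i\<in>I. \<Sum>j\<in>I. if j = i then a i * a i * autocorrelation i x y else 0)"
    unfolding sum.distrib[symmetric] by (intro sum.cong refl) (auto simp: algebra_simps)
  also have "\<dots> = (\<Sum>i\<in>I. a i * ?l i) * (\<Sum>i\<in>I. a i * ?l i) + (\<Sum>i\<in>I. a i * a i * autocorrelation i x y)"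
    using fin by (simp add: sum_product)
  finally show ?thesis .
qed (simp add: superposition_def)

text \<open>The off-diagonal terms see independent translates and contribute the energy of Lebesgue
  measure on \<open>B\<close>; the diagonal terms reduce to the energies of the \<open>U i\<close> by
  \<open>nn_integral_riesz_kernel_autocorrelation\<close>.\<close>

lemma expected_energy:
  assumes [measurable]: "B \<in> sets borel"
  shows "(\<integral>\<^sup>+\<omega>. weighted_energy t (\<lambda>x. superposition a U I (\<lambda>i. v i \<omega>) x * indicator B x) \<partial>M)
    \<le> (\<Sum>i\<in>I. a i * emeasure uniform_torus (U i)) * (\<Sum>i\<in>I. a i * emeasure uniform_torus (U i)) * torus_energy t B
      + emeasure uniform_torus B * (\<Sum>i\<in>I. a i * a i * torus_energy t (U i))"
proof -
  let ?\<mu> = "uniform_torus :: (real ^ 'n) measure"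
  define S where "S = (\<Sum>i\<in>I. a i * emeasure uniform_torus (U i))"
  let ?F = "\<lambda>\<omega> x. superposition a U I (\<lambda>i. v i \<omega>) x"
  define b :: "(real ^ 'n) \<times> (real ^ 'n) \<Rightarrow> ennreal" where
    "b = (\<lambda>p. riesz_kernel t (fst p) (snd p) * (indicator B (fst p) * indicator B (snd p)))"
  have [measurable]: "b \<in> borel_measurable (borel \<Otimes>\<^sub>M borel)"
    unfolding b_def by measurable
  interpret P: pair_sigma_finite M "?\<mu> \<Otimes>\<^sub>M ?\<mu>" ..
  have "(\<integral>\<^sup>+\<omega>. weighted_energy t (\<lambda>x. ?F \<omega> x * indicator B x) \<partial>M)
      = (\<integral>\<^sup>+\<omega>. (\<integral>\<^sup>+p. b p * (?F \<omega> (fst p) * ?F \<omega> (snd p)) \<partial>(?\<mu> \<Otimes>\<^sub>M ?\<mu>)) \<partial>M)"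
    unfolding weighted_energy_def b_def by (simp only: mult_ac)
  also have "\<dots> = (\<integral>\<^sup>+p. (\<integral>\<^sup>+\<omega>. b p * (?F \<omega> (fst p) * ?F \<omega> (snd p)) \<partial>M) \<partial>(?\<mu> \<Otimes>\<^sub>M ?\<mu>))"
    by (rule P.Fubini'[symmetric]) (simp add: case_prod_beta)
  also have "\<dots> \<le> (\<integral>\<^sup>+p. b p * (S * S + (\<Sum>i\<in>I. a i * a i * autocorrelation i (fst p) (snd p))) \<partial>(?\<mu> \<Otimes>\<^sub>M ?\<mu>))"
  proof (rule nn_integral_mono)
    fix p
    have [measurable]: "(\<lambda>\<omega>. ?F \<omega> x) \<in> borel_measurable M" for x
      by (rule borel_measurable_superposition) measurable
    have "(\<integral>\<^sup>+\<omega>. b p * (?F \<omega> (fst p) * ?F \<omega> (snd p)) \<partial>M) = b p * (\<integral>\<^sup>+\<omega>. ?F \<omega> (fst p) * ?F \<omega> (snd p) \<partial>M)"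
      by (rule nn_integral_cmult) measurable
    also have "\<dots> \<le> b p * (S * S + (\<Sum>i\<in>I. a i * a i * autocorrelation i (fst p) (snd p)))"
      by (intro mult_left_mono expected_product_superposition[where a = a and I = I, folded S_def]) simp
    finally show "(\<integral>\<^sup>+\<omega>. b p * (?F \<omega> (fst p) * ?F \<omega> (snd p)) \<partial>M)
        \<le> b p * (S * S + (\<Sum>i\<in>I. a i * a i * autocorrelation i (fst p) (snd p)))" .
  qed
  also have "\<dots> = (\<integral>\<^sup>+p. S * S * b p + (\<Sum>i\<in>I. a i * a i * (b p * autocorrelation i (fst p) (snd p))) \<partial>(?\<mu> \<Otimes>\<^sub>M ?\<mu>))"
    by (intro nn_integral_cong) (simp add: distrib_left sum_distrib_left mult_ac)
  also have "\<dots> = S * S * (\<integral>\<^sup>+p. b p \<partial>(?\<mu> \<Otimes>\<^sub>M ?\<mu>))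
      + (\<Sum>i\<in>I. a i * a i * (\<integral>\<^sup>+p. b p * autocorrelation i (fst p) (snd p) \<partial>(?\<mu> \<Otimes>\<^sub>M ?\<mu>)))"
    by (simp add: nn_integral_add nn_integral_sum nn_integral_cmult)
  also have "(\<integral>\<^sup>+p. b p \<partial>(?\<mu> \<Otimes>\<^sub>M ?\<mu>)) = torus_energy t B"
    unfolding weighted_energy_indicator[OF assms, symmetric] weighted_energy_def b_def ..
  also have "S * S * torus_energy t B + (\<Sum>i\<in>I. a i * a i * (\<integral>\<^sup>+p. b p * autocorrelation i (fst p) (snd p) \<partial>(?\<mu> \<Otimes>\<^sub>M ?\<mu>)))
      \<le> S * S * torus_energy t B + (\<Sum>i\<in>I. a i * a i * (emeasure ?\<mu> B * torus_energy t (U i)))"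
  proof (intro add_left_mono sum_mono mult_left_mono)
    fix i
    have "(\<integral>\<^sup>+p. b p * autocorrelation i (fst p) (snd p) \<partial>(?\<mu> \<Otimes>\<^sub>M ?\<mu>))
        = (\<integral>\<^sup>+x. (\<integral>\<^sup>+y. b (x, y) * autocorrelation i x y \<partial>?\<mu>) \<partial>?\<mu>)"
      by (subst uniform_torus.nn_integral_fst[symmetric]) auto
    also have "\<dots> \<le> (\<integral>\<^sup>+x. (\<integral>\<^sup>+y. indicator B x * (riesz_kernel t x y * autocorrelation i x y) \<partial>?\<mu>) \<partial>?\<mu>)"
      by (intro nn_integral_mono) (auto simp: indicator_def b_def)
    also have "\<dots> = (\<integral>\<^sup>+x. indicator B x * torus_energy t (U i) \<partial>?\<mu>)"
    proof (rule nn_integral_cong)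
      fix x
      have "(\<integral>\<^sup>+y. indicator B x * (riesz_kernel t x y * autocorrelation i x y) \<partial>?\<mu>)
          = indicator B x * (\<integral>\<^sup>+y. riesz_kernel t x y * autocorrelation i x y \<partial>?\<mu>)"
        by (rule nn_integral_cmult) measurable
      then show "(\<integral>\<^sup>+y. indicator B x * (riesz_kernel t x y * autocorrelation i x y) \<partial>?\<mu>)
          = indicator B x * torus_energy t (U i)"
        unfolding autocorrelation_def by (simp add: nn_integral_riesz_kernel_autocorrelation)
    qed
    also have "\<dots> = emeasure ?\<mu> B * torus_energy t (U i)"
      by (simp add: nn_integral_multc)
    finally show "(\<integral>\<^sup>+p. b p * autocorrelation i (fst p) (snd p) \<partial>(?\<mu> \<Otimes>\<^sub>M ?\<mu>)) \<le> emeasure ?\<mu> B * torus_energy t (U i)" .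
  qed simp
  also have "(\<Sum>i\<in>I. a i * a i * (emeasure ?\<mu> B * torus_energy t (U i))) = emeasure ?\<mu> B * (\<Sum>i\<in>I. a i * a i * torus_energy t (U i))"
    by (simp only: sum_distrib_left mult_ac)
  finally show ?thesis unfolding S_def .
qed

end

section \<open>Windows of indices with large total ratio\<close>

lemma torus_energy_dyadic_cube_le:
  fixes R B :: "(real ^ 'n::finite) set"
  assumes C: "\<And>(x :: real ^ 'n) r. 0 < r \<Longrightarrow>
      (\<integral>\<^sup>+y. riesz_kernel t x y * indicator {y. torus_dist x y < r} y \<partial>uniform_torus)
        \<le> ennreal (C * r powr (real CARD('n) - t))"
    and R: "R \<in> dyadic_cubes" and B [measurable]: "B \<in> sets borel" "B \<subseteq> R"
  shows "torus_energy t B \<le> ennreal (C * (2 * diameter R) powr (real CARD('n) - t)) * emeasure uniform_torus B"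
proof -
  have pos: "0 < 2 * diameter R" using diameter_dyadic_cubes_pos[OF R] by simp
  have "torus_energy t B = (\<integral>\<^sup>+x. (\<integral>\<^sup>+y. riesz_kernel t x y * indicator B y \<partial>uniform_torus) * indicator B x \<partial>uniform_torus)"
    by (rule torus_energy_eq_uniform_torus) measurable
  also have "\<dots> \<le> (\<integral>\<^sup>+x. ennreal (C * (2 * diameter R) powr (real CARD('n) - t)) * indicator B x \<partial>uniform_torus)"
  proof (rule nn_integral_mono)
    fix x
    show "(\<integral>\<^sup>+y. riesz_kernel t x y * indicator B y \<partial>uniform_torus) * indicator B x
        \<le> ennreal (C * (2 * diameter R) powr (real CARD('n) - t)) * indicator B x"
    proof (cases "x \<in> B")
      case True
      have near: "torus_dist x y < 2 * diameter R" if "y \<in> B" for y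
      proof -
        have "dist x y \<le> diameter R"
          using True that B(2) by (intro diameter_bounded_bound bounded_dyadic_cubes R) auto
        then show ?thesis using torus_dist_le_dist[of x y] pos by linarith
      qed
      have "(\<integral>\<^sup>+y. riesz_kernel t x y * indicator B y \<partial>uniform_torus)
          \<le> (\<integral>\<^sup>+y. riesz_kernel t x y * indicator {y. torus_dist x y < 2 * diameter R} y \<partial>uniform_torus)"
        using near by (intro nn_integral_mono mult_left_mono) (auto simp: indicator_def)
      also have "\<dots> \<le> ennreal (C * (2 * diameter R) powr (real CARD('n) - t))"
        using pos by (rule C)
      finally show ?thesis by (rule mult_right_mono) simp
    qed simp
  qed
  also have "\<dots> = ennreal (C * (2 * diameter R) powr (real CARD('n) - t)) * emeasure uniform_torus B"
    by (simp add: nn_integral_cmult_indicator)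
  finally show ?thesis .
qed

text \<open>The inequality can be strict for \<open>y = 0\<close> and for \<open>y = \<infinity>\<close>, where the left-hand side is \<open>0\<close>.\<close>

lemma ennreal_divide_mult_le: "(x / y) * y \<le> (x :: ennreal)"
proof -
  have "inverse y * y \<le> 1"
    by (cases y; cases "y = 0") (auto simp: inverse_ennreal ennreal_mult[symmetric])
  then have "x * (inverse y * y) \<le> x * 1" by (rule mult_left_mono) simp
  then show ?thesis by (simp add: divide_ennreal_def mult.assoc)
qed

lemma torus_in_dyadic_cubes: "(torus :: (real ^ 'n::finite) set) \<in> dyadic_cubes"
proof -
  have "(0 :: real ^ 'n) \<in> torus" by (simp add: torus_def)
  then show ?thesis using dyadic_cube_at_in_dyadic_cubes[of "0 :: real ^ 'n" 0] dyadic_cube_at_0[of "0 :: real ^ 'n"] by simp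
qed

context random_translates
begin

text \<open>With these weights \<open>a\<^sub>i\<close> the diagonal term \<open>a\<^sub>i\<^sup>2 I\<^sub>t(U\<^sub>i)\<close> of the expected energy and the term
  \<open>a\<^sub>i \<lambda>(U\<^sub>i)\<close> of the expected mass agree, up to conventions at \<open>0\<close> and \<open>\<infinity>\<close>: both are the \<open>i\<close>-th
  term of the series.\<close>

definition energy_weight :: "real \<Rightarrow> nat \<Rightarrow> ennreal" where
  "energy_weight t i = emeasure uniform_torus (U i) / torus_energy t (U i)"

definition energy_ratio :: "real \<Rightarrow> nat \<Rightarrow> ennreal" where
  "energy_ratio t i = emeasure uniform_torus (U i) ^ 2 / torus_energy t (U i)"

lemma energy_weight_times_volume: "energy_weight t i * emeasure uniform_torus (U i) = energy_ratio t i"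
  by (simp add: energy_weight_def energy_ratio_def divide_ennreal_def power2_eq_square mult_ac)

lemma energy_weight_squared_times_energy: "energy_weight t i * energy_weight t i * torus_energy t (U i) \<le> energy_ratio t i"
  using mult_left_mono[OF ennreal_divide_mult_le[of "emeasure uniform_torus (U i)" "torus_energy t (U i)"], of "energy_weight t i"]
  unfolding energy_weight_times_volume by (simp add: energy_weight_def mult.assoc)

text \<open>Vanishing energy forces vanishing volume, because the kernel is bounded below on the torus.\<close>

lemma energy_weight_finite:
  assumes t: "0 < t" shows "energy_weight t i < \<top>"
proof (cases "torus_energy t (U i) = 0")
  case True
  have "(\<lambda>x. indicator (U i) x * indicator torus x) = (indicator (U i) :: _ \<Rightarrow> ennreal)"
    using subset_U[of i] by (auto simp: indicator_def fun_eq_iff)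
  then have "emeasure uniform_torus (U i) * emeasure uniform_torus (U i)
      \<le> ennreal (diameter (torus :: (real ^ 'n) set) powr t) * torus_energy t (U i)"
    using mass_squared_le_energy[OF t _ torus_in_dyadic_cubes, of "indicator (U i)"]
    by (simp add: weighted_energy_indicator del: indicator_times_eq_if)
  then have "emeasure uniform_torus (U i) = 0"
    using True by simp
  then show ?thesis by (simp add: energy_weight_def)
next
  case False
  then show ?thesis
    using uniform_torus.emeasure_finite[of "U i"]
    unfolding energy_weight_def divide_ennreal_def ennreal_mult_less_top
    by (simp add: less_top[symmetric])
qed

lemma energy_ratio_finite: "0 < t \<Longrightarrow> energy_ratio t i < \<top>"
  unfolding energy_weight_times_volume[symmetric]
  unfolding ennreal_mult_less_top
  using energy_weight_finite[of t i] uniform_torus.emeasure_finite[of "U i"]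
  by (simp add: less_top[symmetric])

text \<open>The event that the mass inside \<open>R\<close> of the superposition over \<open>I\<close> is positive and its square at least \<open>c\<close> times
  the energy, for the translation vectors \<open>u\<close>. It depends on \<open>u\<close> only through the indices in \<open>I\<close>, so
  disjoint windows are independent.\<close>

definition large_window :: "real \<Rightarrow> real \<Rightarrow> (real ^ 'n) set \<Rightarrow> nat set \<Rightarrow> (nat \<Rightarrow> real ^ 'n) \<Rightarrow> bool" where
  "large_window t c R I u \<longleftrightarrow>
     (let f = \<lambda>x. superposition (energy_weight t) U I u x * indicator (interior R) x;
          m = (\<integral>\<^sup>+x. f x \<partial>uniform_torus)
      in 0 < m \<and> ennreal c * weighted_energy t f \<le> m * m)"

lemma large_window_cong:
  "(\<And>i. i \<in> I \<Longrightarrow> u i = u' i) \<Longrightarrow> large_window t c R I u = large_window t c R I u'"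
  by (simp add: large_window_def superposition_cong[of I u u'])

lemma
  fixes B :: "(real ^ 'n) set"
  assumes V: "\<And>i. i \<in> I \<Longrightarrow> V i \<in> borel_measurable N" and B [measurable]: "B \<in> sets borel"
  shows borel_measurable_superposition_mass:
      "(\<lambda>w. \<integral>\<^sup>+x. superposition a U I (\<lambda>i. V i w) x * indicator B x \<partial>uniform_torus) \<in> borel_measurable N"
    and borel_measurable_superposition_energy:
      "(\<lambda>w. weighted_energy t (\<lambda>x. superposition a U I (\<lambda>i. V i w) x * indicator B x)) \<in> borel_measurable N"
proof -
  have [measurable (raw)]: "(\<lambda>p. superposition a U I (\<lambda>i. V i (f p)) (X p)) \<in> borel_measurable K"
    if "f \<in> K \<rightarrow>\<^sub>M N" "X \<in> borel_measurable K" for f X and K :: "'c measure"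
    using measurable_compose[OF that(1) V] that(2) by (intro borel_measurable_superposition) auto
  show "(\<lambda>w. \<integral>\<^sup>+x. superposition a U I (\<lambda>i. V i w) x * indicator B x \<partial>uniform_torus) \<in> borel_measurable N"
    by (rule uniform_torus.borel_measurable_nn_integral) measurable
  show "(\<lambda>w. weighted_energy t (\<lambda>x. superposition a U I (\<lambda>i. V i w) x * indicator B x)) \<in> borel_measurable N"
    unfolding weighted_energy_def
    by (rule uniform_torus_pair.P.borel_measurable_nn_integral) measurable
qed

lemma large_window_sets:
  assumes V: "\<And>i. i \<in> I \<Longrightarrow> V i \<in> borel_measurable N"
  shows "{w \<in> space N. large_window t c R I (\<lambda>i. V i w)} \<in> sets N"
proof -
  note [measurable] = borel_measurable_superposition_mass[OF V] borel_measurable_superposition_energy[OF V]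
  have [measurable]: "interior R \<in> sets borel" by simp
  show ?thesis
    unfolding large_window_def Let_def by measurable
qed

lemma large_window_covers:
  assumes t: "0 < t" and c: "0 < c" and R: "R \<in> dyadic_cubes" and I: "finite I"
    and large: "large_window t c R I u"
    and QQ: "\<Q> \<subseteq> dyadic_cubes" and cover: "(\<Union>i\<in>I. torus_translate (u i) (U i)) \<inter> interior R \<subseteq> \<Union>\<Q>"
  shows "ennreal c \<le> cover_cost t \<Q>"
proof -
  let ?f = "\<lambda>x. superposition (energy_weight t) U I u x * indicator (interior R) x"
  have [measurable]: "(\<lambda>x. superposition (energy_weight t) U I u x) \<in> borel_measurable borel"
    by (rule borel_measurable_superposition) auto
  show ?thesis
  proof (rule cover_cost_ge_of_energy[OF t _ QQ _ refl _ _ c])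
    show "?f \<in> borel_measurable borel" by measurable
    show "x \<in> \<Union>\<Q>" if "?f x \<noteq> 0" for x
    proof -
      have x: "x \<in> interior R" "superposition (energy_weight t) U I u x \<noteq> 0"
        using that by (auto simp: indicator_def split: if_splits)
      obtain i where i: "i \<in> I" "energy_weight t i * indicator (U i) (torus_proj (x - u i)) \<noteq> 0"
        using x(2) unfolding superposition_def by (rule sum.not_neutral_contains_not_neutral)
      then have "torus_proj (x - u i) \<in> U i" by (auto simp: indicator_def split: if_splits)
      moreover have "x \<in> torus"
        using x(1) interior_subset dyadic_cubes_subset_torus[OF R] by blast
      ultimately have "x \<in> torus_translate (u i) (U i)"
        using mem_torus_translate_iff[OF subset_U] by blast
      then show ?thesis using i(1) x(1) cover by blast
    qed
    show "0 < (\<integral>\<^sup>+x. ?f x \<partial>uniform_torus)"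
      "ennreal c * weighted_energy t ?f \<le> (\<integral>\<^sup>+x. ?f x \<partial>uniform_torus) * (\<integral>\<^sup>+x. ?f x \<partial>uniform_torus)"
      using large by (auto simp: large_window_def Let_def)
    have "(\<integral>\<^sup>+x. ?f x \<partial>uniform_torus) \<le> (\<integral>\<^sup>+x. (\<Sum>i\<in>I. energy_weight t i) \<partial>(uniform_torus :: (real ^ 'n) measure))"
    proof (rule nn_integral_mono)
      fix x
      have "superposition (energy_weight t) U I u x \<le> (\<Sum>i\<in>I. energy_weight t i)"
        unfolding superposition_def by (intro sum_mono) (auto simp: indicator_def)
      then show "?f x \<le> (\<Sum>i\<in>I. energy_weight t i)"
        by (cases "x \<in> interior R") auto
    qed
    also have "\<dots> = (\<Sum>i\<in>I. energy_weight t i)"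
      by (simp add: prob_space.emeasure_space_1[OF prob_space_uniform_torus, simplified])
    also have "\<dots> < \<top>" using I energy_weight_finite[OF t] by (simp add: less_top[symmetric])
    finally show "(\<integral>\<^sup>+x. ?f x \<partial>uniform_torus) < \<top>" .
  qed
qed

text \<open>The energy of Lebesgue measure on \<open>R\<close> is at most \<open>const \<lambda>(R) |R| powr (d - t)\<close>, and \<open>|R|\<^sup>d\<close> is a
  constant multiple of \<open>\<lambda>(R)\<close>. Once \<open>S \<ge> |R|\<^sup>t / \<lambda>(R)\<close> the diagonal term \<open>S \<lambda>(R)\<close> is at most
  \<open>S\<^sup>2 \<lambda>(R)\<^sup>2 / |R|\<^sup>t\<close>, and \<open>second_moment_event\<close> applies with a constant \<open>D\<close> that does not depend on \<open>R\<close>.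
  Only the threshold for \<open>S\<close> depends on \<open>R\<close>.\<close>

lemma prob_large_window:
  assumes t: "0 < t" "t < real CARD('n)"
  shows "\<exists>c>0. \<exists>p>0. \<forall>R\<in>dyadic_cubes. \<exists>s. \<forall>I. finite I \<and> ennreal s \<le> (\<Sum>i\<in>I. energy_ratio t i) \<longrightarrow>
    p \<le> prob {\<omega> \<in> space M. large_window t (c * diameter R powr t) R I (\<lambda>i. v i \<omega>)}"
proof -
  let ?\<mu> = "uniform_torus :: (real ^ 'n) measure"
  define d where "d = CARD('n)"
  obtain C where C: "0 < C" "\<And>(x :: real ^ 'n) r. 0 < r \<Longrightarrow>
      (\<integral>\<^sup>+y. riesz_kernel t x y * indicator {y. torus_dist x y < r} y \<partial>?\<mu>)
        \<le> ennreal (C * r powr (real CARD('n) - t))"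
    using nn_integral_riesz_kernel_ball_le[OF t] by blast
  \<comment> \<open>The first summand comes from the energy of \<open>R\<close>, the \<open>1\<close> from the diagonal terms.\<close>
  define D where "D = C * 2 powr (real d - t) * sqrt (real d) ^ d + 1"
  have D: "0 < D" using C(1) by (simp add: D_def add_nonneg_pos)
  have main: "1 / (2 * D) \<le> prob {\<omega> \<in> space M. large_window t (1 / (4 * D) * diameter R powr t) R I (\<lambda>i. v i \<omega>)}"
    if R: "R \<in> dyadic_cubes" and I: "finite I"
      and S: "ennreal (diameter R powr t / measure ?\<mu> (interior R)) \<le> (\<Sum>i\<in>I. energy_ratio t i)" for R I
  proof -
    let ?B = "interior R" and ?a = "energy_weight t"
    let ?F = "\<lambda>\<omega> x. superposition ?a U I (\<lambda>i. v i \<omega>) x * indicator ?B x"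
    obtain n z where z: "R = dyadic_cube_at n z" using R by (auto elim: dyadic_cubesE)
    define l where "l = (1 / 2 ^ n :: real) ^ d"
    have l: "0 < l" by (simp add: l_def)
    define \<delta> where "\<delta> = diameter R"
    have \<delta>: "0 < \<delta>" using R by (simp add: \<delta>_def diameter_dyadic_cubes_pos)
    have BR: "?B \<subseteq> R" by (rule interior_subset)
    have B: "emeasure ?\<mu> ?B = ennreal l"
    proof -
      have "emeasure ?\<mu> ?B = emeasure lborel ?B"
        using BR dyadic_cubes_subset_torus[OF R]
        by (intro emeasure_uniform_torus order_trans[of ?B R torus]) auto
      also have "\<dots> = ennreal l"
        unfolding z l_def d_def by (rule emeasure_interior_dyadic_cube_at)
      finally show ?thesis .
    qed
    then have Bm: "measure ?\<mu> ?B = l" using l by (simp add: measure_def)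
    have dl: "\<delta> powr real d = sqrt (real d) ^ d * l"
    proof -
      have "\<delta> = sqrt (real d) * (1 / 2 ^ n)"
        by (simp add: \<delta>_def z diameter_dyadic_cube_at d_def)
      then have "\<delta> ^ d = sqrt (real d) ^ d * l"
        unfolding l_def by (simp only: power_mult_distrib)
      then show ?thesis using \<delta> by (simp only: powr_realpow)
    qed
    have "(\<Sum>i\<in>I. energy_ratio t i) < \<top>"
      using I energy_ratio_finite[OF t(1)] by (simp add: less_top[symmetric])
    then obtain S where S': "(\<Sum>i\<in>I. energy_ratio t i) = ennreal S" "0 \<le> S"
      by (cases "\<Sum>i\<in>I. energy_ratio t i") auto
    have S_ge: "\<delta> powr t / l \<le> S"
      using S S'(2) unfolding S'(1) Bm \<delta>_def[symmetric] by (simp only: ennreal_le_iff)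
    have "0 < \<delta> powr t / l" using \<delta> l by simp
    then have Spos: "0 < S" using S_ge by (rule less_le_trans)
    have mass_a: "(\<Sum>i\<in>I. ?a i * emeasure ?\<mu> (U i)) = ennreal S"
      by (simp add: energy_weight_times_volume S')
    have [measurable]: "?B \<in> sets borel" by simp
    have F_meas: "(\<lambda>\<omega>. \<integral>\<^sup>+x. ?F \<omega> x \<partial>?\<mu>) \<in> borel_measurable M"
      by (rule borel_measurable_superposition_mass) auto
    have E_meas: "(\<lambda>\<omega>. weighted_energy t (?F \<omega>)) \<in> borel_measurable M"
      by (rule borel_measurable_superposition_energy) auto
    have "1 / (2 * D) \<le> prob {\<omega> \<in> space M. 0 < (\<integral>\<^sup>+x. ?F \<omega> x \<partial>?\<mu>) \<and>
        ennreal (\<delta> powr t / (4 * D)) * weighted_energy t (?F \<omega>) \<le> (\<integral>\<^sup>+x. ?F \<omega> x \<partial>?\<mu>) * (\<integral>\<^sup>+x. ?F \<omega> x \<partial>?\<mu>)}"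
    proof (rule second_moment_event[OF F_meas E_meas, where \<mu> = "S * l"])
      show "0 < \<delta> powr t" "0 < S * l" "0 < D" using \<delta> Spos l D by auto
    next
      fix \<omega>
      have [measurable]: "(\<lambda>x. superposition ?a U I (\<lambda>i. v i \<omega>) x) \<in> borel_measurable borel"
        by (rule borel_measurable_superposition) auto
      have "?F \<omega> x * indicator R x = ?F \<omega> x" for x
        using BR by (auto simp: indicator_def)
      then show "(\<integral>\<^sup>+x. ?F \<omega> x \<partial>?\<mu>) * (\<integral>\<^sup>+x. ?F \<omega> x \<partial>?\<mu>) \<le> ennreal (\<delta> powr t) * weighted_energy t (?F \<omega>)"
        using mass_squared_le_energy[OF t(1) _ R, of "?F \<omega>"] by (simp add: \<delta>_def)
    next
      show "(\<integral>\<^sup>+\<omega>. (\<integral>\<^sup>+x. ?F \<omega> x \<partial>?\<mu>) \<partial>M) = ennreal (S * l)"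
        using expected_mass[of ?B ?a I] S'(2) l by (simp add: mass_a B ennreal_mult)
    next
      have "(\<integral>\<^sup>+\<omega>. weighted_energy t (?F \<omega>) \<partial>M)
          \<le> ennreal S * ennreal S * torus_energy t ?B + ennreal l * (\<Sum>i\<in>I. ?a i * ?a i * torus_energy t (U i))"
        using expected_energy[of ?B t ?a I] by (simp add: mass_a B)
      also have "\<dots> \<le> ennreal S * ennreal S * (ennreal (C * (2 * \<delta>) powr (real d - t)) * ennreal l) + ennreal l * ennreal S"
      proof (intro add_mono mult_left_mono)
        show "torus_energy t ?B \<le> ennreal (C * (2 * \<delta>) powr (real d - t)) * ennreal l"
          using torus_energy_dyadic_cube_le[OF C(2) R _ BR] by (simp add: \<delta>_def d_def B)
        show "(\<Sum>i\<in>I. ?a i * ?a i * torus_energy t (U i)) \<le> ennreal S"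
          unfolding S'(1)[symmetric] by (intro sum_mono energy_weight_squared_times_energy)
      qed auto
      also have "\<dots> = ennreal (S * S * (C * (2 * \<delta>) powr (real d - t) * l) + l * S)"
      proof -
        have nonneg: "0 \<le> C * (2 * \<delta>) powr (real d - t)" "0 \<le> l" using C(1) l by simp_all
        show ?thesis
          by (simp only: ennreal_plus ennreal_mult mult_nonneg_nonneg nonneg S'(2))
      qed
      finally have "ennreal (\<delta> powr t) * (\<integral>\<^sup>+\<omega>. weighted_energy t (?F \<omega>) \<partial>M)
          \<le> ennreal (\<delta> powr t) * ennreal (S * S * (C * (2 * \<delta>) powr (real d - t) * l) + l * S)"
        by (rule mult_left_mono) simp
      also have "\<dots> = ennreal (\<delta> powr t * (S * S * (C * (2 * \<delta>) powr (real d - t) * l) + l * S))"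
        by (rule ennreal_mult'[symmetric]) simp
      also have "\<dots> \<le> ennreal (D * (S * l)\<^sup>2)"
      proof (rule ennreal_leI)
        have 1: "\<delta> powr t * (2 * \<delta>) powr (real d - t) = 2 powr (real d - t) * (sqrt (real d) ^ d * l)"
        proof -
          have "(2 * \<delta>) powr (real d - t) = 2 powr (real d - t) * \<delta> powr (real d - t)"
            using \<delta> by (simp add: powr_mult)
          moreover have "\<delta> powr t * \<delta> powr (real d - t) = \<delta> powr real d"
            by (simp add: powr_add[symmetric])
          ultimately show ?thesis
            unfolding dl[symmetric] by (metis mult.left_commute)
        qed
        have "\<delta> powr t * (S * S * (C * (2 * \<delta>) powr (real d - t) * l) + l * S)
            = (\<delta> powr t * (2 * \<delta>) powr (real d - t)) * (S * S * C * l) + \<delta> powr t * (l * S)"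
          by (simp add: algebra_simps)
        also have "\<dots> = (D - 1) * (S * l)\<^sup>2 + \<delta> powr t * (l * S)"
          unfolding 1 by (simp add: D_def power2_eq_square)
        also have "\<delta> powr t * (l * S) \<le> (S * l) * (l * S)"
          using S_ge l Spos by (intro mult_right_mono) (auto simp: field_simps)
        also have "(D - 1) * (S * l)\<^sup>2 + (S * l) * (l * S) = D * (S * l)\<^sup>2"
          by (simp add: power2_eq_square algebra_simps)
        finally show "\<delta> powr t * (S * S * (C * (2 * \<delta>) powr (real d - t) * l) + l * S) \<le> D * (S * l)\<^sup>2"
          by simp
      qed
      finally show "ennreal (\<delta> powr t) * (\<integral>\<^sup>+\<omega>. weighted_energy t (?F \<omega>) \<partial>M) \<le> ennreal (D * (S * l)\<^sup>2)" .
    qed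
    then show ?thesis
      by (simp add: large_window_def Let_def \<delta>_def)
  qed
  have "\<forall>R\<in>dyadic_cubes. \<exists>s. \<forall>I. finite I \<and> ennreal s \<le> (\<Sum>i\<in>I. energy_ratio t i) \<longrightarrow>
      1 / (2 * D) \<le> prob {\<omega> \<in> space M. large_window t (1 / (4 * D) * diameter R powr t) R I (\<lambda>i. v i \<omega>)}"
    using main by (intro ballI exI allI impI) (erule conjE)
  moreover have "0 < 1 / (4 * D)" "0 < 1 / (2 * D)" using D by simp_all
  ultimately show ?thesis by blast
qed

text \<open>Finite terms and a divergent series allow cutting \<open>{n..}\<close> into consecutive blocks
  \<open>{N k..<N (k + 1)}\<close> whose partial sums all reach the threshold \<open>s\<close>.\<close>

lemma AE_ex_large_window:
  assumes t: "0 < t" and div: "(\<Sum>i. energy_ratio t i) = \<infinity>" and p: "0 < p"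
    and prob: "\<And>I. finite I \<Longrightarrow> ennreal s \<le> (\<Sum>i\<in>I. energy_ratio t i) \<Longrightarrow>
      p \<le> prob {\<omega> \<in> space M. large_window t c R I (\<lambda>i. v i \<omega>)}"
  shows "AE \<omega> in M. \<exists>I\<subseteq>{n..}. finite I \<and> large_window t c R I (\<lambda>i. v i \<omega>)"
proof -
  have "\<exists>N>k. ennreal s \<le> (\<Sum>i\<in>{k..<N}. energy_ratio t i)" for k
  proof (rule ccontr)
    assume none: "\<not> ?thesis"
    have "(\<Sum>i. energy_ratio t i) \<le> (\<Sum>i<Suc k. energy_ratio t i) + ennreal s"
    proof (rule suminf_le_const)
      fix N
      show "(\<Sum>i<N. energy_ratio t i) \<le> (\<Sum>i<Suc k. energy_ratio t i) + ennreal s"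
      proof (cases "k < N")
        case True
        then have "(\<Sum>i<N. energy_ratio t i) = (\<Sum>i<k. energy_ratio t i) + (\<Sum>i\<in>{k..<N}. energy_ratio t i)"
          by (subst sum.union_disjoint[symmetric]) (auto intro: sum.cong)
        also have "\<dots> \<le> (\<Sum>i<Suc k. energy_ratio t i) + ennreal s"
          using none True by (intro add_mono sum_mono2) (auto simp: not_le less_imp_le)
        finally show ?thesis .
      next
        case False
        then have "(\<Sum>i<N. energy_ratio t i) \<le> (\<Sum>i<Suc k. energy_ratio t i)"
          by (intro sum_mono2) auto
        then show ?thesis by (rule order_trans) simp
      qed
    qed auto
    also have "\<dots> < \<top>"
      using energy_ratio_finite[OF t] by (simp add: less_top[symmetric])
    finally show False using div by simp
  qed
  then obtain g where g: "\<And>k. k < g k" "\<And>k. ennreal s \<le> (\<Sum>i\<in>{k..<g k}. energy_ratio t i)"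
    by metis
  define N where "N = (\<lambda>k. (g ^^ k) n)"
  have N_Suc: "N (Suc k) = g (N k)" for k by (simp add: N_def)
  have N_mono: "strict_mono N" by (simp add: strict_mono_Suc_iff N_Suc g)
  define W where "W = (\<lambda>k. {N k..<N (Suc k)})"
  have W_disj: "disjoint_family_on W UNIV"
  proof -
    have "W j \<inter> W k = {}" if "j < k" for j k
    proof -
      have "N (Suc j) \<le> N k" using that strict_mono_mono[OF N_mono] by (simp add: monoD)
      then show ?thesis by (auto simp: W_def)
    qed
    then show ?thesis
      unfolding disjoint_family_on_def by (metis Int_commute linorder_neqE_nat)
  qed
  have "indep_vars (\<lambda>k. PiM (W k) (\<lambda>_. borel)) (\<lambda>k \<omega>. restrict (\<lambda>i. v i \<omega>) (W k)) UNIV"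
    by (rule indep_vars_restrict[OF indep _ W_disj]) simp
  then have "indep_events (\<lambda>k. {\<omega> \<in> space M. large_window t c R (W k) (restrict (\<lambda>i. v i \<omega>) (W k))}) UNIV"
  proof (rule indep_eventsI_indep_vars)
    fix k
    show "{u \<in> space (PiM (W k) (\<lambda>_. borel)). large_window t c R (W k) u} \<in> sets (PiM (W k) (\<lambda>_. borel))"
      using large_window_sets[of "W k" "\<lambda>i u. u i" "PiM (W k) (\<lambda>_. borel)" t c R] by simp
  qed
  also have "(\<lambda>k. {\<omega> \<in> space M. large_window t c R (W k) (restrict (\<lambda>i. v i \<omega>) (W k))})
      = (\<lambda>k. {\<omega> \<in> space M. large_window t c R (W k) (\<lambda>i. v i \<omega>)})"
    by (intro ext Collect_cong conj_cong refl large_window_cong) simp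
  finally have indep_W: "indep_events (\<lambda>k. {\<omega> \<in> space M. large_window t c R (W k) (\<lambda>i. v i \<omega>)}) UNIV" .
  have "AE \<omega> in M. \<exists>k. \<omega> \<in> {\<omega> \<in> space M. large_window t c R (W k) (\<lambda>i. v i \<omega>)}"
  proof (rule AE_ex_indep_events[OF indep_W p])
    show "p \<le> prob {\<omega> \<in> space M. large_window t c R (W k) (\<lambda>i. v i \<omega>)}" for k
      using g(2)[of "N k"] by (intro prob) (simp_all add: W_def N_Suc)
  qed
  then show ?thesis
  proof eventually_elim
    case (elim \<omega>)
    then obtain k where k: "large_window t c R (W k) (\<lambda>i. v i \<omega>)" by blast
    have "N 0 \<le> N k" using strict_mono_mono[OF N_mono] by (simp add: monoD)
    then have "W k \<subseteq> {n..}" by (auto simp: W_def N_def)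
    then show ?case using k by (intro exI[of _ "W k"]) (simp add: W_def)
  qed
qed

lemma AE_tail_cover_cost:
  assumes t: "0 < t" "t < real CARD('n)" and div: "(\<Sum>i. energy_ratio t i) = \<infinity>"
  shows "\<exists>c>0. AE \<omega> in M. \<forall>n. \<forall>R\<in>dyadic_cubes. \<forall>\<Q>\<subseteq>dyadic_cubes.
    (\<Union>i\<in>{n..}. torus_translate (v i \<omega>) (U i)) \<inter> interior R \<subseteq> \<Union>\<Q> \<longrightarrow>
      ennreal (c * diameter R powr t) \<le> cover_cost t \<Q>"
proof -
  obtain c p where c: "0 < c" and p: "0 < p"
    and prob: "\<And>R. R \<in> dyadic_cubes \<Longrightarrow> \<exists>s. \<forall>I. finite I \<and> ennreal s \<le> (\<Sum>i\<in>I. energy_ratio t i) \<longrightarrow>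
      p \<le> prob {\<omega> \<in> space M. large_window t (c * diameter R powr t) R I (\<lambda>i. v i \<omega>)}"
    using prob_large_window[OF t] by metis
  have "AE \<omega> in M. \<forall>\<Q>\<subseteq>dyadic_cubes.
      (\<Union>i\<in>{n..}. torus_translate (v i \<omega>) (U i)) \<inter> interior R \<subseteq> \<Union>\<Q> \<longrightarrow>
        ennreal (c * diameter R powr t) \<le> cover_cost t \<Q>"
    if R: "R \<in> dyadic_cubes" for n R
  proof -
    obtain s where s: "\<And>I. finite I \<Longrightarrow> ennreal s \<le> (\<Sum>i\<in>I. energy_ratio t i) \<Longrightarrow>
        p \<le> prob {\<omega> \<in> space M. large_window t (c * diameter R powr t) R I (\<lambda>i. v i \<omega>)}"
      using prob[OF R] by blast
    have cR: "0 < c * diameter R powr t"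
      using c diameter_dyadic_cubes_pos[OF R] by simp
    have "AE \<omega> in M. \<exists>I\<subseteq>{n..}. finite I \<and> large_window t (c * diameter R powr t) R I (\<lambda>i. v i \<omega>)"
      using t(1) div p s by (rule AE_ex_large_window)
    then show ?thesis
    proof eventually_elim
      case (elim \<omega>)
      then obtain I where I: "I \<subseteq> {n..}" "finite I" "large_window t (c * diameter R powr t) R I (\<lambda>i. v i \<omega>)"
        by blast
      show ?case
      proof (intro allI impI)
        fix \<Q> :: "(real ^ 'n) set set"
        assume QQ: "\<Q> \<subseteq> dyadic_cubes"
          and cover: "(\<Union>i\<in>{n..}. torus_translate (v i \<omega>) (U i)) \<inter> interior R \<subseteq> \<Union>\<Q>"
        have "(\<Union>i\<in>I. torus_translate (v i \<omega>) (U i)) \<subseteq> (\<Union>i\<in>{n..}. torus_translate (v i \<omega>) (U i))"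
          using I(1) by (rule UN_mono) simp
        then have "(\<Union>i\<in>I. torus_translate (v i \<omega>) (U i)) \<inter> interior R \<subseteq> \<Union>\<Q>"
          using cover by blast
        then show "ennreal (c * diameter R powr t) \<le> cover_cost t \<Q>"
          by (rule large_window_covers[OF t(1) cR R I(2,3) QQ])
      qed
    qed
  qed
  then have "AE \<omega> in M. \<forall>n. \<forall>R\<in>dyadic_cubes. \<forall>\<Q>\<subseteq>dyadic_cubes.
      (\<Union>i\<in>{n..}. torus_translate (v i \<omega>) (U i)) \<inter> interior R \<subseteq> \<Union>\<Q> \<longrightarrow>
        ennreal (c * diameter R powr t) \<le> cover_cost t \<Q>"
    by (simp add: AE_all_countable AE_ball_countable countable_dyadic_cubes)
  then show ?thesis using c by blast
qed

end

section \<open>The limsup set\<close>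

text \<open>In the interior of a cube the torus topology is the Euclidean one.\<close>

lemma open_Int_interior_dyadic_cube:
  assumes "openin torus_topology W" "R \<in> dyadic_cubes"
  shows "open (W \<inter> interior R)"
proof -
  have "x \<in> W \<longleftrightarrow> x \<in> torus_proj -` W" if "x \<in> interior R" for x
  proof -
    have "x \<in> torus"
      using that interior_subset dyadic_cubes_subset_torus[OF assms(2)] by blast
    then show ?thesis by (simp add: torus_proj_ident)
  qed
  then have "W \<inter> interior R = torus_proj -` W \<inter> interior R" by blast
  then show ?thesis
    using assms(1) by (simp add: openin_torus_topology_iff open_Int)
qed

context random_translates
begin

lemma AE_limsup_cover_cost:
  assumes t: "0 < t" "t < real CARD('n)" and div: "(\<Sum>i. energy_ratio t i) = \<infinity>"
    and op: "\<And>i. openin torus_topology (U i)"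
  shows "AE \<omega> in M. \<forall>R\<in>dyadic_cubes. \<forall>\<Q>\<subseteq>dyadic_cubes.
    (\<Inter>n. \<Union>i\<in>{n..}. torus_translate (v i \<omega>) (U i)) \<inter> R \<subseteq> \<Union>\<Q> \<longrightarrow>
      ennreal (diameter R powr t) \<le> cover_cost t \<Q>"
proof -
  obtain c where c: "0 < c" and ae: "AE \<omega> in M. \<forall>n. \<forall>R\<in>dyadic_cubes. \<forall>\<Q>\<subseteq>dyadic_cubes.
      (\<Union>i\<in>{n..}. torus_translate (v i \<omega>) (U i)) \<inter> interior R \<subseteq> \<Union>\<Q> \<longrightarrow>
        ennreal (c * diameter R powr t) \<le> cover_cost t \<Q>"
    using AE_tail_cover_cost[OF t div] by (elim exE conjE)
  from ae show ?thesis
  proof eventually_elim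
    case (elim \<omega>)
    let ?G = "\<lambda>n. \<Union>i\<in>{n..}. torus_translate (v i \<omega>) (U i)"
    show ?case
    proof (intro ballI allI impI)
      fix R :: "(real ^ 'n) set" and \<Q>
      assume R: "R \<in> dyadic_cubes" and QQ: "\<Q> \<subseteq> dyadic_cubes" and cover: "(\<Inter>n. ?G n) \<inter> R \<subseteq> \<Union>\<Q>"
      show "ennreal (diameter R powr t) \<le> cover_cost t \<Q>"
      proof (rule cover_cost_Inter_ge[OF _ _ t(1) R QQ cover])
        show "open (?G n \<inter> interior R')" if "R' \<in> dyadic_cubes" for n R'
          using op by (intro open_Int_interior_dyadic_cube openin_Union that) (auto intro: openin_torus_translate)
        show "ennreal (diameter R' powr t) \<le> cover_cost t \<P>"
          if "R' \<in> dyadic_cubes" "\<P> \<subseteq> dyadic_cubes" "?G n \<inter> interior R' \<subseteq> \<Union>\<P>" for n R' \<P>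
        proof (rule cover_cost_self_improvement[OF t(2) c _ t(1) that])
          show "ennreal (c * diameter R'' powr t) \<le> cover_cost t \<P>'"
            if "R'' \<in> dyadic_cubes" "\<P>' \<subseteq> dyadic_cubes" "?G n \<inter> interior R'' \<subseteq> \<Union>\<P>'" for R'' \<P>'
            using elim that by simp
        qed
      qed
    qed
  qed
qed

end

lemma energy_exponent_le: "energy_exponent (U :: nat \<Rightarrow> (real ^ 'n::finite) set) \<le> real CARD('n)"
  unfolding energy_exponent_def by (rule cInf_lower) (auto intro!: bdd_belowI[of _ 0])

lemma energy_series_diverges:
  fixes U :: "nat \<Rightarrow> (real ^ 'n::finite) set"
  assumes "0 < t" "t < energy_exponent U"
  shows "(\<Sum>i. emeasure torus_measure (U i) ^ 2 / torus_energy t (U i)) = \<infinity>"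
proof (rule ccontr)
  assume fin: "\<not> ?thesis"
  have "t < real CARD('n)" using assms(2) energy_exponent_le by (rule less_le_trans)
  then have "energy_exponent U \<le> t"
    unfolding energy_exponent_def using fin assms(1)
    by (intro cInf_lower) (auto intro!: bdd_belowI[of _ 0] simp: less_top)
  then show False using assms(2) by simp
qed

theorem theorem1:
  fixes M :: "'a measure"
    and U :: "nat \<Rightarrow> (real ^ 'n::finite) set"
    and v :: "nat \<Rightarrow> 'a \<Rightarrow> real ^ 'n"
  assumes "prob_space M"
    and "\<And>i. openin torus_topology (U i)"
    and "\<And>i. U i \<noteq> {}"
    and "prob_space.indep_vars M (\<lambda>_. torus_measure) v UNIV"
    and "\<And>i. distr M torus_measure (v i) = torus_measure"
  shows "AE \<omega> in M.
           (\<Inter>n. \<Union>i\<in>{n..}. torus_translate (v i \<omega>) (U i))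
             \<in> large_intersection_class (energy_exponent U)"
proof -
  interpret prob_space M by (rule assms(1))
  have U: "U i \<in> sets borel" "U i \<subseteq> torus" for i
    using assms(2)[of i] openin_torus_borel by (auto simp: openin_torus_topology_iff)
  interpret random_translates M U v
  proof
    show "indep_vars (\<lambda>_. borel) v UNIV"
      using indep_vars_compose2[OF assms(4), of "\<lambda>_ x. x" "\<lambda>_. borel"] by (simp add: measurable_ident_torus)
    have "v i \<in> M \<rightarrow>\<^sub>M torus_measure" for i
      using assms(4) by (simp add: indep_vars_def)
    then show "distr M borel (v i) = uniform_torus" for i
      unfolding uniform_torus_def
      by (subst assms(5)[of i, symmetric], subst distr_distr) (simp_all add: measurable_ident_torus comp_def)
  qed (use U in auto)
  define s where "s = energy_exponent U"
  have ratio: "energy_ratio t i = emeasure torus_measure (U i) ^ 2 / torus_energy t (U i)" for t i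
    by (simp add: energy_ratio_def emeasure_torus_measure U)
  let ?E = "\<lambda>\<omega>. \<Inter>n. \<Union>i\<in>{n..}. torus_translate (v i \<omega>) (U i)"
  \<comment> \<open>For \<open>s > 0\<close>, exponents in \<open>(0, s)\<close> that increase to \<open>s\<close>.\<close>
  define T where "T = (\<lambda>k :: nat. s - s / real (k + 2))"
  have T: "0 < T k" "T k < s" if "0 < s" for k
  proof -
    have "s / real (k + 2) < s / 1" by (rule divide_strict_left_mono) (use that in auto)
    then show "0 < T k" by (simp add: T_def)
    show "T k < s" using that by (simp add: T_def)
  qed
  have "AE \<omega> in M. \<forall>k. 0 < s \<longrightarrow> (\<forall>R\<in>dyadic_cubes. \<forall>\<Q>\<subseteq>dyadic_cubes. ?E \<omega> \<inter> R \<subseteq> \<Union>\<Q> \<longrightarrow>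
      ennreal (diameter R powr T k) \<le> cover_cost (T k) \<Q>)"
    unfolding AE_all_countable
  proof
    fix k
    show "AE \<omega> in M. 0 < s \<longrightarrow> (\<forall>R\<in>dyadic_cubes. \<forall>\<Q>\<subseteq>dyadic_cubes. ?E \<omega> \<inter> R \<subseteq> \<Union>\<Q> \<longrightarrow>
      ennreal (diameter R powr T k) \<le> cover_cost (T k) \<Q>)"
    proof (cases "0 < s")
      case True
      have "T k < real CARD('n)"
        using T(2)[OF True, of k] energy_exponent_le[of U] by (simp add: s_def)
      moreover have "(\<Sum>i. energy_ratio (T k) i) = \<infinity>"
        unfolding ratio using T[OF True] by (intro energy_series_diverges) (auto simp: s_def)
      ultimately have "AE \<omega> in M. \<forall>R\<in>dyadic_cubes. \<forall>\<Q>\<subseteq>dyadic_cubes. ?E \<omega> \<inter> R \<subseteq> \<Union>\<Q> \<longrightarrow>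
          ennreal (diameter R powr T k) \<le> cover_cost (T k) \<Q>"
        using T[OF True] assms(2) by (intro AE_limsup_cover_cost) auto
      then show ?thesis by (rule eventually_mono, intro impI)
    qed simp
  qed
  then show ?thesis
  proof eventually_elim
    case (elim \<omega>)
    have "gdelta_in torus_topology (?E \<omega>)"
    proof (rule gdelta_in_Inter)
      fix G assume "G \<in> range (\<lambda>n. \<Union>i\<in>{n..}. torus_translate (v i \<omega>) (U i))"
      then obtain n where "G = (\<Union>i\<in>{n..}. torus_translate (v i \<omega>) (U i))" by (rule rangeE)
      moreover have "openin torus_topology (\<Union>i\<in>{n..}. torus_translate (v i \<omega>) (U i))"
        using openin_torus_translate[OF assms(2)] by (intro openin_Union) (auto simp: image_iff)
      ultimately show "gdelta_in torus_topology G" by (simp only: open_imp_gdelta_in)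
    qed simp_all
    moreover have "dyadic_net_content t (?E \<omega> \<inter> R) = dyadic_net_content t R"
      if t: "0 < t" "t < s" and R: "R \<in> dyadic_cubes" for t R
    proof (rule dyadic_net_content_eqI[OF _ R])
      fix \<Q> :: "(real ^ 'n) set set"
      assume QQ: "\<Q> \<subseteq> dyadic_cubes" "?E \<omega> \<inter> R \<subseteq> \<Union>\<Q>"
      have s: "0 < s" using t by simp
      obtain k :: nat where k: "s / (s - t) < real k" using reals_Archimedean2 by blast
      then have "s < real k * (s - t)" using t by (simp add: field_simps)
      also have "\<dots> \<le> real (k + 2) * (s - t)" using t by (intro mult_right_mono) auto
      finally have "s / real (k + 2) \<le> s - t"
        using pos_divide_le_eq[of "real (k + 2)" s "s - t"] by (simp add: mult.commute)
      then have tT: "t \<le> T k" by (simp add: T_def)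
      show "ennreal (diameter R powr t) \<le> cover_cost t \<Q>"
      proof (rule cover_cost_exponent_mono[OF _ t(1) tT R QQ])
        show "ennreal (diameter R powr T k) \<le> cover_cost (T k) \<P>"
          if "\<P> \<subseteq> dyadic_cubes" "?E \<omega> \<inter> R \<subseteq> \<Union>\<P>" for \<P>
          using elim s R that by blast
      qed
    qed
    ultimately show ?case
      unfolding large_intersection_class_def s_def by blast
  qed
qed

end
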